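(* Let $a\in H^\infty$ be outer with $\ker T_{\overline{a}/a}\neq\{0\}$, and write $\ker T_{\overline{a}/a}=\gamma K_I$ with $\gamma$ the extremal function and $I$ the associated inner function. Let $N\in\mathbb{N}_0$ and $\zeta_0\in\mathbb{T}$. If $\zeta_0\in(AC)_{\overline{a},N}$, then $$k_{\zeta_0,\ell}^{\overline{a}}\in T_{\overline{a}}(\gamma K_I),\qquad 0\leqslant\ell\leqslant N.$$
   Context: $\mathbb{D}$ is the open unit disk, $\mathbb{T}$ the unit circle, $\mathbb{N}_0=\mathbb{N}\cup\{0\}$, $H^2$ the Hardy space with $\langle f,g\rangle_{H^2}=\int_{\mathbb{T}}f\overline{g}\,dm$ ($m$ normalized Lebesgue measure), $H^\infty$ the bounded analytic functions on $\mathbb{D}$. For $\varphi\in L^\infty(\mathbb{T})$, $T_\varphi f=P_+(\varphi f)$ on $H^2$, with $P_+:L^2\to H^2$ the orthogonal projection. For $I$ inner, $K_I:=H^2\ominus IH^2$. For $a\in H^\infty$ outer, $T_{\overline{a}}$ is injective; $\mathscr{M}(\overline{a}):=T_{\overline{a}}H^2$ with $\langle T_{\overline{a}}f,T_{\overline{a}}g\rangle_{\overline{a}}:=\langle f,g\rangle_{H^2}$. By the Hitt--Sarason theorem, if $M=\ker T_{\overline{a}/a}\ne\{0\}$ and $\gamma$ is the unique solution of $\sup\{\Re g(0):g\in M,\ \|g\|_{H^2}\leqslant1\}$, then there is an inner $I$ with $I(0)=0$ such that $M=\gamma K_I$. $\zeta_0\in(AC)_{\overline{a},N}$ means $\int_0^{2\pi}\frac{|a(e^{it})|^2}{|e^{it}-\zeta_0|^{2N+2}}\,dt<\infty$.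 In that case, for every $f\in\mathscr{M}(\overline{a})$ and $0\leqslant\ell\leqslant N$, $f^{(\ell)}$ has a finite non-tangential limit $f^{(\ell)}(\zeta_0)$ at $\zeta_0$, and $k_{\zeta_0,\ell}^{\overline{a}}\in\mathscr{M}(\overline{a})$ denotes the element with $f^{(\ell)}(\zeta_0)=\langle f,k_{\zeta_0,\ell}^{\overline{a}}\rangle_{\overline{a}}$ for all $f\in\mathscr{M}(\overline{a})$; explicitly $k_{\zeta_0,\ell}^{\overline{a}}=T_{\overline{a}}\left(\ell!\,\frac{z^\ell a}{(1-\overline{\zeta_0}z)^{\ell+1}}\right)$. *)

theory Defs
  imports "HOL-Complex_Analysis.Complex_Analysis"
begin

text \<open>
  Analytic functions on the open unit disk \<open>\<bbbD>\<close> are represented by their extension by \<open>0\<close>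
  to all of \<open>\<complex>\<close>.  Thus equality in HOL of two members of \<open>H2\<close> is equality on the disk, and
  the zero function is \<open>\<lambda>_. 0\<close>.  Boundary values are a separate object, see \<open>bdry\<close>.
\<close>

definition disk_analytic :: "(complex \<Rightarrow> complex) \<Rightarrow> bool" where
  "disk_analytic f \<longleftrightarrow> f holomorphic_on ball 0 1 \<and> (\<forall>z. z \<notin> ball 0 1 \<longrightarrow> f z = 0)"

text \<open>Normalized Lebesgue measure on the unit circle, as a Borel measure on \<open>\<complex>\<close>.\<close>

definition circle_measure :: "complex measure" where
  "circle_measure = distr (uniform_measure lborel {0..2 * pi}) borel cis"

text \<open>
  The boundary function on the unit circle, given by radial limits.  By Fatou's theorem the
  limit exists almost everywhere for \<open>f\<close> in \<open>H2\<close>; where it does not exist the value is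
  irrelevant.
\<close>

definition bdry :: "(complex \<Rightarrow> complex) \<Rightarrow> complex \<Rightarrow> complex" where
  "bdry f \<zeta> = Lim (at_left (1::real)) (\<lambda>r. f (of_real r * \<zeta>))"

definition H2 :: "(complex \<Rightarrow> complex) set" where
  "H2 = {f. disk_analytic f \<and>
     bdd_above ((\<lambda>r::real. \<integral>\<zeta>. (cmod (f (of_real r * \<zeta>)))\<^sup>2 \<partial>circle_measure) ` {0..<1})}"

definition Hinf :: "(complex \<Rightarrow> complex) set" where
  "Hinf = {f. disk_analytic f \<and> bounded (f ` ball 0 1)}"

definition L2_inner :: "(complex \<Rightarrow> complex) \<Rightarrow> (complex \<Rightarrow> complex) \<Rightarrow> complex" where
  "L2_inner f g = (\<integral>\<zeta>. f \<zeta> * cnj (g \<zeta>) \<partial>circle_measure)"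

definition H2_inner :: "(complex \<Rightarrow> complex) \<Rightarrow> (complex \<Rightarrow> complex) \<Rightarrow> complex" where
  "H2_inner f g = L2_inner (bdry f) (bdry g)"

definition H2_norm :: "(complex \<Rightarrow> complex) \<Rightarrow> real" where
  "H2_norm f = sqrt (Re (H2_inner f f))"

text \<open>
  The orthogonal projection of \<open>L\<^sup>2\<close> of the circle onto \<open>H2\<close>: the projection of \<open>g\<close> is the
  member \<open>h\<close> of \<open>H2\<close> for which \<open>g - h\<close> is orthogonal to \<open>H2\<close>.  Only meaningful for square
  integrable \<open>g\<close>.
\<close>

definition P_plus :: "(complex \<Rightarrow> complex) \<Rightarrow> complex \<Rightarrow> complex" where
  "P_plus g = (THE h. h \<in> H2 \<and> (\<forall>u\<in>H2. L2_inner (\<lambda>\<zeta>. g \<zeta> - bdry h \<zeta>) (bdry u) = 0))"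

definition toeplitz :: "(complex \<Rightarrow> complex) \<Rightarrow> (complex \<Rightarrow> complex) \<Rightarrow> complex \<Rightarrow> complex" where
  "toeplitz \<phi> f = P_plus (\<lambda>\<zeta>. \<phi> \<zeta> * bdry f \<zeta>)"

definition toeplitz_ker :: "(complex \<Rightarrow> complex) \<Rightarrow> (complex \<Rightarrow> complex) set" where
  "toeplitz_ker \<phi> = {f \<in> H2. toeplitz \<phi> f = (\<lambda>_. 0)}"

text \<open>
  Outer functions.  Since \<open>ln 0 = 0\<close> in HOL, the condition \<open>log |a| \<in> L\<^sup>1\<close> needs the separate
  clause that the boundary function is nonzero almost everywhere.
\<close>

definition outer_fun :: "(complex \<Rightarrow> complex) \<Rightarrow> bool" where
  "outer_fun a \<longleftrightarrow> disk_analytic a \<and>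
     (AE \<zeta> in circle_measure. bdry a \<zeta> \<noteq> 0) \<and>
     integrable circle_measure (\<lambda>\<zeta>. ln (cmod (bdry a \<zeta>))) \<and>
     (\<exists>c. cmod c = 1 \<and> (\<forall>z\<in>ball 0 1.
        a z = c * exp (\<integral>\<zeta>. (\<zeta> + z) / (\<zeta> - z) * of_real (ln (cmod (bdry a \<zeta>))) \<partial>circle_measure)))"

definition inner_fun :: "(complex \<Rightarrow> complex) \<Rightarrow> bool" where
  "inner_fun I \<longleftrightarrow> I \<in> Hinf \<and> (AE \<zeta> in circle_measure. cmod (bdry I \<zeta>) = 1)"

definition mult_space :: "(complex \<Rightarrow> complex) \<Rightarrow> (complex \<Rightarrow> complex) set \<Rightarrow> (complex \<Rightarrow> complex) set" where
  "mult_space g S = (\<lambda>f z. g z * f z) ` S"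

definition model_space :: "(complex \<Rightarrow> complex) \<Rightarrow> (complex \<Rightarrow> complex) set" where
  "model_space I = {f \<in> H2. \<forall>g\<in>mult_space I H2. H2_inner f g = 0}"

definition conj_symbol :: "(complex \<Rightarrow> complex) \<Rightarrow> complex \<Rightarrow> complex" where
  "conj_symbol a \<zeta> = cnj (bdry a \<zeta>)"

definition conj_quot_symbol :: "(complex \<Rightarrow> complex) \<Rightarrow> complex \<Rightarrow> complex" where
  "conj_quot_symbol a \<zeta> = cnj (bdry a \<zeta>) / bdry a \<zeta>"

definition range_space :: "(complex \<Rightarrow> complex) \<Rightarrow> (complex \<Rightarrow> complex) set" where
  "range_space a = toeplitz (conj_symbol a) ` H2"

text \<open>The range inner product; well defined when the Toeplitz operator is injective on \<open>H2\<close>.\<close>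

definition range_inner ::
  "(complex \<Rightarrow> complex) \<Rightarrow> (complex \<Rightarrow> complex) \<Rightarrow> (complex \<Rightarrow> complex) \<Rightarrow> complex" where
  "range_inner a F G =
     H2_inner (inv_into H2 (toeplitz (conj_symbol a)) F) (inv_into H2 (toeplitz (conj_symbol a)) G)"

definition extremal_solution :: "(complex \<Rightarrow> complex) set \<Rightarrow> (complex \<Rightarrow> complex) \<Rightarrow> bool" where
  "extremal_solution M g \<longleftrightarrow> g \<in> M \<and> H2_norm g \<le> 1 \<and>
     (\<forall>f\<in>M. H2_norm f \<le> 1 \<longrightarrow> Re (f 0) \<le> Re (g 0))"

definition extremal_fun :: "(complex \<Rightarrow> complex) set \<Rightarrow> (complex \<Rightarrow> complex) \<Rightarrow> bool" where
  "extremal_fun M \<gamma> \<longleftrightarrow> extremal_solution M \<gamma> \<and> (\<forall>g. extremal_solution M g \<longrightarrow> g = \<gamma>)"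

definition AC_condition :: "(complex \<Rightarrow> complex) \<Rightarrow> nat \<Rightarrow> complex \<Rightarrow> bool" where
  "AC_condition a N \<zeta>\<^sub>0 \<longleftrightarrow>
     (\<integral>\<^sup>+t\<in>{0..2 * pi}. ennreal ((cmod (bdry a (cis t)))\<^sup>2 / cmod (cis t - \<zeta>\<^sub>0) ^ (2 * N + 2)) \<partial>lborel) < \<infinity>"

definition stolz_region :: "real \<Rightarrow> complex \<Rightarrow> complex set" where
  "stolz_region \<alpha> \<zeta>\<^sub>0 = {z \<in> ball 0 1. cmod (z - \<zeta>\<^sub>0) < \<alpha> * (1 - cmod z)}"

definition has_nt_limit :: "(complex \<Rightarrow> complex) \<Rightarrow> complex \<Rightarrow> complex \<Rightarrow> bool" where
  "has_nt_limit f \<zeta>\<^sub>0 L \<longleftrightarrow> (\<forall>\<alpha>>1. (f \<longlongrightarrow> L) (at \<zeta>\<^sub>0 within stolz_region \<alpha> \<zeta>\<^sub>0))"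

text \<open>
  The element of the range space representing \<open>f \<mapsto> f\<^sup>(\<^sup>l\<^sup>)(\<zeta>\<^sub>0)\<close>, where the value at \<open>\<zeta>\<^sub>0\<close> is the
  non-tangential limit of the \<open>l\<close>-th derivative.
\<close>

definition range_kernel :: "(complex \<Rightarrow> complex) \<Rightarrow> complex \<Rightarrow> nat \<Rightarrow> complex \<Rightarrow> complex" where
  "range_kernel a \<zeta>\<^sub>0 l = (THE k. k \<in> range_space a \<and>
     (\<forall>f\<in>range_space a. has_nt_limit ((deriv ^^ l) f) \<zeta>\<^sub>0 (range_inner a f k)))"

end

theory Submission
  imports Defs
begin

text \<open>
  The kernel is \<open>k = T u\<close>, where \<open>T\<close> is the Toeplitz operator with symbol \<open>cnj a\<close> and
  \<open>u = l! z\<^sup>l a / (1 - cnj \<zeta>\<^sub>0 z)\<^sup>l\<^sup>+\<^sup>1\<close>, which lies in \<open>H2\<close> by the integrability condition at \<open>\<zeta>\<^sub>0\<close>.  Indeed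
  the \<open>l\<close>-th derivative of \<open>T g\<close> at \<open>z\<close> is the inner product of \<open>g\<close> with \<open>l! w\<^sup>l a / (1 - cnj z w)\<^sup>l\<^sup>+\<^sup>1\<close>, and for \<open>z\<close>
  tending to \<open>\<zeta>\<^sub>0\<close> in a Stolz region these functions are dominated on the circle by a multiple of \<open>\<bar>u\<bar>\<close>.
  As \<open>1 - cnj \<zeta>\<^sub>0 \<zeta> = - cnj \<zeta>\<^sub>0 \<zeta> cnj (1 - cnj \<zeta>\<^sub>0 \<zeta>)\<close> on the circle, \<open>(cnj a / a) u\<close> is there the conjugate of a
  function in \<open>z H2\<close>, so \<open>u\<close> belongs to the kernel of the Toeplitz operator with symbol \<open>cnj a / a\<close>.

  Radial limits exist almost everywhere because the tails of the power series satisfy a weak type maximal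
  inequality: the Poisson kernel is even and decreasing, so Poisson averages are controlled by averages over
  symmetric intervals, and Vitali's covering lemma applies.  The operator \<open>T\<close> is injective because the outer
  functions \<open>b\<^sub>n\<close> of modulus \<open>min n (1 / \<bar>a\<bar>)\<close> satisfy \<open>\<bar>a b\<^sub>n\<bar> \<le> 1\<close> and \<open>a b\<^sub>n \<rightarrow> 1\<close> at the origin, which
  forces \<open>a b\<^sub>n \<rightarrow> 1\<close> in mean square.
\<close>

subsection \<open>Normalized arc length\<close>

text \<open>\<open>bdry\<close> is a pointwise \<open>Lim\<close>, \<open>P_plus\<close> and
  \<open>range_kernel\<close> are definite descriptions, and \<open>range_inner\<close> inverts the
  Toeplitz operator with \<open>inv_into\<close>. Each of these terms has its intended value only
  once existence, uniqueness or injectivity is known, which is why so much Hardy space theory is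
  developed; its base is Parseval's identity for Taylor coefficients on circles of radius r < 1. The
  maximal inequality is of weak type for integrable functions; it reaches \<open>H2\<close> because
  the square of an analytic function is again analytic. Functions on the circle are not identified
  when they agree almost everywhere, so boundary identities hold almost everywhere, whereas analytic
  functions are compared by their values in the disk, which Szego kernels recover. Since the
  description of the kernel by \<gamma> and I is an assumption of the theorem, the claim amounts to
  an explicit preimage of the boundary kernel that the operator with symbol cnj a / a
  annihilates.\<close>

lemma sets_circle_measure [measurable_cong, simp]: "sets circle_measure = sets borel"
  by (simp add: circle_measure_def)

lemma space_circle_measure [simp]: "space circle_measure = UNIV"
  by (simp add: circle_measure_def)

lemma measurable_cis [measurable]: "cis \<in> borel_measurable borel"
  by (intro borel_measurable_continuous_onI continuous_intros)

lemma measurable_cnj [measurable]: "cnj \<in> borel_measurable borel"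
  by (intro borel_measurable_continuous_onI continuous_intros)

text \<open>A real-valued density is the form to which \<open>integral_density\<close> applies; it
  turns Bochner integrals over the circle into integrals over \<open>{0..2*pi}\<close>.\<close>

lemma uniform_measure_interval:
  "uniform_measure lborel {0..2*pi} = density lborel (\<lambda>t. ennreal (indicator {0..2*pi} t / (2*pi)))"
  unfolding uniform_measure_def
proof (intro density_cong AE_I2)
  fix t :: real
  have "(1::ennreal) / ennreal (2 * pi) = ennreal (1 / (2 * pi))"
    using divide_ennreal[of 1 "2*pi"] by simp
  then show "indicator {0..2*pi} t / emeasure lborel {0..2*pi} = ennreal (indicator {0..2*pi} t / (2*pi))"
    by (auto simp: indicator_def)
qed auto

lemma nn_integral_circle:
  assumes [measurable]: "f \<in> borel_measurable borel"
  shows "(\<integral>\<^sup>+\<zeta>. f \<zeta> \<partial>circle_measure) = (\<integral>\<^sup>+t\<in>{0..2*pi}. f (cis t) \<partial>lborel) / ennreal (2*pi)"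
  unfolding circle_measure_def
  by (simp add: nn_integral_distr nn_integral_uniform_measure)

lemma integral_circle:
  fixes f :: "complex \<Rightarrow> 'a::{banach, second_countable_topology}"
  assumes [measurable]: "f \<in> borel_measurable borel"
  shows "(\<integral>\<zeta>. f \<zeta> \<partial>circle_measure) = (1/(2*pi)) *\<^sub>R (LINT t:{0..2*pi}|lborel. f (cis t))"
  unfolding circle_measure_def uniform_measure_interval set_lebesgue_integral_def
  by (simp add: integral_distr integral_density flip: integral_scaleR_right)

lemma AE_circle:
  assumes [measurable]: "Measurable.pred borel P"
  shows "(AE \<zeta> in circle_measure. P \<zeta>) \<longleftrightarrow> (AE t in lborel. t \<in> {0..2*pi} \<longrightarrow> P (cis t))"
  unfolding circle_measure_def
  by (simp add: AE_distr_iff AE_uniform_measure)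

lemma AE_circle_norm: "AE \<zeta> in circle_measure. cmod \<zeta> = 1"
  by (subst AE_circle) auto

lemma emeasure_circle: "emeasure circle_measure UNIV = 1"
proof -
  have "emeasure circle_measure UNIV = (\<integral>\<^sup>+\<zeta>. 1 \<partial>circle_measure)" by simp
  also have "\<dots> = 1" by (subst nn_integral_circle) (auto simp: ennreal_divide_self)
  finally show ?thesis .
qed

global_interpretation circle: finite_measure circle_measure
  by standard (simp add: emeasure_circle)

lemma measure_circle [simp]: "measure circle_measure UNIV = 1"
  by (simp add: measure_def emeasure_circle)

text \<open>Arguments of one point differ by integer multiples of 2 pi. Countability makes single
  points null, so the singularity at \<open>\<zeta>\<^sub>0\<close> can be discarded later.\<close>

lemma countable_cis_vimage: "countable {t. cis t = c}"
proof (cases "\<exists>s. cis s = c")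
  case True
  then obtain s where s: "cis s = c" by blast
  have "{t. cis t = c} \<subseteq> range (\<lambda>n::int. s + 2 * pi * of_int n)"
  proof
    fix t assume "t \<in> {t. cis t = c}"
    then have "exp (\<i> * of_real t) = exp (\<i> * of_real s)" using s by (simp add: cis_conv_exp)
    then obtain n :: int where "\<i> * of_real t = \<i> * of_real s + (of_int (2 * n) * pi) * \<i>"
      unfolding exp_eq by blast
    then have "t = s + 2 * pi * of_int n" by (auto simp: complex_eq_iff)
    then show "t \<in> range (\<lambda>n::int. s + 2 * pi * of_int n)" by blast
  qed
  then show ?thesis by (rule countable_subset) auto
qed auto

lemma AE_circle_neq: "AE \<zeta> in circle_measure. \<zeta> \<noteq> c"
proof (subst AE_circle)
  have "AE t in lborel. t \<notin> {t. cis t = c}"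
    by (intro AE_not_in countable_imp_null_set_lborel countable_cis_vimage)
  then show "AE t in lborel. t \<in> {0..2*pi} \<longrightarrow> cis t \<noteq> c"
    by (auto elim!: eventually_mono)
qed auto

section \<open>Cauchy's formula and Parseval's identity on the circle\<close>

lemma integral_circle_HK:
  fixes f :: "complex \<Rightarrow> 'a::euclidean_space"
  assumes "f \<in> borel_measurable borel" and f: "continuous_on (sphere 0 1) f"
  shows "integrable circle_measure f"
    and "(\<integral>\<zeta>. f \<zeta> \<partial>circle_measure) = (1/(2*pi)) *\<^sub>R integral {0..2*pi} (\<lambda>t. f (cis t))"
proof -
  have [measurable]: "f \<in> borel_measurable borel" by fact
  have c: "continuous_on {0..2*pi} (\<lambda>t. f (cis t))"
    by (rule continuous_on_compose2[OF f]) (auto intro!: continuous_intros)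
  then have "set_integrable lborel {0..2*pi} (\<lambda>t. f (cis t))"
    unfolding set_integrable_def by (intro borel_integrable_compact) auto
  then show "(\<integral>\<zeta>. f \<zeta> \<partial>circle_measure) = (1/(2*pi)) *\<^sub>R integral {0..2*pi} (\<lambda>t. f (cis t))"
    by (subst integral_circle) (auto simp: set_borel_integral_eq_integral)
  have "compact (f ` sphere 0 1)" by (intro compact_continuous_image f) auto
  then obtain B where B: "\<And>z. z \<in> sphere 0 1 \<Longrightarrow> norm (f z) \<le> B"
    by (meson bounded_iff compact_imp_bounded imageI)
  show "integrable circle_measure f"
    by (rule circle.integrable_const_bound[of _ B])
       (use AE_circle_norm in \<open>auto elim!: eventually_mono intro: B\<close>)
qed

text \<open>On the unit circle d\<zeta> = i \<zeta> dt, so the contour formula divided by 2 pi i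
  becomes a mean over the circle with an extra factor \<zeta> in the numerator. Measurability of f
  is a separate assumption because \<open>circle_measure\<close> is a Borel measure on the whole
  plane.\<close>

lemma cauchy_circle:
  assumes m: "f \<in> borel_measurable borel" and c: "continuous_on (cball 0 1) f"
    and h: "f holomorphic_on ball 0 1" and z: "cmod z < 1"
  shows "(\<integral>\<zeta>. f \<zeta> * \<zeta> / (\<zeta> - z) ^ Suc l \<partial>circle_measure) = (deriv ^^ l) f z / fact l"
proof -
  have [measurable]: "f \<in> borel_measurable borel" by fact
  let ?I = "(2 * pi * \<i>) / (fact l) * (deriv ^^ l) f z"
  have "((\<lambda>u. f u / (u-z) ^ (Suc l)) has_contour_integral ?I) (part_circlepath 0 1 0 (2*pi))"
    using Cauchy_has_contour_integral_higher_derivative_circlepath[OF c h, of z l] z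
    by (simp add: circlepath_def)
  then have "((\<lambda>t. f (cis t) / (cis t - z) ^ Suc l * \<i> * cis t) has_integral ?I) {0..2*pi}"
    by (subst (asm) has_contour_integral_part_circlepath_iff) auto
  then have "((\<lambda>t. (1/\<i>) * (f (cis t) / (cis t - z) ^ Suc l * \<i> * cis t)) has_integral (1/\<i>) * ?I) {0..2*pi}"
    by (rule has_integral_mult_right)
  then have "((\<lambda>t. f (cis t) * cis t / (cis t - z) ^ Suc l) has_integral (1/\<i>) * ?I) {0..2*pi}"
  proof (rule has_integral_eq[rotated])
    show "(1/\<i>) * (f (cis t) / (cis t - z) ^ Suc l * \<i> * cis t) = f (cis t) * cis t / (cis t - z) ^ Suc l" for t
    proof -
      have "(1/\<i>) * (A / B * \<i> * C) = A * C / B" for A B C :: complex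
        using mult_minus_left[of 1 "A * C / B"] by (simp add: divide_inverse mult_ac flip: mult.assoc[of \<i> \<i>])
      then show ?thesis .
    qed
  qed
  then have *: "integral {0..2*pi} (\<lambda>t. f (cis t) * cis t / (cis t - z) ^ Suc l) = (1/\<i>) * ?I"
    by (rule integral_unique)
  show ?thesis
  proof (subst integral_circle_HK(2))
    show "continuous_on (sphere 0 1) (\<lambda>\<zeta>. f \<zeta> * \<zeta> / (\<zeta> - z) ^ Suc l)"
      using z by (intro continuous_intros continuous_on_subset[OF c]) auto
    show "(1/(2*pi)) *\<^sub>R integral {0..2*pi} (\<lambda>t. f (cis t) * cis t / (cis t - z) ^ Suc l) =
      (deriv ^^ l) f z / fact l"
      unfolding * by (simp add: scaleR_conv_of_real)
  qed auto
qed

lemma cauchy_circle_0: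
  assumes m: "f \<in> borel_measurable borel" and c: "continuous_on (cball 0 1) f"
    and h: "f holomorphic_on ball 0 1"
  shows "(\<integral>\<zeta>. f \<zeta> \<partial>circle_measure) = f 0"
proof -
  have [measurable]: "f \<in> borel_measurable borel" by fact
  have "(\<integral>\<zeta>. f \<zeta> \<partial>circle_measure) = (\<integral>\<zeta>. f \<zeta> * \<zeta> / (\<zeta> - 0) ^ Suc 0 \<partial>circle_measure)"
  proof (rule integral_cong_AE)
    show "AE \<zeta> in circle_measure. f \<zeta> = f \<zeta> * \<zeta> / (\<zeta> - 0) ^ Suc 0"
      using AE_circle_neq[of 0] by eventually_elim simp
  qed auto
  also have "\<dots> = f 0" using cauchy_circle[OF m c h, of 0 0] by simp
  finally show ?thesis .
qed

text \<open>For n \<le> m the integrand equals \<open>\<zeta> ^ (m - n)\<close> on the circle, and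
  its mean is the value \<open>0 ^ (m - n)\<close> at the origin; conjugation gives the other
  case.\<close>

lemma circle_moments:
  "(\<integral>\<zeta>. \<zeta> ^ m * cnj (\<zeta> ^ n) \<partial>circle_measure) = (if m = n then 1 else 0)"
proof -
  have le: "(\<integral>\<zeta>. \<zeta> ^ m * cnj (\<zeta> ^ n) \<partial>circle_measure) = (if m = n then 1 else 0)" if "n \<le> m" for m n
  proof -
    have "(\<integral>\<zeta>. \<zeta> ^ m * cnj (\<zeta> ^ n) \<partial>circle_measure) = (\<integral>\<zeta>. \<zeta> ^ (m - n) \<partial>circle_measure)"
    proof (rule integral_cong_AE)
      show "AE \<zeta> in circle_measure. \<zeta> ^ m * cnj (\<zeta> ^ n) = \<zeta> ^ (m - n)"
        using AE_circle_norm
      proof eventually_elim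
        case (elim \<zeta>)
        have "\<zeta> ^ m = \<zeta> ^ (m - n) * \<zeta> ^ n" using that by (simp flip: power_add)
        moreover have "\<zeta> ^ n * cnj (\<zeta> ^ n) = 1"
          using elim complex_norm_square[of \<zeta>] by (simp flip: power_mult_distrib)
        ultimately show ?case by (simp add: mult.assoc)
      qed
    qed auto
    also have "\<dots> = 0 ^ (m - n)"
      by (subst cauchy_circle_0) (auto intro!: continuous_intros holomorphic_intros)
    finally show ?thesis using that by auto
  qed
  show ?thesis
  proof (cases "n \<le> m")
    case False
    have "(\<integral>\<zeta>. \<zeta> ^ m * cnj (\<zeta> ^ n) \<partial>circle_measure) = (\<integral>\<zeta>. cnj (\<zeta> ^ n * cnj (\<zeta> ^ m)) \<partial>circle_measure)"
      by (simp add: mult.commute)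
    also have "\<dots> = cnj (\<integral>\<zeta>. \<zeta> ^ n * cnj (\<zeta> ^ m) \<partial>circle_measure)"
      by (rule Bochner_Integration.integral_cnj)
    also have "\<dots> = 0" using False by (subst le) auto
    finally show ?thesis using False by simp
  qed (rule le)
qed

lemma integrable_circle_bounded:
  fixes f :: "complex \<Rightarrow> 'a::{banach, second_countable_topology}"
  assumes "f \<in> borel_measurable borel" "AE \<zeta> in circle_measure. norm (f \<zeta>) \<le> B"
  shows "integrable circle_measure f"
  using circle.integrable_const_bound[of f B] assms by auto

lemma parseval_sum:
  "(\<integral>\<zeta>. (cmod (\<Sum>k<n. c k * \<zeta> ^ k))\<^sup>2 \<partial>circle_measure) = (\<Sum>k<n. (cmod (c k))\<^sup>2)"
proof -
  have int: "integrable circle_measure (\<lambda>\<zeta>. c j * cnj (c k) * (\<zeta> ^ j * cnj (\<zeta> ^ k)))" for j k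
    by (intro integrable_circle_bounded[where B="cmod (c j * c k)"])
       (use AE_circle_norm in \<open>auto elim!: eventually_mono simp: norm_mult norm_power\<close>)
  have "complex_of_real (\<integral>\<zeta>. (cmod (\<Sum>k<n. c k * \<zeta> ^ k))\<^sup>2 \<partial>circle_measure)
      = (\<integral>\<zeta>. complex_of_real ((cmod (\<Sum>k<n. c k * \<zeta> ^ k))\<^sup>2) \<partial>circle_measure)"
    by (rule integral_complex_of_real [symmetric])
  also have "\<dots> = (\<integral>\<zeta>. (\<Sum>j<n. \<Sum>k<n. c j * cnj (c k) * (\<zeta> ^ j * cnj (\<zeta> ^ k))) \<partial>circle_measure)"
    by (intro Bochner_Integration.integral_cong refl)
       (simp only: complex_norm_square cnj_sum sum_product complex_cnj_mult mult_ac)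
  also have "\<dots> = (\<Sum>j<n. \<Sum>k<n. c j * cnj (c k) * (if j = k then 1 else 0))"
    using int by (simp only: Bochner_Integration.integral_sum Bochner_Integration.integrable_sum
       integral_mult_right_zero circle_moments)
  also have "\<dots> = (\<Sum>j<n. c j * cnj (c j))"
    by (simp add: if_distrib cong: if_cong)
  also have "\<dots> = complex_of_real (\<Sum>k<n. (cmod (c k))\<^sup>2)"
    by (simp only: complex_norm_square of_real_sum)
  finally show ?thesis by (simp only: of_real_eq_iff)
qed

text \<open>Absolute summability allows dominated convergence by a constant. It is available for
  dilates: on a circle of radius r < 1 a Taylor series converges absolutely.\<close>

lemma parseval_summable:
  assumes c: "summable (\<lambda>n. cmod (c n))"
  shows "(\<lambda>n. (cmod (c n))\<^sup>2) sums (\<integral>\<zeta>. (cmod (\<Sum>n. c n * \<zeta> ^ n))\<^sup>2 \<partial>circle_measure)"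
proof -
  have s: "(\<lambda>n. \<Sum>k<n. c k * \<zeta> ^ k) \<longlonglongrightarrow> (\<Sum>n. c n * \<zeta> ^ n)"
    and b: "cmod (\<Sum>k<n. c k * \<zeta> ^ k) \<le> (\<Sum>n. cmod (c n))" if "cmod \<zeta> = 1" for \<zeta> n
  proof -
    have "summable (\<lambda>n. c n * \<zeta> ^ n)"
      by (rule summable_norm_cancel) (simp add: norm_mult norm_power that c)
    then show "(\<lambda>n. \<Sum>k<n. c k * \<zeta> ^ k) \<longlonglongrightarrow> (\<Sum>n. c n * \<zeta> ^ n)"
      by (rule summable_LIMSEQ)
    have "cmod (\<Sum>k<n. c k * \<zeta> ^ k) \<le> (\<Sum>k<n. cmod (c k))"
      by (rule order_trans[OF norm_sum]) (simp add: norm_mult norm_power that)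
    also have "\<dots> \<le> (\<Sum>n. cmod (c n))" by (rule sum_le_suminf) (auto intro: c)
    finally show "cmod (\<Sum>k<n. c k * \<zeta> ^ k) \<le> (\<Sum>n. cmod (c n))" .
  qed
  have "(\<lambda>n. \<integral>\<zeta>. (cmod (\<Sum>k<n. c k * \<zeta> ^ k))\<^sup>2 \<partial>circle_measure) \<longlonglongrightarrow>
    (\<integral>\<zeta>. (cmod (\<Sum>n. c n * \<zeta> ^ n))\<^sup>2 \<partial>circle_measure)"
  proof (rule integral_dominated_convergence[where w="\<lambda>_. (\<Sum>n. cmod (c n))\<^sup>2"])
    show "AE \<zeta> in circle_measure. (\<lambda>n. (cmod (\<Sum>k<n. c k * \<zeta> ^ k))\<^sup>2) \<longlonglongrightarrow> (cmod (\<Sum>n. c n * \<zeta> ^ n))\<^sup>2"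
      using AE_circle_norm by eventually_elim (intro tendsto_intros s)
    show "AE \<zeta> in circle_measure. norm ((cmod (\<Sum>k<n. c k * \<zeta> ^ k))\<^sup>2) \<le> (\<Sum>n. cmod (c n))\<^sup>2" for n
      using AE_circle_norm by eventually_elim (auto intro!: power_mono b)
  qed auto
  then show ?thesis unfolding sums_def parseval_sum .
qed

subsection \<open>Square integrable functions on the circle\<close>

text \<open>Borel functions on the plane rather than equivalence classes; the values off the circle
  do not affect \<open>L2_sq\<close>.\<close>

definition L2 :: "(complex \<Rightarrow> complex) set" where
  "L2 = {f \<in> borel_measurable borel. integrable circle_measure (\<lambda>\<zeta>. (cmod (f \<zeta>))\<^sup>2)}"

definition L2_sq :: "(complex \<Rightarrow> complex) \<Rightarrow> real" where
  "L2_sq f = (\<integral>\<zeta>. (cmod (f \<zeta>))\<^sup>2 \<partial>circle_measure)"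

lemma L2_measurable: "f \<in> L2 \<Longrightarrow> f \<in> borel_measurable borel"
  by (simp add: L2_def)

lemma L2_integrable_sq: "f \<in> L2 \<Longrightarrow> integrable circle_measure (\<lambda>\<zeta>. (cmod (f \<zeta>))\<^sup>2)"
  by (simp add: L2_def)

lemma L2_sq_nonneg [simp]: "0 \<le> L2_sq f"
  by (simp add: L2_sq_def)

lemma L2_dominated:
  assumes [measurable]: "f \<in> borel_measurable borel" and "g \<in> L2"
    and "AE \<zeta> in circle_measure. cmod (f \<zeta>) \<le> B * cmod (g \<zeta>)"
  shows "f \<in> L2"
proof -
  have "integrable circle_measure (\<lambda>\<zeta>. (cmod (f \<zeta>))\<^sup>2)"
  proof (rule Bochner_Integration.integrable_bound)
    show "integrable circle_measure (\<lambda>\<zeta>. B\<^sup>2 * (cmod (g \<zeta>))\<^sup>2)"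
      using assms by (intro integrable_mult_right L2_integrable_sq)
    show "AE \<zeta> in circle_measure. norm ((cmod (f \<zeta>))\<^sup>2) \<le> norm (B\<^sup>2 * (cmod (g \<zeta>))\<^sup>2)"
      using assms(3) by eventually_elim (auto simp flip: power_mult_distrib intro!: power_mono)
  qed simp
  then show ?thesis by (simp add: L2_def)
qed

lemma L2_bounded:
  assumes [measurable]: "f \<in> borel_measurable borel" and "AE \<zeta> in circle_measure. cmod (f \<zeta>) \<le> B"
  shows "f \<in> L2"
  by (rule L2_dominated[of _ "\<lambda>_. 1" B]) (use assms in \<open>auto simp: L2_def\<close>)

lemma power_L2: "(\<lambda>\<zeta>. \<zeta> ^ n) \<in> L2"
  by (rule L2_bounded[of _ 1]) (use AE_circle_norm in \<open>auto elim!: eventually_mono simp: norm_power\<close>)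

lemma L2_bounded_mult:
  assumes [measurable]: "f \<in> borel_measurable borel" and b: "AE \<zeta> in circle_measure. cmod (f \<zeta>) \<le> B"
    and g: "g \<in> L2"
  shows "(\<lambda>\<zeta>. f \<zeta> * g \<zeta>) \<in> L2"
proof (rule L2_dominated[OF _ g])
  show "AE \<zeta> in circle_measure. cmod (f \<zeta> * g \<zeta>) \<le> B * cmod (g \<zeta>)"
    using b by eventually_elim (auto simp: norm_mult intro: mult_right_mono)
qed (use L2_measurable[OF g] in measurable)

lemma L2_cnj: "f \<in> L2 \<Longrightarrow> (\<lambda>\<zeta>. cnj (f \<zeta>)) \<in> L2"
  by (auto simp: L2_def)

lemma L2_sq_cnj [simp]: "L2_sq (\<lambda>\<zeta>. cnj (f \<zeta>)) = L2_sq f"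
  by (simp add: L2_sq_def)

lemma L2_norm_mult_integrable:
  assumes f: "f \<in> L2" and g: "g \<in> L2"
  shows "integrable circle_measure (\<lambda>\<zeta>. cmod (f \<zeta>) * cmod (g \<zeta>))"
proof (rule Bochner_Integration.integrable_bound)
  show "integrable circle_measure (\<lambda>\<zeta>. (cmod (f \<zeta>))\<^sup>2 + (cmod (g \<zeta>))\<^sup>2)"
    using assms by (intro Bochner_Integration.integrable_add L2_integrable_sq)
  have "x * y \<le> x\<^sup>2 + y\<^sup>2" if "0 \<le> x" "0 \<le> y" for x y :: real
    using sum_squares_bound[of x y] mult_nonneg_nonneg[OF that] by linarith
  then show "AE \<zeta> in circle_measure. norm (cmod (f \<zeta>) * cmod (g \<zeta>)) \<le> norm ((cmod (f \<zeta>))\<^sup>2 + (cmod (g \<zeta>))\<^sup>2)"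
    by (intro AE_I2) (auto simp: abs_mult)
qed (use L2_measurable[OF f] L2_measurable[OF g] in measurable)

lemma L2_mult_integrable:
  assumes f: "f \<in> L2" and g: "g \<in> L2"
  shows "integrable circle_measure (\<lambda>\<zeta>. f \<zeta> * g \<zeta>)"
proof -
  have [measurable]: "f \<in> borel_measurable borel" "g \<in> borel_measurable borel"
    using f g by (auto intro: L2_measurable)
  show ?thesis
    by (rule Bochner_Integration.integrable_bound[OF L2_norm_mult_integrable[OF f g]])
       (auto simp: norm_mult)
qed

lemma L2_add:
  assumes f: "f \<in> L2" and g: "g \<in> L2"
  shows "(\<lambda>\<zeta>. f \<zeta> + g \<zeta>) \<in> L2"
proof -
  have [measurable]: "f \<in> borel_measurable borel" "g \<in> borel_measurable borel"
    using f g by (auto intro: L2_measurable)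
  have "integrable circle_measure (\<lambda>\<zeta>. (cmod (f \<zeta> + g \<zeta>))\<^sup>2)"
  proof (rule Bochner_Integration.integrable_bound)
    show "integrable circle_measure (\<lambda>\<zeta>. 2 * (cmod (f \<zeta>))\<^sup>2 + 2 * (cmod (g \<zeta>))\<^sup>2)"
      using assms by (intro Bochner_Integration.integrable_add integrable_mult_right L2_integrable_sq)
    have "(cmod (u + v))\<^sup>2 \<le> 2 * (cmod u)\<^sup>2 + 2 * (cmod v)\<^sup>2" for u v
    proof -
      have "(cmod (u + v))\<^sup>2 \<le> (cmod u + cmod v)\<^sup>2" by (intro power_mono norm_triangle_ineq) auto
      also have "\<dots> \<le> 2 * (cmod u)\<^sup>2 + 2 * (cmod v)\<^sup>2"
        using sum_squares_bound[of "cmod u" "cmod v"] by (simp add: power2_sum)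
      finally show ?thesis .
    qed
    then show "AE \<zeta> in circle_measure. norm ((cmod (f \<zeta> + g \<zeta>))\<^sup>2) \<le> norm (2 * (cmod (f \<zeta>))\<^sup>2 + 2 * (cmod (g \<zeta>))\<^sup>2)"
      by (intro AE_I2) auto
  qed auto
  then show ?thesis by (simp add: L2_def)
qed

lemma L2_minus: "f \<in> L2 \<Longrightarrow> (\<lambda>\<zeta>. - f \<zeta>) \<in> L2"
  by (auto simp: L2_def)

lemma L2_diff: "f \<in> L2 \<Longrightarrow> g \<in> L2 \<Longrightarrow> (\<lambda>\<zeta>. f \<zeta> - g \<zeta>) \<in> L2"
  using L2_add[of f "\<lambda>\<zeta>. - g \<zeta>"] L2_minus by simp

text \<open>The integral of (|f| - t |g|)^2 is nonnegative for every real t, which bounds the mixed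
  term M. The product carries no conjugate; the sesquilinear version comes from replacing g by its
  conjugate with \<open>L2_cnj\<close>.\<close>

lemma L2_cauchy_schwarz:
  assumes f: "f \<in> L2" and g: "g \<in> L2"
  shows "cmod (\<integral>\<zeta>. f \<zeta> * g \<zeta> \<partial>circle_measure) \<le> sqrt (L2_sq f) * sqrt (L2_sq g)"
proof -
  define M where "M = (\<integral>\<zeta>. cmod (f \<zeta>) * cmod (g \<zeta>) \<partial>circle_measure)"
  have "0 \<le> M" by (simp add: M_def)
  have q: "0 \<le> L2_sq f - 2 * t * M + t\<^sup>2 * L2_sq g" for t
  proof -
    have "0 \<le> (\<integral>\<zeta>. (cmod (f \<zeta>) - t * cmod (g \<zeta>))\<^sup>2 \<partial>circle_measure)" by simp
    also have "\<dots> = (\<integral>\<zeta>. (cmod (f \<zeta>))\<^sup>2 - 2 * t * (cmod (f \<zeta>) * cmod (g \<zeta>)) + t\<^sup>2 * (cmod (g \<zeta>))\<^sup>2 \<partial>circle_measure)"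
      by (intro Bochner_Integration.integral_cong) (auto simp: power2_eq_square algebra_simps)
    also have "\<dots> = L2_sq f - 2 * t * M + t\<^sup>2 * L2_sq g"
      using L2_integrable_sq[OF f] L2_integrable_sq[OF g] L2_norm_mult_integrable[OF f g]
      by (simp add: L2_sq_def M_def)
    finally show ?thesis .
  qed
  have "M\<^sup>2 \<le> L2_sq f * L2_sq g"
  proof (cases "L2_sq g = 0")
    case True
    have "M = 0"
    proof (rule ccontr)
      assume "M \<noteq> 0"
      \<comment> \<open>For this t the expression in \<open>q\<close>, here linear in t, equals
        -1.\<close>
      with q[of "(L2_sq f + 1) / (2 * M)"] True show False by simp
    qed
    then show ?thesis by simp
  next
    case False
    then have pos: "0 < L2_sq g" using L2_sq_nonneg[of g] by linarith
    \<comment> \<open>t = \<open>M / L2_sq g\<close> is the minimum point of the quadratic.\<close>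
    have "0 \<le> (L2_sq f - 2 * (M / L2_sq g) * M + (M / L2_sq g)\<^sup>2 * L2_sq g) * L2_sq g"
      using q[of "M / L2_sq g"] pos by simp
    also have "\<dots> = L2_sq f * L2_sq g - M\<^sup>2"
      using pos by (simp add: field_simps power2_eq_square)
    finally show ?thesis by simp
  qed
  then have "M \<le> sqrt (L2_sq f) * sqrt (L2_sq g)"
    by (simp add: real_le_rsqrt flip: real_sqrt_mult)
  moreover have "cmod (\<integral>\<zeta>. f \<zeta> * g \<zeta> \<partial>circle_measure) \<le> M"
    unfolding M_def norm_mult [symmetric] by (rule integral_norm_bound)
  ultimately show ?thesis by simp
qed

text \<open>An arbitrary filter with membership in \<open>L2\<close> only eventually: this serves
  sequences as well as dilates whose radius tends to 1 from the left, where square integrability is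
  known for radii in [0, 1).\<close>

lemma L2_tendsto_integral:
  assumes f: "\<forall>\<^sub>F n in F. f n \<in> L2" and h: "h \<in> L2" and g: "g \<in> L2"
    and lim: "((\<lambda>n. L2_sq (\<lambda>\<zeta>. f n \<zeta> - h \<zeta>)) \<longlongrightarrow> 0) F"
  shows "((\<lambda>n. \<integral>\<zeta>. f n \<zeta> * g \<zeta> \<partial>circle_measure) \<longlongrightarrow> (\<integral>\<zeta>. h \<zeta> * g \<zeta> \<partial>circle_measure)) F"
proof (rule LIM_zero_cancel, rule Lim_null_comparison)
  show "\<forall>\<^sub>F n in F. norm ((\<integral>\<zeta>. f n \<zeta> * g \<zeta> \<partial>circle_measure) - (\<integral>\<zeta>. h \<zeta> * g \<zeta> \<partial>circle_measure))
      \<le> sqrt (L2_sq (\<lambda>\<zeta>. f n \<zeta> - h \<zeta>)) * sqrt (L2_sq g)"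
    using f
  proof eventually_elim
    case (elim n)
    have "(\<integral>\<zeta>. f n \<zeta> * g \<zeta> \<partial>circle_measure) - (\<integral>\<zeta>. h \<zeta> * g \<zeta> \<partial>circle_measure)
        = (\<integral>\<zeta>. (f n \<zeta> - h \<zeta>) * g \<zeta> \<partial>circle_measure)"
      using L2_mult_integrable[OF elim g] L2_mult_integrable[OF h g] by (simp add: algebra_simps)
    then show ?case using L2_cauchy_schwarz[OF L2_diff[OF elim h] g] by simp
  qed
  show "((\<lambda>n. sqrt (L2_sq (\<lambda>\<zeta>. f n \<zeta> - h \<zeta>)) * sqrt (L2_sq g)) \<longlongrightarrow> 0) F"
    using tendsto_mult_left_zero[OF tendsto_real_sqrt[OF lim, simplified]] by simp
qed

lemma L2_sq_diff:
  assumes f: "f \<in> L2" and g: "g \<in> L2"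
  shows "L2_sq (\<lambda>\<zeta>. f \<zeta> - g \<zeta>) = L2_sq f + L2_sq g - 2 * (\<integral>\<zeta>. Re (f \<zeta> * cnj (g \<zeta>)) \<partial>circle_measure)"
proof -
  have "L2_sq (\<lambda>\<zeta>. f \<zeta> - g \<zeta>) =
    (\<integral>\<zeta>. (cmod (f \<zeta>))\<^sup>2 + (cmod (g \<zeta>))\<^sup>2 - 2 * Re (f \<zeta> * cnj (g \<zeta>)) \<partial>circle_measure)"
    unfolding L2_sq_def
    by (intro Bochner_Integration.integral_cong refl)
       (simp only: cmod_power2, simp add: power2_eq_square algebra_simps)
  also have "\<dots> = L2_sq f + L2_sq g - 2 * (\<integral>\<zeta>. Re (f \<zeta> * cnj (g \<zeta>)) \<partial>circle_measure)"
    using L2_integrable_sq[OF f] L2_integrable_sq[OF g] L2_mult_integrable[OF f L2_cnj[OF g]]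
    by (simp add: L2_sq_def del: integral_Re times_complex.sel complex_cnj)
  finally show ?thesis .
qed

lemma L2_sq_diff_le:
  assumes f: "f \<in> L2" and g: "g \<in> L2"
  shows "\<bar>sqrt (L2_sq f) - sqrt (L2_sq g)\<bar> \<le> sqrt (L2_sq (\<lambda>\<zeta>. f \<zeta> - g \<zeta>))"
proof (rule power2_le_imp_le)
  have "(\<integral>\<zeta>. Re (f \<zeta> * cnj (g \<zeta>)) \<partial>circle_measure) = Re (\<integral>\<zeta>. f \<zeta> * cnj (g \<zeta>) \<partial>circle_measure)"
    by (rule integral_Re[OF L2_mult_integrable[OF f L2_cnj[OF g]]])
  also have "\<dots> \<le> sqrt (L2_sq f) * sqrt (L2_sq g)"
    using order_trans[OF complex_Re_le_cmod L2_cauchy_schwarz[OF f L2_cnj[OF g]]] by simp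
  finally have "2 * (\<integral>\<zeta>. Re (f \<zeta> * cnj (g \<zeta>)) \<partial>circle_measure) \<le> 2 * (sqrt (L2_sq f) * sqrt (L2_sq g))"
    by linarith
  moreover note L2_sq_diff[OF f g]
  moreover have "\<bar>sqrt (L2_sq f) - sqrt (L2_sq g)\<bar>\<^sup>2 = L2_sq f + L2_sq g - 2 * (sqrt (L2_sq f) * sqrt (L2_sq g))"
    by (simp add: power2_diff)
  ultimately show "\<bar>sqrt (L2_sq f) - sqrt (L2_sq g)\<bar>\<^sup>2 \<le> (sqrt (L2_sq (\<lambda>\<zeta>. f \<zeta> - g \<zeta>)))\<^sup>2"
    unfolding real_sqrt_pow2[OF L2_sq_nonneg] power2_abs by linarith
qed simp

lemma L2_tendsto_sq:
  assumes f: "\<forall>\<^sub>F n in F. f n \<in> L2" and h: "h \<in> L2"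
    and lim: "((\<lambda>n. L2_sq (\<lambda>\<zeta>. f n \<zeta> - h \<zeta>)) \<longlongrightarrow> 0) F"
  shows "((\<lambda>n. L2_sq (f n)) \<longlongrightarrow> L2_sq h) F"
proof -
  have "((\<lambda>n. sqrt (L2_sq (f n))) \<longlongrightarrow> sqrt (L2_sq h)) F"
  proof (rule LIM_zero_cancel, rule Lim_null_comparison)
    show "((\<lambda>n. sqrt (L2_sq (\<lambda>\<zeta>. f n \<zeta> - h \<zeta>))) \<longlongrightarrow> 0) F"
      using tendsto_real_sqrt[OF lim] by simp
    show "\<forall>\<^sub>F n in F. norm (sqrt (L2_sq (f n)) - sqrt (L2_sq h)) \<le> sqrt (L2_sq (\<lambda>\<zeta>. f n \<zeta> - h \<zeta>))"
      using f by eventually_elim (use L2_sq_diff_le[OF _ h] in simp)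
  qed
  from tendsto_power[OF this, of 2] show ?thesis by simp
qed

subsection \<open>Power series and the Hardy space\<close>

definition taylor :: "(complex \<Rightarrow> complex) \<Rightarrow> (nat \<Rightarrow> complex) \<Rightarrow> bool" where
  "taylor f c \<longleftrightarrow> disk_analytic f \<and> (\<forall>z\<in>ball 0 1. (\<lambda>n. c n * z ^ n) sums f z)"

lemma disk_analytic_taylor: "disk_analytic f \<Longrightarrow> \<exists>c. taylor f c"
  using holomorphic_power_series[of f 0 1]
  by (intro exI[of _ "\<lambda>n. (deriv ^^ n) f 0 / fact n"]) (auto simp: taylor_def disk_analytic_def)

text \<open>Produces an analytic function from prescribed coefficients; the orthogonal projection is
  built this way from Fourier coefficients. Bounded coefficients are dominated by a geometric
  series.\<close>

lemma taylor_of_bounded: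
  assumes "bounded (range c)"
  shows "taylor (\<lambda>z. if cmod z < 1 then \<Sum>n. c n * z ^ n else 0) c"
proof -
  obtain B where B: "\<And>n. cmod (c n) \<le> B" using assms by (auto simp: bounded_iff)
  have s: "(\<lambda>n. c n * z ^ n) sums (if cmod z < 1 then \<Sum>n. c n * z ^ n else 0)" if "z \<in> ball 0 1" for z
  proof -
    have "summable (\<lambda>n. c n * z ^ n)"
    proof (rule summable_comparison_test)
      show "\<exists>N. \<forall>n\<ge>N. norm (c n * z ^ n) \<le> B * cmod z ^ n"
        using B by (auto simp: norm_mult norm_power intro!: mult_right_mono)
      show "summable (\<lambda>n. B * cmod z ^ n)" using that by (intro summable_mult summable_geometric) auto
    qed
    then show ?thesis using that by (auto dest: summable_sums)
  qed
  then have "(\<lambda>z. if cmod z < 1 then \<Sum>n. c n * z ^ n else 0) holomorphic_on ball 0 1"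
    by (intro power_series_holomorphic[of 0 1 c]) simp
  with s show ?thesis by (auto simp: taylor_def disk_analytic_def)
qed

lemma disk_analytic_measurable:
  assumes "disk_analytic f"
  shows "f \<in> borel_measurable borel"
proof -
  have "(\<lambda>z. indicator (ball 0 1) z *\<^sub>R f z) \<in> borel_measurable borel"
    using assms by (intro borel_measurable_continuous_on_indicator)
      (auto simp: disk_analytic_def intro: holomorphic_on_imp_continuous_on)
  moreover have "(\<lambda>z. indicator (ball 0 1) z *\<^sub>R f z) = f"
    using assms by (auto simp: disk_analytic_def indicator_def fun_eq_iff)
  ultimately show ?thesis by simp
qed

lemma dilate_measurable:
  assumes "disk_analytic f"
  shows "(\<lambda>\<zeta>. f (of_real r * \<zeta>)) \<in> borel_measurable borel"
proof -
  have [measurable]: "f \<in> borel_measurable borel" by (rule disk_analytic_measurable[OF assms])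
  show ?thesis by measurable
qed

lemma dilate_norm_less: "0 \<le> r \<Longrightarrow> r < 1 \<Longrightarrow> cmod z \<le> 1 \<Longrightarrow> cmod (of_real r * z) < 1"
proof -
  assume "0 \<le> r" "r < 1" "cmod z \<le> 1"
  then have "r * cmod z \<le> r * 1" by (intro mult_left_mono) auto
  with \<open>0 \<le> r\<close> \<open>r < 1\<close> show ?thesis by (simp add: norm_mult)
qed

lemma dilate_holomorphic:
  assumes f: "f holomorphic_on ball 0 1" and r: "0 \<le> r" "r < 1"
  shows "(\<lambda>z. f (of_real r * z)) holomorphic_on cball 0 1"
  using holomorphic_on_compose_gen[OF _ f, of "\<lambda>z. of_real r * z" "cball 0 1"] dilate_norm_less[OF r]
  by (auto simp: o_def image_subset_iff intro!: holomorphic_intros)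

lemma dilate_continuous:
  assumes "f holomorphic_on ball 0 1" "0 \<le> r" "r < 1"
  shows "continuous_on (cball 0 1) (\<lambda>z. f (of_real r * z))"
  using dilate_holomorphic[OF assms] by (rule holomorphic_on_imp_continuous_on)

lemma dilate_L2:
  assumes f: "disk_analytic f" and r: "0 \<le> r" "r < 1"
  shows "(\<lambda>\<zeta>. f (of_real r * \<zeta>)) \<in> L2"
proof -
  have "compact ((\<lambda>z. f (of_real r * z)) ` cball 0 1)"
    using dilate_continuous[of f r] assms
    by (intro compact_continuous_image) (auto simp: disk_analytic_def)
  then obtain B where B: "\<And>z. z \<in> cball 0 1 \<Longrightarrow> cmod (f (of_real r * z)) \<le> B"
    by (meson bounded_iff compact_imp_bounded imageI)
  show ?thesis
    by (rule L2_bounded[of _ B, OF dilate_measurable[OF f]])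
       (use AE_circle_norm in \<open>auto elim!: eventually_mono intro: B\<close>)
qed

lemma taylor_summable:
  assumes "taylor f c" "0 \<le> r" "r < 1"
  shows "summable (\<lambda>n. cmod (c n) * r ^ n)"
proof -
  \<comment> \<open>A radius strictly between r and 1: convergence at s gives absolute convergence
    at r.\<close>
  define s where "s = (r + 1) / 2"
  have s: "r < s" "s < 1" "0 \<le> s" using assms by (auto simp: s_def)
  have "summable (\<lambda>n. c n * of_real s ^ n)"
    using assms s by (auto simp: taylor_def intro!: sums_summable)
  then have "summable (\<lambda>n. norm (c n * of_real r ^ n))"
    by (rule powser_insidea) (use s assms in auto)
  then show ?thesis using assms by (simp add: norm_mult norm_power)
qed

lemma parseval_taylor:
  assumes f: "taylor f c" and r: "0 \<le> r" "r < 1"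
  shows "(\<lambda>n. (cmod (c n) * r ^ n)\<^sup>2) sums L2_sq (\<lambda>\<zeta>. f (of_real r * \<zeta>))"
proof -
  have "(\<lambda>n. (cmod (c n * of_real r ^ n))\<^sup>2) sums
      (\<integral>\<zeta>. (cmod (\<Sum>n. (c n * of_real r ^ n) * \<zeta> ^ n))\<^sup>2 \<partial>circle_measure)"
    by (rule parseval_summable) (use taylor_summable[OF assms] r in \<open>simp add: norm_mult norm_power\<close>)
  also have "(\<integral>\<zeta>. (cmod (\<Sum>n. (c n * of_real r ^ n) * \<zeta> ^ n))\<^sup>2 \<partial>circle_measure) = L2_sq (\<lambda>\<zeta>. f (of_real r * \<zeta>))"
    unfolding L2_sq_def
  proof (rule integral_cong_AE)
    show "AE \<zeta> in circle_measure. (cmod (\<Sum>n. c n * of_real r ^ n * \<zeta> ^ n))\<^sup>2 = (cmod (f (of_real r * \<zeta>)))\<^sup>2"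
      using AE_circle_norm
    proof eventually_elim
      case (elim \<zeta>)
      then have "(\<lambda>n. c n * (of_real r * \<zeta>) ^ n) sums f (of_real r * \<zeta>)"
        using f r dilate_norm_less[of r \<zeta>] by (auto simp: taylor_def)
      then show ?case by (simp add: sums_iff power_mult_distrib mult.assoc)
    qed
    have [measurable]: "(\<lambda>\<zeta>. f (of_real r * \<zeta>)) \<in> borel_measurable borel"
      using f by (intro dilate_measurable) (simp add: taylor_def)
    show "(\<lambda>\<zeta>. (cmod (f (of_real r * \<zeta>)))\<^sup>2) \<in> borel_measurable circle_measure" by measurable
  qed measurable
  finally show ?thesis using r by (simp add: norm_mult norm_power)
qed

lemma H2_iff_bounded:
  "f \<in> H2 \<longleftrightarrow> disk_analytic f \<and> (\<exists>B. \<forall>r. 0 \<le> r \<longrightarrow> r < 1 \<longrightarrow> L2_sq (\<lambda>\<zeta>. f (of_real r * \<zeta>)) \<le> B)"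
  unfolding H2_def L2_sq_def bdd_above_def by simp (metis atLeastLessThan_iff)

lemma H2_disk_analytic: "f \<in> H2 \<Longrightarrow> disk_analytic f"
  by (simp add: H2_def)

lemma taylor_L2_sq_le:
  assumes f: "taylor f c" and s: "summable (\<lambda>n. (cmod (c n))\<^sup>2)" and r: "0 \<le> r" "r < 1"
  shows "L2_sq (\<lambda>\<zeta>. f (of_real r * \<zeta>)) \<le> (\<Sum>n. (cmod (c n))\<^sup>2)"
proof -
  have "(cmod (c n) * r ^ n)\<^sup>2 \<le> (cmod (c n))\<^sup>2" for n
    using r by (intro power_mono mult_left_le) (auto simp: power_le_one)
  then show ?thesis
    using parseval_taylor[OF f r] s suminf_le[of "\<lambda>n. (cmod (c n) * r ^ n)\<^sup>2" "\<lambda>n. (cmod (c n))\<^sup>2"]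
    by (auto simp: sums_iff)
qed

lemma taylor_H2_iff:
  assumes f: "taylor f c"
  shows "f \<in> H2 \<longleftrightarrow> summable (\<lambda>n. (cmod (c n))\<^sup>2)"
proof
  assume "f \<in> H2"
  then obtain B where B: "\<And>r. 0 \<le> r \<Longrightarrow> r < 1 \<Longrightarrow> L2_sq (\<lambda>\<zeta>. f (of_real r * \<zeta>)) \<le> B"
    by (auto simp: H2_iff_bounded)
  show "summable (\<lambda>n. (cmod (c n))\<^sup>2)"
  proof (rule bounded_imp_summable)
    fix n
    \<comment> \<open>The number of terms is fixed while r tends to 1, so the bound B passes to
      every partial sum of the squared coefficients.\<close>
    have "((\<lambda>r. \<Sum>k\<le>n. (cmod (c k) * r ^ k)\<^sup>2) \<longlongrightarrow> (\<Sum>k\<le>n. (cmod (c k) * 1 ^ k)\<^sup>2)) (at_left 1)"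
      by (intro tendsto_intros)
    moreover have "\<forall>\<^sub>F r in at_left (1::real). (\<Sum>k\<le>n. (cmod (c k) * r ^ k)\<^sup>2) \<le> B"
      using eventually_at_left_real[OF zero_less_one]
    proof eventually_elim
      case (elim r)
      then have r: "0 \<le> r" "r < 1" by auto
      have "(\<Sum>k\<le>n. (cmod (c k) * r ^ k)\<^sup>2) \<le> L2_sq (\<lambda>\<zeta>. f (of_real r * \<zeta>))"
        using parseval_taylor[OF f r] sum_le_suminf[of "\<lambda>n. (cmod (c n) * r ^ n)\<^sup>2" "{..n}"]
        by (auto simp: sums_iff)
      also have "\<dots> \<le> B" by (rule B[OF r])
      finally show ?case .
    qed
    ultimately show "(\<Sum>k\<le>n. (cmod (c k))\<^sup>2) \<le> B"
      using tendsto_upperbound[of _ _ "at_left (1::real)" B] by fastforce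
  qed auto
next
  assume "summable (\<lambda>n. (cmod (c n))\<^sup>2)"
  from taylor_L2_sq_le[OF f this] show "f \<in> H2" using f by (auto simp: H2_iff_bounded taylor_def)
qed

subsection \<open>The radial maximal function\<close>

definition poisson :: "complex \<Rightarrow> complex \<Rightarrow> real" where
  "poisson z \<zeta> = (1 - (cmod z)\<^sup>2) / (cmod (\<zeta> - z))\<^sup>2"

lemma poisson_measurable [measurable]: "poisson z \<in> borel_measurable borel"
  unfolding poisson_def by measurable

lemma poisson_nonneg: "cmod z \<le> 1 \<Longrightarrow> 0 \<le> poisson z \<zeta>"
  by (auto simp: poisson_def power_le_one)

lemma unimodular_mult_cnj: "cmod w = 1 \<Longrightarrow> w * cnj w = 1"
  using complex_norm_square[of w] by simp

lemma one_minus_cnj_mult_nonzero: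
  assumes "cmod z \<le> 1" "cmod w \<le> 1" "cmod z < 1 \<or> cmod w < 1"
  shows "1 - cnj z * w \<noteq> 0"
proof
  assume "1 - cnj z * w = 0"
  then have "cmod z * cmod w = 1" by (metis complex_mod_cnj eq_iff_diff_eq_0 norm_mult norm_one)
  moreover have "cmod z * cmod w < 1"
    using assms mult_left_le_one_le[of "cmod w" "cmod z"] mult_left_le[of "cmod w" "cmod z"] by fastforce
  ultimately show False by simp
qed

text \<open>Cauchy's formula for \<open>F w * (1 - \<bar>z\<bar>\<^sup>2) / (1 - cnj z * w)\<close>, whose kernel is the Poisson kernel on the circle.\<close>

lemma poisson_integral:
  assumes m: "F \<in> borel_measurable borel" and c: "continuous_on (cball 0 1) F"
    and h: "F holomorphic_on ball 0 1" and z: "cmod z < 1"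
  shows "(\<integral>\<zeta>. F \<zeta> * of_real (poisson z \<zeta>) \<partial>circle_measure) = F z"
proof -
  have [measurable]: "F \<in> borel_measurable borel" by fact
  define f where "f w = F w * (of_real (1 - (cmod z)\<^sup>2) / (1 - cnj z * w))" for w
  have nz: "1 - cnj z * w \<noteq> 0" if "cmod w \<le> 1" for w
    using one_minus_cnj_mult_nonzero[of z w] that z by simp
  have [measurable]: "f \<in> borel_measurable borel" unfolding f_def by measurable
  have "(\<integral>\<zeta>. F \<zeta> * of_real (poisson z \<zeta>) \<partial>circle_measure) = (\<integral>\<zeta>. f \<zeta> * \<zeta> / (\<zeta> - z) ^ Suc 0 \<partial>circle_measure)"
  proof (rule integral_cong_AE)
    show "AE \<zeta> in circle_measure. F \<zeta> * of_real (poisson z \<zeta>) = f \<zeta> * \<zeta> / (\<zeta> - z) ^ Suc 0"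
      using AE_circle_norm
    proof eventually_elim
      case (elim \<zeta>)
      have "\<zeta> * cnj \<zeta> = 1" using elim by (rule unimodular_mult_cnj)
      then have e: "\<zeta> * cnj (\<zeta> - z) = 1 - cnj z * \<zeta>" by (simp add: algebra_simps)
      have nz': "\<zeta> - z \<noteq> 0" using elim z by auto
      define D E where "D = complex_of_real ((cmod (\<zeta> - z))\<^sup>2)" and "E = 1 - cnj z * \<zeta>"
      have "D * \<zeta> = (\<zeta> - z) * E"
        unfolding D_def E_def complex_norm_square e[symmetric] by simp
      moreover have "D \<noteq> 0" "E \<noteq> 0" using nz[of \<zeta>] nz' elim by (auto simp: D_def E_def)
      ultimately have "1 / D = \<zeta> / ((\<zeta> - z) * E)" using nz' by (simp add: field_simps)
      moreover have "of_real (poisson z \<zeta>) = of_real (1 - (cmod z)\<^sup>2) * (1 / D)"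
        by (simp add: poisson_def D_def)
      ultimately have "of_real (poisson z \<zeta>) = of_real (1 - (cmod z)\<^sup>2) * (\<zeta> / ((\<zeta> - z) * E))" by simp
      then show ?case by (simp add: f_def E_def mult_ac)
    qed
  qed measurable
  also have "\<dots> = f z"
  proof (subst cauchy_circle[where l=0])
    show "f holomorphic_on ball 0 1" "continuous_on (cball 0 1) f"
      unfolding f_def using nz by (auto intro!: holomorphic_intros continuous_intros h c)
  qed (use z in auto)
  also have "f z = F z"
  proof -
    have "1 - cnj z * z = of_real (1 - (cmod z)\<^sup>2)"
      by (simp add: complex_norm_square mult.commute flip: of_real_power)
    moreover have "(cmod z)\<^sup>2 \<noteq> 1" using z by (metis abs_norm_cancel less_irrefl power2_eq_1_iff abs_1 abs_minus_cancel)
    ultimately show ?thesis by (simp add: f_def flip: of_real_power of_real_diff)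
  qed
  finally show ?thesis .
qed

lemma poisson_bounded: "cmod z < 1 \<Longrightarrow> cmod \<zeta> = 1 \<Longrightarrow> poisson z \<zeta> \<le> 1 / (1 - cmod z)\<^sup>2"
  unfolding poisson_def
proof (intro frac_le power_mono)
  assume "cmod z < 1" "cmod \<zeta> = 1"
  then show "1 - cmod z \<le> cmod (\<zeta> - z)" using norm_triangle_ineq2[of \<zeta> z] by simp
qed auto

lemma poisson_integrable: "cmod z < 1 \<Longrightarrow> integrable circle_measure (poisson z)"
  by (rule integrable_circle_bounded[where B="1 / (1 - cmod z)\<^sup>2"])
     (use AE_circle_norm in \<open>auto elim!: eventually_mono intro: poisson_bounded simp: poisson_nonneg\<close>)

lemma integral_poisson:
  assumes "cmod z < 1"
  shows "(\<integral>\<zeta>. poisson z \<zeta> \<partial>circle_measure) = 1"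
proof -
  have "complex_of_real (\<integral>\<zeta>. poisson z \<zeta> \<partial>circle_measure) = (\<integral>\<zeta>. 1 * of_real (poisson z \<zeta>) \<partial>circle_measure)"
    by simp
  also have "\<dots> = 1" by (subst poisson_integral) (use assms in auto)
  finally show ?thesis by (simp only: of_real_eq_1_iff)
qed

text \<open>Integration by parts without a boundary formula: the function D has derivative K' times
  the integral of \<phi> over \<open>{0..t}\<close>, a product of two nonpositive numbers, and
  \<open>D 0 = 0\<close>. So \<open>D b\<close> is nonnegative, which bounds the integral of K
  \<phi> by \<open>K b\<close> times that of \<phi>.\<close>

lemma decreasing_kernel_integral:
  fixes K K' \<phi> :: "real \<Rightarrow> real"
  assumes b: "0 \<le> b" and \<phi>: "continuous_on {0..b} \<phi>"
    and K: "\<And>t. (K has_real_derivative K' t) (at t)" and K': "\<And>t. 0 \<le> t \<Longrightarrow> t \<le> b \<Longrightarrow> K' t \<le> 0"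
    and K0: "0 \<le> K b" and le: "\<And>h. 0 \<le> h \<Longrightarrow> h \<le> b \<Longrightarrow> integral {0..h} \<phi> \<le> 0"
  shows "integral {0..b} (\<lambda>t. K t * \<phi> t) \<le> 0"
proof -
  define D where "D h = K h * integral {0..h} \<phi> - integral {0..h} (\<lambda>t. K t * \<phi> t)" for h
  have cK: "continuous_on S K" for S
    using K by (meson DERIV_isCont continuous_at_imp_continuous_on)
  have der: "(D has_real_derivative K' t * integral {0..t} \<phi>) (at t within {0..b})" if "t \<in> {0..b}" for t
    unfolding D_def
    by (auto intro!: derivative_eq_intros has_field_derivative_at_within[OF K]
        integral_has_real_derivative continuous_intros \<phi> cK that)
  have "D 0 \<le> D b"
  proof (rule DERIV_nonneg_imp_increasing_open[OF b])
    show "continuous_on {0..b} D"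
      using der by (meson DERIV_continuous continuous_on_eq_continuous_within)
    fix t assume t: "0 < t" "t < b"
    then have "(D has_real_derivative K' t * integral {0..t} \<phi>) (at t)"
      using der[of t] by (simp add: at_within_Icc_at)
    moreover have "0 \<le> K' t * integral {0..t} \<phi>"
      using K'[of t] le[of t] t by (simp add: mult_nonpos_nonpos)
    ultimately show "\<exists>y. (D has_real_derivative y) (at t) \<and> 0 \<le> y" by blast
  qed
  moreover have "K b * integral {0..b} \<phi> \<le> 0"
    using le[of b] b K0 by (simp add: mult_nonneg_nonpos)
  ultimately show ?thesis by (simp add: D_def)
qed

lemma integral_fold:
  fixes g :: "real \<Rightarrow> real"
  assumes g: "continuous_on UNIV g" and per: "\<And>t. g (2 * pi - t) = g (- t)"
  shows "integral {0..2*pi} g = integral {0..pi} (\<lambda>t. g t + g (- t))"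
proof -
  have int: "g integrable_on {a..b}" for a b
    by (intro integrable_continuous_interval continuous_on_subset[OF g]) auto
  have int': "(\<lambda>t. g (- t)) integrable_on {a..b}" for a b
    by (intro integrable_continuous_interval continuous_on_compose2[OF g] continuous_intros) auto
  \<comment> \<open>The substitution t -> 2 pi - t exchanges \<open>{pi..2*pi}\<close> and
    \<open>{0..pi}\<close>; periodicity then turns g (2 pi - t) into g (-t).\<close>
  have "((\<lambda>t. g ((-1) *\<^sub>R t + 2 * pi)) has_integral (1 / (\<bar>-1\<bar> ^ DIM(real))) *\<^sub>R integral {pi..2*pi} g)
     ((\<lambda>x. (1 / (-1)) *\<^sub>R x + -((1 / (-1)) *\<^sub>R (2 * pi))) ` cbox pi (2 * pi))"
    by (rule has_integral_affinity) (use int in \<open>auto intro: integrable_integral\<close>)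
  moreover have "(\<lambda>x. (1 / (-1)) *\<^sub>R x + -((1 / (-1)) *\<^sub>R (2 * pi))) ` cbox pi (2 * pi) = {0..pi}"
    using image_affinity_atLeastAtMost[of "-1" "2*pi" pi "2*pi"] by simp
  ultimately have "((\<lambda>t. g (- t)) has_integral integral {pi..2*pi} g) {0..pi}"
    by (simp add: per)
  then have "integral {pi..2*pi} g = integral {0..pi} (\<lambda>t. g (- t))" by (simp add: integral_unique)
  moreover have "integral {0..2*pi} g = integral {0..pi} g + integral {pi..2*pi} g"
    by (rule Henstock_Kurzweil_Integration.integral_combine [symmetric]) (use int in auto)
  ultimately show ?thesis
    using int int' by (simp add: Henstock_Kurzweil_Integration.integral_add)
qed

lemma poisson_real_cis: "poisson (of_real r) (cis t) = (1 - r\<^sup>2) / (1 - 2 * r * cos t + r\<^sup>2)"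
proof -
  have "(cmod (cis t - of_real r))\<^sup>2 = (cos t - r)\<^sup>2 + (sin t)\<^sup>2" by (simp add: cmod_power2)
  also have "\<dots> = ((cos t)\<^sup>2 + (sin t)\<^sup>2) - 2 * r * cos t + r\<^sup>2"
    by (simp add: power2_diff algebra_simps del: sin_cos_squared_add sin_cos_squared_add2)
  finally show ?thesis by (simp add: poisson_def)
qed

text \<open>The hypothesis says that the mean of |F| over each arc symmetric about the point 1 is at
  most \<Lambda>. Only the radius towards 1 is treated; other directions follow by rotating
  F.\<close>

lemma maximal_pointwise:
  assumes m: "F \<in> borel_measurable borel" and c: "continuous_on (cball 0 1) F"
    and h: "F holomorphic_on ball 0 1" and r: "0 \<le> r" "r < 1"
    and le: "\<And>h. 0 \<le> h \<Longrightarrow> h \<le> pi \<Longrightarrow> integral {0..h} (\<lambda>t. cmod (F (cis t)) + cmod (F (cis (- t)))) \<le> 2 * \<Lambda> * h"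
  shows "cmod (F (of_real r)) \<le> \<Lambda>"
proof -
  have [measurable]: "F \<in> borel_measurable borel" by fact
  have z: "cmod (of_real r) < 1" using r by simp
  define G where "G t = cmod (F (cis t))" for t
  define K where "K t = poisson (of_real r) (cis t)" for t
  define q where "q t = 1 - 2 * r * cos t + r\<^sup>2" for t
  have K_q: "K t = (1 - r\<^sup>2) / q t" for t by (simp add: K_def q_def poisson_real_cis)
  have q: "0 < q t" for t
  proof -
    have "0 < (1 - r)\<^sup>2" using r by simp
    also have "\<dots> \<le> q t" using r mult_left_mono[of "cos t" 1 r] by (simp add: q_def power2_diff)
    finally show ?thesis .
  qed
  have r2: "r\<^sup>2 \<le> 1" using r by (simp add: power_le_one)
  have cG: "continuous_on S G" for S
    unfolding G_def by (intro continuous_on_norm continuous_on_compose2[OF c] continuous_intros) auto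
  have cG': "continuous_on S (\<lambda>t. G (- t))" for S
    by (intro continuous_on_compose2[OF cG[of UNIV]] continuous_intros) auto
  have cK: "continuous_on S K" for S
    unfolding K_q[abs_def] using q by (auto intro!: continuous_intros simp: q_def less_imp_neq[symmetric])
  have K_sym: "K (- t) = K t" for t by (simp add: K_q q_def)
  have K_per: "K (2 * pi - t) = K t" for t by (simp add: K_q q_def cos_diff)
  have G_per: "G (2 * pi - t) = G (- t)" for t by (simp add: G_def cis_divide[symmetric] cis_inverse divide_inverse flip: cis_cnj)
  have Kder: "(K has_real_derivative - (1 - r\<^sup>2) * (2 * r * sin t) / (q t)\<^sup>2) (at t)" for t
  proof -
    have "(q has_real_derivative 2 * r * sin t) (at t)"
      unfolding q_def[abs_def] by (auto intro!: derivative_eq_intros)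
    from DERIV_divide[OF DERIV_const this, of "1 - r\<^sup>2"] q[of t] show ?thesis
      unfolding K_q[abs_def] by (simp add: power2_eq_square algebra_simps)
  qed
  have ci: "continuous_on (sphere 0 1) (poisson (of_real r))"
    unfolding poisson_def using z by (auto intro!: continuous_intros)
  have cF: "continuous_on (sphere 0 1) F" by (rule continuous_on_subset[OF c]) auto
  \<comment> \<open>The Poisson kernel has mean 1 over the circle, and its evenness splits the mass
    equally between the two half circles.\<close>
  have half: "integral {0..pi} K = pi"
  proof -
    have "1 = (1 / (2*pi)) * integral {0..2*pi} K"
      using integral_poisson[OF z] by (subst (asm) integral_circle_HK(2)[OF _ ci]) (auto simp: K_def[abs_def])
    also have "integral {0..2*pi} K = integral {0..pi} (\<lambda>t. 2 * K t)"
      by (subst integral_fold) (auto simp: cK K_per K_sym)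
    finally show ?thesis by (simp add: field_simps)
  qed
  have "cmod (F (of_real r)) \<le> (\<integral>\<zeta>. cmod (F \<zeta>) * poisson (of_real r) \<zeta> \<partial>circle_measure)"
  proof -
    have "cmod (F (of_real r)) \<le> (\<integral>\<zeta>. cmod (F \<zeta> * of_real (poisson (of_real r) \<zeta>)) \<partial>circle_measure)"
      unfolding poisson_integral[OF m c h z, symmetric] by (rule integral_norm_bound)
    also have "\<dots> = (\<integral>\<zeta>. cmod (F \<zeta>) * poisson (of_real r) \<zeta> \<partial>circle_measure)"
      using poisson_nonneg[of "of_real r"] r by (simp add: norm_mult)
    finally show ?thesis .
  qed
  also have "\<dots> = (1 / (2*pi)) * integral {0..2*pi} (\<lambda>t. G t * K t)"
    by (subst integral_circle_HK(2)) (auto intro!: continuous_intros cF ci simp: G_def K_def)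
  also have "integral {0..2*pi} (\<lambda>t. G t * K t) = integral {0..pi} (\<lambda>t. K t * (G t + G (- t)))"
  proof (subst integral_fold)
    show "G (2 * pi - t) * K (2 * pi - t) = G (- t) * K (- t)" for t by (simp add: K_per G_per K_sym)
  qed (auto intro!: continuous_intros cG cK simp: K_sym algebra_simps)
  also have "\<dots> \<le> 2 * \<Lambda> * pi"
  proof -
    \<comment> \<open>Subtracting the constant 2 \<Lambda> makes the integrals over
      \<open>{0..h}\<close> nonpositive, as \<open>decreasing_kernel_integral\<close> requires; the
      constant returns as 2 \<Lambda> pi through \<open>half\<close>.\<close>
    have "integral {0..pi} (\<lambda>t. K t * (G t + G (- t) - 2 * \<Lambda>)) \<le> 0"
    proof (rule decreasing_kernel_integral[OF _ _ Kder])
      show "continuous_on {0..pi} (\<lambda>t. G t + G (- t) - 2 * \<Lambda>)"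
        by (intro continuous_intros cG cG')
      show "- (1 - r\<^sup>2) * (2 * r * sin t) / (q t)\<^sup>2 \<le> 0" if "0 \<le> t" "t \<le> pi" for t
      proof -
        have "0 \<le> (1 - r\<^sup>2) * (2 * r * sin t)" using that r r2 sin_ge_zero[of t] by simp
        then have "- (1 - r\<^sup>2) * (2 * r * sin t) \<le> 0" by (simp only: mult_minus_left neg_le_0_iff_le)
        then show ?thesis by (intro divide_nonpos_nonneg) auto
      qed
      show "0 \<le> K pi" using q[of pi] r2 by (simp add: K_q)
      fix h :: real assume h: "0 \<le> h" "h \<le> pi"
      have "integral {0..h} (\<lambda>t. G t + G (- t) - 2 * \<Lambda>) = integral {0..h} (\<lambda>t. G t + G (- t)) - integral {0..h} (\<lambda>t. 2 * \<Lambda>)"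
        by (intro Henstock_Kurzweil_Integration.integral_diff integrable_continuous_interval continuous_intros cG cG')
      then show "integral {0..h} (\<lambda>t. G t + G (- t) - 2 * \<Lambda>) \<le> 0"
        using le[OF h] h by (simp add: G_def mult_ac)
    qed simp
    also have "integral {0..pi} (\<lambda>t. K t * (G t + G (- t) - 2 * \<Lambda>)) =
      integral {0..pi} (\<lambda>t. K t * (G t + G (- t)) - 2 * \<Lambda> * K t)" by (simp add: algebra_simps)
    also have "\<dots> = integral {0..pi} (\<lambda>t. K t * (G t + G (- t))) - integral {0..pi} (\<lambda>t. 2 * \<Lambda> * K t)"
      by (intro Henstock_Kurzweil_Integration.integral_diff integrable_continuous_interval continuous_intros cG cG' cK)
    finally show ?thesis using half by simp
  qed
  finally show ?thesis by (simp add: field_simps)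
qed

section \<open>The weak type inequality by a Vitali covering\<close>

lemma emeasure_subadditive_countable:
  assumes "countable C" and [measurable]: "\<And>i. i \<in> C \<Longrightarrow> A i \<in> sets M"
  shows "emeasure M (\<Union>i\<in>C. A i) \<le> (\<integral>\<^sup>+i. emeasure M (A i) \<partial>count_space C)"
proof -
  have U: "(\<Union>i\<in>C. A i) \<in> sets M" using assms by (intro sets.countable_UN') auto
  have "emeasure M (\<Union>i\<in>C. A i) = (\<integral>\<^sup>+x. indicator (\<Union>i\<in>C. A i) x \<partial>M)"
    using U by simp
  also have "\<dots> \<le> (\<integral>\<^sup>+x. (\<integral>\<^sup>+i. indicator (A i) x \<partial>count_space C) \<partial>M)"
  proof (rule nn_integral_mono)
    fix x
    show "indicator (\<Union>i\<in>C. A i) x \<le> (\<integral>\<^sup>+i. indicator (A i) x \<partial>count_space C :: ennreal)"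
    proof (cases "x \<in> (\<Union>i\<in>C. A i)")
      case True
      then obtain j where j: "j \<in> C" "x \<in> A j" by blast
      have "indicator (A j) x = (\<integral>\<^sup>+i. indicator (A i) x * indicator {j} i \<partial>count_space C :: ennreal)"
        using j by (subst nn_integral_indicator_singleton) auto
      also have "\<dots> \<le> (\<integral>\<^sup>+i. indicator (A i) x \<partial>count_space C)"
        by (intro nn_integral_mono) (auto simp: indicator_def)
      finally show ?thesis using j by (auto simp: indicator_def split: if_splits)
    qed auto
  qed
  also have "\<dots> = (\<integral>\<^sup>+i. (\<integral>\<^sup>+x. indicator (A i) x \<partial>M) \<partial>count_space C)"
    by (intro nn_integral_count_space_nn_integral assms borel_measurable_indicator)
  also have "\<dots> = (\<integral>\<^sup>+i. emeasure M (A i) \<partial>count_space C)"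
    by (intro nn_integral_cong) auto
  finally show ?thesis .
qed

lemma cis_shift: "cis (2 * pi + t) = cis t" "cis (- 2 * pi + t) = cis t"
  by (simp_all add: complex_eq_iff cos_add sin_add cos_diff sin_diff)

text \<open>The constant 30 is 10 times 3: an interval of radius h enlarged five times has length 10
  h, which is at most 10 / \<Lambda> times the \<nu>-mass of the original interval, and the disjoint
  intervals selected lie in three periods of F (cis t).\<close>

lemma maximal_weak_type:
  assumes m: "F \<in> borel_measurable borel" and c: "continuous_on (cball 0 1) F"
    and h: "F holomorphic_on ball 0 1" and L: "0 < \<Lambda>"
    and S: "\<And>\<theta>. \<theta> \<in> S \<Longrightarrow> 0 \<le> \<theta> \<and> \<theta> \<le> 2 * pi \<and> (\<exists>r. 0 \<le> r \<and> r < 1 \<and> \<Lambda> < cmod (F (of_real r * cis \<theta>)))"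
  shows "emeasure lborel S \<le> ennreal (30 / \<Lambda>) * (\<integral>\<^sup>+t\<in>{0..2*pi}. ennreal (cmod (F (cis t))) \<partial>lborel)"
proof -
  have [measurable]: "F \<in> borel_measurable borel" by fact
  define g where "g t = cmod (F (cis t))" for t
  have [measurable]: "g \<in> borel_measurable borel" unfolding g_def by measurable
  have g0: "0 \<le> g t" for t by (simp add: g_def)
  have cg: "continuous_on T g" for T
    unfolding g_def by (intro continuous_on_norm continuous_on_compose2[OF c] continuous_intros) auto
  \<comment> \<open>The density lives on the whole line and is 2 pi-periodic, so intervals that
    stick out of \<open>{0..2*pi}\<close> need no wrapping.\<close>
  define \<nu> where "\<nu> = density lborel (\<lambda>t. ennreal (g t))"
  have sets_\<nu> [simp]: "sets \<nu> = sets borel" by (simp add: \<nu>_def)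
  have \<nu>: "emeasure \<nu> A = (\<integral>\<^sup>+t. ennreal (g t) * indicator A t \<partial>lborel)" if "A \<in> sets borel" for A
    using that by (simp add: \<nu>_def emeasure_density)
  \<comment> \<open>Contrapositive of \<open>maximal_pointwise\<close> for F rotated by \<theta>.
    The factor 2 on the right is crude: each one-sided integral is bounded by the mass of the full
    interval. The radius is positive because at h = 0 the strict inequality would read 0 <
    0.\<close>
  have ex: "\<exists>h. 0 < h \<and> h \<le> pi \<and> ennreal (2 * \<Lambda> * h) \<le> 2 * emeasure \<nu> (cball \<theta> h)" if "\<theta> \<in> S" for \<theta>
  proof -
    from S[OF that] obtain r where r: "0 \<le> r" "r < 1" "\<Lambda> < cmod (F (of_real r * cis \<theta>))" by blast
    define F' where "F' w = F (cis \<theta> * w)" for w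
    have F': "F' \<in> borel_measurable borel" "continuous_on (cball 0 1) F'" "F' holomorphic_on ball 0 1"
      unfolding F'_def
        apply measurable
       apply (auto intro!: continuous_on_compose2[OF c] continuous_intros simp: norm_mult)[1]
      using holomorphic_on_compose_gen[OF _ h, of "\<lambda>w. cis \<theta> * w" "ball 0 1"]
      by (auto simp: o_def norm_mult image_subset_iff intro!: holomorphic_intros)
    have "\<not> cmod (F' (of_real r)) \<le> \<Lambda>" using r by (simp add: F'_def mult.commute)
    then obtain h where h: "0 \<le> h" "h \<le> pi"
      and gt: "2 * \<Lambda> * h < integral {0..h} (\<lambda>t. cmod (F' (cis t)) + cmod (F' (cis (- t))))"
      using maximal_pointwise[OF F' r(1,2), of \<Lambda>] by (meson not_le)
    have "h \<noteq> 0" using gt by auto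
    have gt': "2 * \<Lambda> * h < integral {0..h} (\<lambda>t. g (\<theta> + t) + g (\<theta> - t))"
      using gt by (simp add: F'_def g_def cis_mult)
    have i1: "(\<integral>\<^sup>+t. ennreal (g (\<theta> + t) + g (\<theta> - t)) * indicator {0..h} t \<partial>lborel)
        = ennreal (integral {0..h} (\<lambda>t. g (\<theta> + t) + g (\<theta> - t)))"
    proof (rule nn_integral_has_integral_lebesgue'[OF _ integrable_integral])
      show "(\<lambda>t. g (\<theta> + t) + g (\<theta> - t)) integrable_on {0..h}"
        by (intro integrable_continuous_interval continuous_intros continuous_on_compose2[OF cg[of UNIV]]) auto
    qed (simp add: g0)
    have i2: "(\<integral>\<^sup>+t. ennreal (g (\<theta> + t) + g (\<theta> - t)) * indicator {0..h} t \<partial>lborel)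
        = (\<integral>\<^sup>+t. ennreal (g (\<theta> + t)) * indicator {0..h} t \<partial>lborel) + (\<integral>\<^sup>+t. ennreal (g (\<theta> - t)) * indicator {0..h} t \<partial>lborel)"
      by (subst nn_integral_add [symmetric]) (auto simp: g0 ring_distribs)
    have mb: "(\<lambda>t. ennreal (g t) * indicator (cball \<theta> h) t) \<in> borel_measurable borel"
      by (intro borel_measurable_times_ennreal borel_measurable_indicator) auto
    have i3: "(\<integral>\<^sup>+t. ennreal (g (\<theta> + t)) * indicator {0..h} t \<partial>lborel) \<le> emeasure \<nu> (cball \<theta> h)"
    proof -
      have "emeasure \<nu> (cball \<theta> h) = (\<integral>\<^sup>+t. ennreal (g (\<theta> + t)) * indicator (cball \<theta> h) (\<theta> + t) \<partial>lborel)"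
        using nn_integral_real_affine[OF mb, of 1 \<theta>] by (simp add: \<nu>)
      then show ?thesis by (auto intro!: nn_integral_mono simp: indicator_def dist_norm)
    qed
    have i4: "(\<integral>\<^sup>+t. ennreal (g (\<theta> - t)) * indicator {0..h} t \<partial>lborel) \<le> emeasure \<nu> (cball \<theta> h)"
    proof -
      have "emeasure \<nu> (cball \<theta> h) = (\<integral>\<^sup>+t. ennreal (g (\<theta> - t)) * indicator (cball \<theta> h) (\<theta> - t) \<partial>lborel)"
        using nn_integral_real_affine[OF mb, of "-1" \<theta>] by (simp add: \<nu>)
      then show ?thesis by (auto intro!: nn_integral_mono simp: indicator_def dist_norm)
    qed
    have "ennreal (integral {0..h} (\<lambda>t. g (\<theta> + t) + g (\<theta> - t))) \<le> 2 * emeasure \<nu> (cball \<theta> h)"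
      unfolding i1[symmetric] i2 mult_2 by (intro add_mono i3 i4)
    moreover have "ennreal (2 * \<Lambda> * h) \<le> ennreal (integral {0..h} (\<lambda>t. g (\<theta> + t) + g (\<theta> - t)))"
      using gt' by (intro ennreal_leI) simp
    ultimately show ?thesis using h \<open>h \<noteq> 0\<close> by (intro exI[of _ h]) auto
  qed
  \<comment> \<open>Pairs of centre and radius; pi is the uniform bound on the radii that the
    covering lemma needs.\<close>
  define K where "K = {i. fst i \<in> S \<and> 0 < snd i \<and> snd i \<le> pi \<and>
      ennreal (2 * \<Lambda> * snd i) \<le> 2 * emeasure \<nu> (cball (fst i) (snd i))}"
  have "S \<subseteq> (\<Union>i\<in>K. cball (fst i) (snd i))"
  proof
    fix \<theta> assume "\<theta> \<in> S"
    with ex obtain h where "0 < h" "h \<le> pi" "ennreal (2 * \<Lambda> * h) \<le> 2 * emeasure \<nu> (cball \<theta> h)" by blast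
    with \<open>\<theta> \<in> S\<close> show "\<theta> \<in> (\<Union>i\<in>K. cball (fst i) (snd i))"
      by (intro UN_I[of "(\<theta>, h)"]) (auto simp: K_def)
  qed
  then obtain C where C: "countable C" "C \<subseteq> K"
     "pairwise (\<lambda>i j. disjnt (cball (fst i) (snd i)) (cball (fst j) (snd j))) C"
     "S \<subseteq> (\<Union>i\<in>C. cball (fst i) (5 * snd i))"
    by (rule Vitali_covering_lemma_cballs[where B=pi]) (auto simp: K_def)
  have "emeasure \<nu> (\<Union>i\<in>C. cball (fst i) (snd i)) \<le> emeasure \<nu> ({- 2 * pi..0} \<union> {0..2 * pi} \<union> {2 * pi..4 * pi})"
  proof (rule emeasure_mono)
    show "(\<Union>i\<in>C. cball (fst i) (snd i)) \<subseteq> {- 2 * pi..0} \<union> {0..2 * pi} \<union> {2 * pi..4 * pi}"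
    proof
      fix x assume "x \<in> (\<Union>i\<in>C. cball (fst i) (snd i))"
      then obtain i where "i \<in> K" "\<bar>fst i - x\<bar> \<le> snd i" using C by (auto simp: dist_real_def)
      then have "\<bar>fst i - x\<bar> \<le> pi" "0 \<le> fst i" "fst i \<le> 2 * pi" using S[of "fst i"] by (auto simp: K_def)
      then show "x \<in> {- 2 * pi..0} \<union> {0..2 * pi} \<union> {2 * pi..4 * pi}" using pi_gt_zero by auto
    qed
  qed auto
  also have "\<dots> \<le> emeasure \<nu> {- 2 * pi..0} + emeasure \<nu> {0..2 * pi} + emeasure \<nu> {2 * pi..4 * pi}"
    by (intro order_trans[OF emeasure_subadditive] add_mono) auto
  also have "emeasure \<nu> {- 2 * pi..0} = emeasure \<nu> {0..2 * pi}"
    using nn_integral_real_affine[of "\<lambda>t. ennreal (g t) * indicator {- 2 * pi..0} t" 1 "- 2 * pi"]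
    by (auto simp: \<nu> g_def cis_shift[simplified] indicator_def intro!: nn_integral_cong)
  also have "emeasure \<nu> {2 * pi..4 * pi} = emeasure \<nu> {0..2 * pi}"
    using nn_integral_real_affine[of "\<lambda>t. ennreal (g t) * indicator {2 * pi..4 * pi} t" 1 "2 * pi"]
    by (auto simp: \<nu> g_def cis_shift indicator_def intro!: nn_integral_cong)
  also have "emeasure \<nu> {0..2 * pi} + emeasure \<nu> {0..2 * pi} + emeasure \<nu> {0..2 * pi} = (1 + 1 + 1) * emeasure \<nu> {0..2 * pi}"
    by (simp only: distrib_right mult_1)
  also have "(1 + 1 + 1 :: ennreal) = 3" by simp
  finally have U: "emeasure \<nu> (\<Union>i\<in>C. cball (fst i) (snd i)) \<le> 3 * emeasure \<nu> {0..2 * pi}" .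
  have "emeasure lborel S \<le> emeasure lborel (\<Union>i\<in>C. cball (fst i) (5 * snd i))"
    using C by (intro emeasure_mono sets.countable_UN') auto
  also have "\<dots> \<le> (\<integral>\<^sup>+i. emeasure lborel (cball (fst i) (5 * snd i)) \<partial>count_space C)"
    using C by (intro emeasure_subadditive_countable) auto
  also have "\<dots> \<le> (\<integral>\<^sup>+i. ennreal (10 / \<Lambda>) * emeasure \<nu> (cball (fst i) (snd i)) \<partial>count_space C)"
  proof (rule nn_integral_mono)
    fix i assume "i \<in> space (count_space C)"
    then have i: "i \<in> K" using C by auto
    then have "cball (fst i) (5 * snd i) = {fst i - 5 * snd i .. fst i + 5 * snd i}"
      by (intro cball_eq_atLeastAtMost)
    then have "emeasure lborel (cball (fst i) (5 * snd i)) = ennreal (10 * snd i)"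
      using i by (simp add: K_def)
    also have "10 * snd i = 5 / \<Lambda> * (2 * \<Lambda> * snd i)" using L by simp
    also have "ennreal \<dots> = ennreal (5 / \<Lambda>) * ennreal (2 * \<Lambda> * snd i)"
      using L i by (intro ennreal_mult) (auto simp: K_def)
    also have "\<dots> \<le> ennreal (5 / \<Lambda>) * (2 * emeasure \<nu> (cball (fst i) (snd i)))"
      using i by (intro mult_left_mono) (auto simp: K_def)
    also have "\<dots> = ennreal (10 / \<Lambda>) * emeasure \<nu> (cball (fst i) (snd i))"
      using L ennreal_mult[of "5 / \<Lambda>" 2] by (simp add: mult.assoc[symmetric])
    finally show "emeasure lborel (cball (fst i) (5 * snd i)) \<le> ennreal (10 / \<Lambda>) * emeasure \<nu> (cball (fst i) (snd i))" .
  qed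
  also have "\<dots> = ennreal (10 / \<Lambda>) * (\<integral>\<^sup>+i. emeasure \<nu> (cball (fst i) (snd i)) \<partial>count_space C)"
    by (rule nn_integral_cmult) auto
  also have "(\<integral>\<^sup>+i. emeasure \<nu> (cball (fst i) (snd i)) \<partial>count_space C) = emeasure \<nu> (\<Union>i\<in>C. cball (fst i) (snd i))"
    using C by (intro emeasure_UN_countable [symmetric])
      (auto simp: disjoint_family_on_def pairwise_def disjnt_def)
  also have "ennreal (10 / \<Lambda>) * \<dots> \<le> ennreal (10 / \<Lambda>) * (3 * emeasure \<nu> {0..2 * pi})"
    by (rule mult_left_mono[OF U]) simp
  also have "\<dots> = ennreal (30 / \<Lambda>) * emeasure \<nu> {0..2 * pi}"
    using L ennreal_mult[of "10 / \<Lambda>" 3] by (simp add: mult.assoc[symmetric])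
  finally show ?thesis by (simp add: \<nu> g_def)
qed

section \<open>Tails of the power series and their maximal function\<close>

lemma nn_integral_circle':
  assumes [measurable]: "f \<in> borel_measurable borel"
  shows "(\<integral>\<^sup>+t\<in>{0..2*pi}. f (cis t) \<partial>lborel) = ennreal (2*pi) * (\<integral>\<^sup>+\<zeta>. f \<zeta> \<partial>circle_measure)"
  by (simp add: nn_integral_circle ennreal_times_divide mult_divide_eq_ennreal mult.commute[of "ennreal (2*pi)"])

lemma nn_integral_L2_sq:
  assumes "f \<in> L2"
  shows "(\<integral>\<^sup>+\<zeta>. ennreal ((cmod (f \<zeta>))\<^sup>2) \<partial>circle_measure) = ennreal (L2_sq f)"
  unfolding L2_sq_def by (rule nn_integral_eq_integral) (use L2_integrable_sq[OF assms] in auto)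

lemma taylor_diff:
  "taylor f c \<Longrightarrow> taylor g d \<Longrightarrow> taylor (\<lambda>z. f z - g z) (\<lambda>n. c n - d n)"
  unfolding taylor_def disk_analytic_def
  by (auto intro!: holomorphic_intros simp: left_diff_distrib intro: sums_diff)

definition partial_taylor :: "(nat \<Rightarrow> complex) \<Rightarrow> nat \<Rightarrow> complex \<Rightarrow> complex" where
  "partial_taylor c n z = (if cmod z < 1 then \<Sum>k<n. c k * z ^ k else 0)"

lemma taylor_partial_taylor: "taylor (partial_taylor c n) (\<lambda>k. if k < n then c k else 0)"
proof -
  have "partial_taylor c n holomorphic_on ball 0 1"
    by (rule holomorphic_transform[of "\<lambda>z. \<Sum>k<n. c k * z ^ k"])
       (auto simp: partial_taylor_def intro!: holomorphic_intros)
  moreover have "(\<lambda>k. (if k < n then c k else 0) * z ^ k) sums (\<Sum>k<n. c k * z ^ k)" for z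
    using sums_If_finite_set[of "{..<n}" "\<lambda>k. c k * z ^ k", OF finite_lessThan]
    by (rule sums_cong[THEN iffD1, rotated]) auto
  ultimately show ?thesis by (auto simp: taylor_def disk_analytic_def partial_taylor_def)
qed

text \<open>Settles measurability of the level sets: although r ranges over uncountably many radii,
  a union of open sets is open. The bound on the norm keeps the argument in the disk when \<zeta> is
  off the circle.\<close>

lemma open_radial:
  assumes f: "disk_analytic f"
  shows "open {\<zeta>. \<exists>r. 0 \<le> r \<and> r < b \<and> norm (of_real r * \<zeta>) < 1 \<and> \<Lambda> < (cmod (f (of_real r * \<zeta>)))\<^sup>2}"
proof -
  have "open (ball 0 1 \<inter> (\<lambda>w. (cmod (f w))\<^sup>2) -` {\<Lambda><..})"
    using f by (intro continuous_open_preimage continuous_intros holomorphic_on_imp_continuous_on)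
      (auto simp: disk_analytic_def)
  then have "open (\<Union>r\<in>{0..<b}. (\<lambda>\<zeta>. complex_of_real r * \<zeta>) -` (ball 0 1 \<inter> (\<lambda>w. (cmod (f w))\<^sup>2) -` {\<Lambda><..}))"
    by (intro open_UN ballI open_vimage continuous_intros)
  also have "(\<Union>r\<in>{0..<b}. (\<lambda>\<zeta>. complex_of_real r * \<zeta>) -` (ball 0 1 \<inter> (\<lambda>w. (cmod (f w))\<^sup>2) -` {\<Lambda><..}))
     = {\<zeta>. \<exists>r. 0 \<le> r \<and> r < b \<and> norm (of_real r * \<zeta>) < 1 \<and> \<Lambda> < (cmod (f (of_real r * \<zeta>)))\<^sup>2}"
    by auto
  finally show ?thesis .
qed

text \<open>The weak type inequality is applied to the square of f, so its right-hand side is a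
  squared L2 norm. As f need not be continuous up to the circle, this is done for dilates by
  \<open>\<rho> k\<close> and the level sets are exhausted along an increasing sequence.\<close>

lemma radial_maximal_weak_type:
  assumes f: "taylor f c" and s: "summable (\<lambda>n. (cmod (c n))\<^sup>2)" and L: "0 < \<Lambda>"
  shows "emeasure lborel {t. 0 \<le> t \<and> t \<le> 2 * pi \<and> (\<exists>r. 0 \<le> r \<and> r < 1 \<and> \<Lambda> < (cmod (f (of_real r * cis t)))\<^sup>2)}
    \<le> ennreal (30 / \<Lambda> * (2 * pi * (\<Sum>n. (cmod (c n))\<^sup>2)))"
proof -
  have fa: "disk_analytic f" using f by (simp add: taylor_def)
  \<comment> \<open>The double \<open>Suc\<close> keeps \<open>\<rho> 0\<close> positive, since
    radii are divided by \<open>\<rho> k\<close> below.\<close>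
  define \<rho> :: "nat \<Rightarrow> real" where "\<rho> k = 1 - 1 / real (Suc (Suc k))" for k
  have \<rho>: "0 < \<rho> k" "\<rho> k < 1" for k by (auto simp: \<rho>_def)
  define E where "E k = {t. 0 \<le> t \<and> t \<le> 2 * pi \<and> (\<exists>r. 0 \<le> r \<and> r < \<rho> k \<and> \<Lambda> < (cmod (f (of_real r * cis t)))\<^sup>2)}" for k
  have E_meas: "E k \<in> sets borel" for k
  proof -
    let ?U = "{\<zeta>. \<exists>r. 0 \<le> r \<and> r < \<rho> k \<and> norm (of_real r * \<zeta>) < 1 \<and> \<Lambda> < (cmod (f (of_real r * \<zeta>)))\<^sup>2}"
    have "cis -` ?U \<inter> space borel \<in> sets borel"
      using open_radial[OF fa] by (intro measurable_sets[OF measurable_cis]) auto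
    moreover have "E k = {0..2*pi} \<inter> (cis -` ?U \<inter> space borel)"
      using \<rho>[of k] by (auto simp: E_def norm_mult)
    ultimately show ?thesis by simp
  qed
  have mult3: "ennreal a * (ennreal b * ennreal x) = ennreal (a * (b * x))" if "0 \<le> a" "0 \<le> b" "0 \<le> x" for a b x
    using that by (simp add: ennreal_mult)
  have E_bound: "emeasure lborel (E k) \<le> ennreal (30 / \<Lambda> * (2 * pi * (\<Sum>n. (cmod (c n))\<^sup>2)))" for k
  proof -
    let ?F = "\<lambda>w. (f (of_real (\<rho> k) * w))\<^sup>2"
    note rho = less_imp_le[OF \<rho>(1)[of k]] \<rho>(2)[of k]
    have hol: "f holomorphic_on ball 0 1" using fa by (simp add: disk_analytic_def)
    note [measurable] = dilate_measurable[OF fa, of "\<rho> k"]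
    have "emeasure lborel (E k) \<le> ennreal (30 / \<Lambda>) * (\<integral>\<^sup>+t\<in>{0..2*pi}. ennreal (cmod (?F (cis t))) \<partial>lborel)"
    proof (rule maximal_weak_type[OF _ _ _ L])
      show "continuous_on (cball 0 1) ?F" by (intro continuous_intros dilate_continuous hol rho)
      show "?F holomorphic_on ball 0 1"
        by (intro holomorphic_intros holomorphic_on_subset[OF dilate_holomorphic[OF hol rho]]) auto
      fix t assume "t \<in> E k"
      then obtain r where t: "0 \<le> t" "t \<le> 2 * pi" and r: "0 \<le> r" "r < \<rho> k" "\<Lambda> < (cmod (f (of_real r * cis t)))\<^sup>2"
        by (auto simp: E_def)
      \<comment> \<open>Every radius below \<open>\<rho> k\<close> is \<open>\<rho> k\<close> times
        a radius below 1, so it is seen by the maximal function of the dilate.\<close>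
      have e: "of_real (\<rho> k) * (of_real (r / \<rho> k) * cis t) = of_real r * cis t"
        using \<rho>[of k] by simp
      have "0 \<le> r / \<rho> k \<and> r / \<rho> k < 1 \<and> \<Lambda> < cmod ((f (of_real (\<rho> k) * (of_real (r / \<rho> k) * cis t)))\<^sup>2)"
        unfolding e norm_power using r \<rho>[of k] by simp
      with t show "0 \<le> t \<and> t \<le> 2 * pi \<and> (\<exists>r. 0 \<le> r \<and> r < 1 \<and> \<Lambda> < cmod (?F (of_real r * cis t)))"
        by blast
    qed measurable
    also have "(\<integral>\<^sup>+t\<in>{0..2*pi}. ennreal (cmod (?F (cis t))) \<partial>lborel)
        = ennreal (2*pi) * (\<integral>\<^sup>+\<zeta>. ennreal ((cmod (f (of_real (\<rho> k) * \<zeta>)))\<^sup>2) \<partial>circle_measure)"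
      by (subst nn_integral_circle' [symmetric]) (auto simp: norm_power)
    also have "(\<integral>\<^sup>+\<zeta>. ennreal ((cmod (f (of_real (\<rho> k) * \<zeta>)))\<^sup>2) \<partial>circle_measure) = ennreal (L2_sq (\<lambda>\<zeta>. f (of_real (\<rho> k) * \<zeta>)))"
      by (rule nn_integral_L2_sq[OF dilate_L2[OF fa rho]])
    also have "ennreal (30 / \<Lambda>) * (ennreal (2*pi) * ennreal (L2_sq (\<lambda>\<zeta>. f (of_real (\<rho> k) * \<zeta>))))
       = ennreal (30 / \<Lambda> * (2 * pi * L2_sq (\<lambda>\<zeta>. f (of_real (\<rho> k) * \<zeta>))))"
      using L by (intro mult3) auto
    also have "\<dots> \<le> ennreal (30 / \<Lambda> * (2 * pi * (\<Sum>n. (cmod (c n))\<^sup>2)))"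
      using L taylor_L2_sq_le[OF f s rho] by (intro ennreal_leI mult_left_mono) auto
    finally show ?thesis .
  qed
  have "incseq E"
    unfolding E_def incseq_Suc_iff
  proof (intro allI subsetI, clarify)
    fix k t r assume "r < \<rho> k" "0 \<le> r" "\<Lambda> < (cmod (f (of_real r * cis t)))\<^sup>2"
    moreover have "\<rho> k \<le> \<rho> (Suc k)" by (simp add: \<rho>_def frac_le)
    ultimately show "\<exists>r\<ge>0. r < \<rho> (Suc k) \<and> \<Lambda> < (cmod (f (of_real r * cis t)))\<^sup>2"
      by (meson less_le_trans)
  qed
  have ex: "\<exists>k. r < \<rho> k" if "r < 1" for r
  proof -
    have "0 < 1 - r" using that by simp
    then obtain n where "inverse (real (Suc n)) < 1 - r" using reals_Archimedean by blast
    moreover have "1 / real (Suc (Suc n)) \<le> inverse (real (Suc n))" by (simp add: divide_inverse)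
    ultimately show ?thesis by (intro exI[of _ n]) (simp add: \<rho>_def del: of_nat_Suc)
  qed
  have iff: "(\<exists>r. 0 \<le> r \<and> r < 1 \<and> P r) \<longleftrightarrow> (\<exists>k r. 0 \<le> r \<and> r < \<rho> k \<and> P r)" for P
    by (meson ex \<rho>(2) less_trans)
  have "{t. 0 \<le> t \<and> t \<le> 2 * pi \<and> (\<exists>r. 0 \<le> r \<and> r < 1 \<and> \<Lambda> < (cmod (f (of_real r * cis t)))\<^sup>2)} = (\<Union>k. E k)"
    unfolding E_def iff by auto
  also have "emeasure lborel \<dots> = (SUP k. emeasure lborel (E k))"
    by (rule SUP_emeasure_incseq [symmetric]) (use E_meas \<open>incseq E\<close> in auto)
  also have "\<dots> \<le> ennreal (30 / \<Lambda> * (2 * pi * (\<Sum>n. (cmod (c n))\<^sup>2)))"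
    by (intro SUP_least E_bound)
  finally show ?thesis .
qed

subsection \<open>Radial limits\<close>

text \<open>For fixed j, the points where every tail exceeds the level somewhere on the radius lie
  in the level set of each single tail. The measure of the latter is bounded by a multiple of the
  remaining squared coefficients, which tends to 0 as n grows.\<close>

lemma tail_radial_AE:
  assumes f: "taylor f c" and s: "summable (\<lambda>n. (cmod (c n))\<^sup>2)"
  shows "AE \<zeta> in circle_measure. \<forall>j::nat. \<exists>n. \<forall>r. 0 \<le> r \<longrightarrow> r < 1 \<longrightarrow>
    (cmod (f (of_real r * \<zeta>) - partial_taylor c n (of_real r * \<zeta>)))\<^sup>2 \<le> 1 / real (Suc j)"
proof -
  define R where "R n z = f z - partial_taylor c n z" for n z
  have R: "taylor (R n) (\<lambda>k. c k - (if k < n then c k else 0))" for n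
    unfolding R_def by (intro taylor_diff f taylor_partial_taylor)
  have Ra: "disk_analytic (R n)" for n using R by (simp add: taylor_def)
  define U where "U j n = {\<zeta>. \<exists>r. 0 \<le> r \<and> r < 1 \<and> norm (of_real r * \<zeta>) < 1 \<and> 1 / real (Suc j) < (cmod (R n (of_real r * \<zeta>)))\<^sup>2}" for j n :: nat
  have U[measurable]: "U j n \<in> sets borel" for j n
    unfolding U_def by (intro borel_open open_radial Ra)
  have tail: "(\<lambda>n. (cmod (c n - (if n < N then c n else 0)))\<^sup>2) sums ((\<Sum>n. (cmod (c n))\<^sup>2) - (\<Sum>n<N. (cmod (c n))\<^sup>2))" for N
  proof -
    have "(\<lambda>n. (cmod (c n))\<^sup>2 - (if n \<in> {..<N} then (cmod (c n))\<^sup>2 else 0)) sums ((\<Sum>n. (cmod (c n))\<^sup>2) - (\<Sum>n<N. (cmod (c n))\<^sup>2))"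
      by (intro sums_diff summable_sums s sums_If_finite_set) auto
    then show ?thesis by (rule sums_cong[THEN iffD1, rotated]) auto
  qed
  have null: "{t. 0 \<le> t \<and> t \<le> 2 * pi \<and> (\<forall>n. cis t \<in> U j n)} \<in> null_sets lborel" for j
  proof -
    let ?B = "{t. 0 \<le> t \<and> t \<le> 2 * pi \<and> (\<forall>n. cis t \<in> U j n)}"
    have B[measurable]: "?B \<in> sets borel" by measurable
    let ?C = "\<lambda>n. 30 / (1 / real (Suc j)) * (2 * pi * ((\<Sum>n. (cmod (c n))\<^sup>2) - (\<Sum>n<n. (cmod (c n))\<^sup>2)))"
    have le: "emeasure lborel ?B \<le> ennreal (?C n)" for n
    proof -
      let ?T = "{t. 0 \<le> t \<and> t \<le> 2 * pi \<and> (\<exists>r. 0 \<le> r \<and> r < 1 \<and> 1 / real (Suc j) < (cmod (R n (of_real r * cis t)))\<^sup>2)}"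
      have "?T = {t. 0 \<le> t \<and> t \<le> 2 * pi \<and> cis t \<in> U j n}"
        by (auto simp: U_def norm_mult)
      then have T: "?T \<in> sets lborel" by simp
      have "emeasure lborel ?B \<le> emeasure lborel ?T"
        by (rule emeasure_mono[OF _ T]) (auto simp: U_def)
      also have "\<dots> \<le> ennreal (?C n)"
        using radial_maximal_weak_type[OF R[of n], of "1 / real (Suc j)"] tail[of n] by (auto simp: sums_iff)
      finally show ?thesis .
    qed
    have "(\<lambda>n. ?C n) \<longlonglongrightarrow> 30 / (1 / real (Suc j)) * (2 * pi * ((\<Sum>n. (cmod (c n))\<^sup>2) - (\<Sum>n. (cmod (c n))\<^sup>2)))"
      by (intro tendsto_intros summable_LIMSEQ s)
    then have "(\<lambda>n. ennreal (?C n)) \<longlonglongrightarrow> ennreal 0" by (intro tendsto_ennrealI) simp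
    then have "emeasure lborel ?B \<le> ennreal 0"
      by (rule tendsto_lowerbound) (use le in auto)
    then show ?thesis using B by (auto simp: null_sets_def)
  qed
  have "AE \<zeta> in circle_measure. \<forall>j. \<exists>n. \<zeta> \<notin> U j n"
  proof (subst AE_circle)
    have "AE t in lborel. \<forall>j. t \<notin> {t. 0 \<le> t \<and> t \<le> 2 * pi \<and> (\<forall>n. cis t \<in> U j n)}"
      unfolding AE_all_countable using null by (blast intro: AE_not_in)
    then show "AE t in lborel. t \<in> {0..2 * pi} \<longrightarrow> (\<forall>j. \<exists>n. cis t \<notin> U j n)"
      by eventually_elim auto
  qed measurable
  with AE_circle_norm show ?thesis
  proof eventually_elim
    case (elim \<zeta>)
    show ?case
    proof
      fix j
      from elim obtain n where n: "\<zeta> \<notin> U j n" by blast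
      show "\<exists>n. \<forall>r. 0 \<le> r \<longrightarrow> r < 1 \<longrightarrow>
        (cmod (f (of_real r * \<zeta>) - partial_taylor c n (of_real r * \<zeta>)))\<^sup>2 \<le> 1 / real (Suc j)"
        using n elim by (intro exI[of _ n]) (auto simp: U_def R_def norm_mult not_less simp del: of_nat_Suc)
    qed
  qed
qed

lemma cauchy_at_left_convergent:
  fixes \<phi> :: "real \<Rightarrow> complex"
  assumes "\<And>e. 0 < e \<Longrightarrow> \<exists>P. eventually P (at_left 1) \<and> (\<forall>x y. P x \<and> P y \<longrightarrow> dist (\<phi> x) (\<phi> y) < e)"
  shows "\<exists>l. (\<phi> \<longlongrightarrow> l) (at_left 1)"
proof -
  have "cauchy_filter (filtermap \<phi> (at_left 1))"
    unfolding cauchy_filter_metric_filtermap using assms by blast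
  then have "convergent_filter (filtermap \<phi> (at_left 1))" by (rule cauchy_filter_convergent)
  then show ?thesis by (auto simp: convergent_filter.simps filterlim_def)
qed

text \<open>Two values of f on the radius are compared through one polynomial and its value at
  \<zeta>, giving four terms below e / 4. One n for each level suffices because that polynomial is
  continuous.\<close>

lemma radial_limit_if_tails_small:
  assumes z: "cmod \<zeta> = 1"
    and t: "\<forall>j::nat. \<exists>n. \<forall>r. 0 \<le> r \<longrightarrow> r < 1 \<longrightarrow>
    (cmod (f (of_real r * \<zeta>) - partial_taylor c n (of_real r * \<zeta>)))\<^sup>2 \<le> 1 / real (Suc j)"
  shows "\<exists>l. ((\<lambda>r. f (of_real r * \<zeta>)) \<longlongrightarrow> l) (at_left 1)"
proof -
  let ?\<phi> = "\<lambda>r::real. f (of_real r * \<zeta>)"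
  have tri: "dist a b \<le> dist a p + dist p q + dist r q + dist b r" for a b p q r :: complex
    by metric
  show ?thesis
  proof (rule cauchy_at_left_convergent)
    fix e :: real assume e: "0 < e"
    \<comment> \<open>The tails are controlled in square, hence the square of e / 4.\<close>
    obtain j where j: "1 / real (Suc j) < (e / 4)\<^sup>2"
      using reals_Archimedean[of "(e / 4)\<^sup>2"] e by (auto simp: inverse_eq_divide)
    obtain n where n: "\<And>r. 0 \<le> r \<Longrightarrow> r < 1 \<Longrightarrow> (cmod (f (of_real r * \<zeta>) - partial_taylor c n (of_real r * \<zeta>)))\<^sup>2 \<le> 1 / real (Suc j)"
      using t by blast
    let ?p = "\<lambda>r::real. \<Sum>k<n. c k * (of_real r * \<zeta>) ^ k"
    have close: "cmod (?\<phi> r - ?p r) < e / 4" if "0 \<le> r" "r < 1" for r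
    proof (rule power2_less_imp_less)
      have "(cmod (?\<phi> r - ?p r))\<^sup>2 \<le> 1 / real (Suc j)"
        using n[OF that] that z by (simp add: partial_taylor_def norm_mult)
      then show "(cmod (?\<phi> r - ?p r))\<^sup>2 < (e / 4)\<^sup>2" using j by (rule le_less_trans)
    qed (use e in auto)
    have "(?p \<longlongrightarrow> ?p 1) (at_left 1)" by (intro tendsto_intros)
    then have "\<forall>\<^sub>F r in at_left 1. dist (?p r) (?p 1) < e / 4" using e by (intro tendstoD) auto
    moreover have "\<forall>\<^sub>F r in at_left (1::real). r \<in> {0<..<1}" by (rule eventually_at_left_real) simp
    ultimately have "\<forall>\<^sub>F r in at_left 1. r \<in> {0<..<1} \<and> dist (?p r) (?p 1) < e / 4" by eventually_elim simp
    moreover have "dist (?\<phi> x) (?\<phi> y) < e"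
      if "x \<in> {0<..<1} \<and> dist (?p x) (?p 1) < e / 4" "y \<in> {0<..<1} \<and> dist (?p y) (?p 1) < e / 4" for x y
    proof -
      have "dist (?\<phi> x) (?\<phi> y) \<le> dist (?\<phi> x) (?p x) + dist (?p x) (?p 1) + dist (?p y) (?p 1) + dist (?\<phi> y) (?p y)"
        by (rule tri)
      also have "\<dots> < e" using that close[of x] close[of y] by (simp add: dist_norm)
      finally show ?thesis .
    qed
    ultimately show "\<exists>P. eventually P (at_left 1) \<and> (\<forall>x y. P x \<and> P y \<longrightarrow> dist (?\<phi> x) (?\<phi> y) < e)"
      by (intro exI[of _ "\<lambda>r. r \<in> {0<..<1} \<and> dist (?p r) (?p 1) < e / 4"]) blast
  qed
qed

theorem H2_radial_limit:
  assumes "f \<in> H2"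
  shows "AE \<zeta> in circle_measure. ((\<lambda>r. f (of_real r * \<zeta>)) \<longlongrightarrow> bdry f \<zeta>) (at_left 1)"
proof -
  obtain c where c: "taylor f c" using disk_analytic_taylor H2_disk_analytic assms by blast
  then have "summable (\<lambda>n. (cmod (c n))\<^sup>2)" using assms taylor_H2_iff by blast
  from tail_radial_AE[OF c this] AE_circle_norm show ?thesis
  proof eventually_elim
    case (elim \<zeta>)
    then obtain l where l: "((\<lambda>r. f (of_real r * \<zeta>)) \<longlongrightarrow> l) (at_left 1)"
      using radial_limit_if_tails_small by blast
    then have "bdry f \<zeta> = l" unfolding bdry_def by (intro tendsto_Lim) auto
    with l show ?case by simp
  qed
qed

section \<open>Measurability of the boundary function\<close>

lemma radial_tendsto_inside:
  assumes f: "disk_analytic f" and z: "cmod \<zeta> < 1"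
  shows "((\<lambda>r. f (of_real r * \<zeta>)) \<longlongrightarrow> f \<zeta>) (at_left 1)"
proof -
  have "isCont f \<zeta>"
    using f z continuous_on_eq_continuous_at[of "ball 0 1" f]
    by (auto simp: disk_analytic_def intro: holomorphic_on_imp_continuous_on)
  moreover have "((\<lambda>r. of_real r * \<zeta>) \<longlongrightarrow> of_real 1 * \<zeta>) (at_left 1)" by (intro tendsto_intros)
  ultimately show ?thesis using isCont_tendsto_compose[of \<zeta> f] by simp
qed

lemma radial_tendsto_outside:
  assumes f: "disk_analytic f" and z: "1 < cmod \<zeta>"
  shows "((\<lambda>r. f (of_real r * \<zeta>)) \<longlongrightarrow> 0) (at_left 1)"
proof (rule tendsto_eventually)
  have "((\<lambda>r. \<bar>r\<bar> * cmod \<zeta>) \<longlongrightarrow> \<bar>1\<bar> * cmod \<zeta>) (at_left 1)" by (intro tendsto_intros)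
  then have "\<forall>\<^sub>F r in at_left (1::real). 1 < \<bar>r\<bar> * cmod \<zeta>" using z by (intro order_tendstoD(1)) auto
  then show "\<forall>\<^sub>F r in at_left (1::real). f (of_real r * \<zeta>) = 0"
    by eventually_elim (use f in \<open>auto simp: disk_analytic_def norm_mult\<close>)
qed

text \<open>Cauchy's criterion with its outer quantifiers over natural numbers, so that the set of
  convergence is built by countable operations; the quantifiers over radii become unions of open
  sets.\<close>

lemma radial_converges_iff:
  fixes \<phi> :: "real \<Rightarrow> complex"
  shows "(\<exists>l. (\<phi> \<longlongrightarrow> l) (at_left 1)) \<longleftrightarrow>
    (\<forall>j::nat. \<exists>m::nat. \<forall>r s. 1 - 1 / real (Suc m) < r \<longrightarrow> r < 1 \<longrightarrow> 1 - 1 / real (Suc m) < s \<longrightarrow> s < 1 \<longrightarrow>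
      cmod (\<phi> r - \<phi> s) \<le> 1 / real (Suc j))" (is "?L \<longleftrightarrow> ?R")
proof
  assume ?L
  then obtain l where l: "(\<phi> \<longlongrightarrow> l) (at_left 1)" by blast
  show ?R
  proof
    fix j :: nat
    define e where "e = 1 / real (Suc j)"
    have "\<forall>\<^sub>F r in at_left 1. dist (\<phi> r) l < e / 2" by (rule tendstoD[OF l]) (simp add: e_def)
    then obtain b where b: "b < 1" "\<And>r. b < r \<Longrightarrow> r < 1 \<Longrightarrow> dist (\<phi> r) l < e / 2"
      by (auto simp: eventually_at_left_field)
    have "0 < 1 - b" using b by simp
    then obtain m where "inverse (real (Suc m)) < 1 - b" using reals_Archimedean by blast
    then have m: "b < 1 - 1 / real (Suc m)" by (simp add: inverse_eq_divide del: of_nat_Suc)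
    show "\<exists>m::nat. \<forall>r s. 1 - 1 / real (Suc m) < r \<longrightarrow> r < 1 \<longrightarrow> 1 - 1 / real (Suc m) < s \<longrightarrow> s < 1 \<longrightarrow>
      cmod (\<phi> r - \<phi> s) \<le> 1 / real (Suc j)"
    proof (intro exI allI impI)
      fix r s assume "1 - 1 / real (Suc m) < r" "r < 1" "1 - 1 / real (Suc m) < s" "s < 1"
      then have "dist (\<phi> r) l < e / 2" "dist (\<phi> s) l < e / 2" using b(2) m by (meson less_trans)+
      then show "cmod (\<phi> r - \<phi> s) \<le> 1 / real (Suc j)"
        using dist_triangle_half_r[of l "\<phi> r" e "\<phi> s"] by (simp add: dist_norm e_def norm_minus_commute)
    qed
  qed
next
  assume R: ?R
  show ?L
  proof (rule cauchy_at_left_convergent)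
    fix e :: real assume "0 < e"
    then obtain j where j: "inverse (real (Suc j)) < e" using reals_Archimedean by blast
    obtain m where m: "\<And>r s. 1 - 1 / real (Suc m) < r \<Longrightarrow> r < 1 \<Longrightarrow> 1 - 1 / real (Suc m) < s \<Longrightarrow> s < 1 \<Longrightarrow>
      cmod (\<phi> r - \<phi> s) \<le> 1 / real (Suc j)" using R by blast
    have "\<forall>\<^sub>F r in at_left 1. r \<in> {1 - 1 / real (Suc m)<..<1}" by (rule eventually_at_left_real) simp
    moreover have "dist (\<phi> r) (\<phi> s) < e" if "r \<in> {1 - 1 / real (Suc m)<..<1}" "s \<in> {1 - 1 / real (Suc m)<..<1}" for r s
      using m[of r s] that j unfolding dist_norm inverse_eq_divide by (auto intro: le_less_trans simp del: of_nat_Suc)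
    ultimately show "\<exists>P. eventually P (at_left 1) \<and> (\<forall>x y. P x \<and> P y \<longrightarrow> dist (\<phi> x) (\<phi> y) < e)"
      by (intro exI[of _ "\<lambda>r. r \<in> {1 - 1 / real (Suc m)<..<1}"]) blast
  qed
qed

lemma filterlim_radii: "filterlim (\<lambda>k. 1 - 1 / real (Suc k)) (at_left 1) sequentially"
proof -
  have "(\<lambda>k. 1 - 1 / real (Suc k)) \<longlonglongrightarrow> 1 - 0" by (intro tendsto_intros LIMSEQ_Suc[OF lim_1_over_n])
  then show ?thesis by (auto simp: filterlim_at)
qed

text \<open>\<open>bdry f\<close> is a function on the whole plane, so all points count: off the
  circle the radial limit always exists, and on the circle it either equals a limit along a sequence
  of radii or is the default value of \<open>Lim\<close>.\<close>

lemma bdry_measurable: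
  assumes f: "disk_analytic f"
  shows "bdry f \<in> borel_measurable borel"
proof -
  \<comment> \<open>Points where f oscillates by more than 1 / (j + 1) on the last 1 / (m + 1) of
    the radius; a union of open sets.\<close>
  define U where "U j m = (\<Union>r\<in>{1 - 1 / real (Suc m)<..<1}. \<Union>s\<in>{1 - 1 / real (Suc m)<..<1}.
     {\<zeta>\<in>{\<zeta>. cmod (of_real r * \<zeta>) < 1 \<and> cmod (of_real s * \<zeta>) < 1}.
        1 / real (Suc j) < cmod (f (of_real r * \<zeta>) - f (of_real s * \<zeta>))})" for j m :: nat
  have "open (U j m)" for j m
    unfolding U_def
  proof (intro open_UN ballI)
    fix r s :: real
    let ?D = "{\<zeta>. cmod (of_real r * \<zeta>) < 1 \<and> cmod (of_real s * \<zeta>) < 1}"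
    have D: "open ?D" by (intro open_Collect_conj open_Collect_less continuous_intros)
    have cf: "continuous_on (ball 0 1) f" using f by (auto simp: disk_analytic_def intro: holomorphic_on_imp_continuous_on)
    have "continuous_on ?D (\<lambda>\<zeta>. cmod (f (of_real r * \<zeta>) - f (of_real s * \<zeta>)))"
      by (intro continuous_intros continuous_on_compose2[OF cf]) auto
    then have "open (?D \<inter> (\<lambda>\<zeta>. cmod (f (of_real r * \<zeta>) - f (of_real s * \<zeta>))) -` {1 / real (Suc j)<..})"
      using D by (rule continuous_open_preimage) auto
    moreover have "?D \<inter> (\<lambda>\<zeta>. cmod (f (of_real r * \<zeta>) - f (of_real s * \<zeta>))) -` {1 / real (Suc j)<..}
      = {\<zeta>\<in>?D. 1 / real (Suc j) < cmod (f (of_real r * \<zeta>) - f (of_real s * \<zeta>))}" by auto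
    ultimately show "open {\<zeta>\<in>?D. 1 / real (Suc j) < cmod (f (of_real r * \<zeta>) - f (of_real s * \<zeta>))}"
      by (simp only:)
  qed
  then have U[measurable]: "U j m \<in> sets borel" for j m by simp
  have conv: "(\<exists>l. ((\<lambda>r. f (of_real r * \<zeta>)) \<longlongrightarrow> l) (at_left 1)) \<longleftrightarrow> (\<forall>j. \<exists>m. \<zeta> \<notin> U j m)"
    if "cmod \<zeta> = 1" for \<zeta>
  proof -
    have *: "\<zeta> \<notin> U j m \<longleftrightarrow> (\<forall>r s. 1 - 1 / real (Suc m) < r \<longrightarrow> r < 1 \<longrightarrow> 1 - 1 / real (Suc m) < s \<longrightarrow> s < 1 \<longrightarrow>
      cmod (f (of_real r * \<zeta>) - f (of_real s * \<zeta>)) \<le> 1 / real (Suc j))" for j m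
    proof -
      have "cmod (of_real r * \<zeta>) < 1" if r: "1 - 1 / real (Suc m) < r" "r < 1" for r
      proof -
        have "0 \<le> 1 - 1 / real (Suc m)" by simp
        then have "0 < r" using r(1) by (rule le_less_trans)
        then show ?thesis using r \<open>cmod \<zeta> = 1\<close> by (simp add: norm_mult)
      qed
      then show ?thesis unfolding U_def by (auto simp: not_less simp del: of_nat_Suc)
    qed
    show ?thesis unfolding * by (rule radial_converges_iff)
  qed
  \<comment> \<open>Where no limit exists, the description inside \<open>Lim\<close> has the
    predicate that is constantly false, so \<open>bdry f\<close> takes this one value at all such
    points.\<close>
  define d where "d = (THE l::complex. False)"
  define lm where "lm \<zeta> = lim (\<lambda>k. f (of_real (1 - 1 / real (Suc k)) * \<zeta>))" for \<zeta>
  have [measurable]: "(\<lambda>\<zeta>. f (of_real r * \<zeta>)) \<in> borel_measurable borel" for r by (rule dilate_measurable[OF f])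
  have [measurable]: "lm \<in> borel_measurable borel"
    unfolding lm_def by (rule borel_measurable_lim_metric) measurable
  have lim: "bdry f \<zeta> = lm \<zeta>" if "((\<lambda>r. f (of_real r * \<zeta>)) \<longlongrightarrow> l) (at_left 1)" for \<zeta> l
  proof -
    have "bdry f \<zeta> = l" unfolding bdry_def using that by (intro tendsto_Lim) auto
    moreover have "lm \<zeta> = l" unfolding lm_def by (rule limI) (rule filterlim_compose[OF that filterlim_radii])
    ultimately show ?thesis by simp
  qed
  have "bdry f \<zeta> = (if cmod \<zeta> = 1 \<and> \<not> (\<forall>j. \<exists>m. \<zeta> \<notin> U j m) then d else lm \<zeta>)" for \<zeta>
  proof (cases "cmod \<zeta> = 1 \<and> \<not> (\<forall>j. \<exists>m. \<zeta> \<notin> U j m)")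
    case True
    then have "\<not> ((\<lambda>r. f (of_real r * \<zeta>)) \<longlongrightarrow> l) (at_left 1)" for l using conv by blast
    then show ?thesis using True by (simp add: bdry_def Topological_Spaces.Lim_def d_def)
  next
    case False
    then consider "cmod \<zeta> < 1" | "1 < cmod \<zeta>" | "cmod \<zeta> = 1" "\<forall>j. \<exists>m. \<zeta> \<notin> U j m" by fastforce
    then have "\<exists>l. ((\<lambda>r. f (of_real r * \<zeta>)) \<longlongrightarrow> l) (at_left 1)"
      by cases (use radial_tendsto_inside[OF f] radial_tendsto_outside[OF f] conv in blast)+
    then show ?thesis using lim False by auto
  qed
  then have "bdry f = (\<lambda>\<zeta>. if cmod \<zeta> = 1 \<and> \<not> (\<forall>j. \<exists>m. \<zeta> \<notin> U j m) then d else lm \<zeta>)" by (rule ext)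
  moreover have "(\<lambda>\<zeta>. if cmod \<zeta> = 1 \<and> \<not> (\<forall>j. \<exists>m. \<zeta> \<notin> U j m) then d else lm \<zeta>) \<in> borel_measurable borel"
    by measurable
  ultimately show ?thesis by simp
qed

subsection \<open>Mean square convergence to the boundary function\<close>

lemma parseval_taylor_diff:
  assumes f: "taylor f c" and r: "0 \<le> r" "r < 1" and s: "0 \<le> s" "s < 1"
  shows "(\<lambda>n. (cmod (c n) * \<bar>r ^ n - s ^ n\<bar>)\<^sup>2) sums L2_sq (\<lambda>\<zeta>. f (of_real r * \<zeta>) - f (of_real s * \<zeta>))"
proof -
  let ?d = "\<lambda>n. c n * (of_real r ^ n - of_real s ^ n)"
  have nd: "cmod (?d n) = cmod (c n) * \<bar>r ^ n - s ^ n\<bar>" for n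
  proof -
    have "of_real r ^ n - of_real s ^ n = complex_of_real (r ^ n - s ^ n)" by simp
    then show ?thesis by (simp only: norm_mult norm_of_real)
  qed
  have "summable (\<lambda>n. cmod (?d n))"
  proof (rule summable_comparison_test')
    show "summable (\<lambda>n. cmod (c n) * r ^ n + cmod (c n) * s ^ n)"
      by (intro summable_add taylor_summable[OF f] r s)
    have "\<bar>r ^ n - s ^ n\<bar> \<le> r ^ n + s ^ n" for n
      using r s zero_le_power[of r n] zero_le_power[of s n] by (simp add: abs_le_iff)
    then show "norm (cmod (?d n)) \<le> cmod (c n) * r ^ n + cmod (c n) * s ^ n" for n
      unfolding nd by (simp add: mult_left_mono flip: distrib_left)
  qed
  then have "(\<lambda>n. (cmod (?d n))\<^sup>2) sums (\<integral>\<zeta>. (cmod (\<Sum>n. ?d n * \<zeta> ^ n))\<^sup>2 \<partial>circle_measure)"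
    by (rule parseval_summable)
  also have "(\<integral>\<zeta>. (cmod (\<Sum>n. ?d n * \<zeta> ^ n))\<^sup>2 \<partial>circle_measure) = L2_sq (\<lambda>\<zeta>. f (of_real r * \<zeta>) - f (of_real s * \<zeta>))"
    unfolding L2_sq_def
  proof (rule integral_cong_AE)
    show "AE \<zeta> in circle_measure. (cmod (\<Sum>n. ?d n * \<zeta> ^ n))\<^sup>2 = (cmod (f (of_real r * \<zeta>) - f (of_real s * \<zeta>)))\<^sup>2"
      using AE_circle_norm
    proof eventually_elim
      case (elim \<zeta>)
      then have "(\<lambda>n. c n * (of_real r * \<zeta>) ^ n - c n * (of_real s * \<zeta>) ^ n) sums (f (of_real r * \<zeta>) - f (of_real s * \<zeta>))"
        using f r s dilate_norm_less[of r \<zeta>] dilate_norm_less[of s \<zeta>] by (intro sums_diff) (auto simp: taylor_def)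
      then have "(\<lambda>n. ?d n * \<zeta> ^ n) sums (f (of_real r * \<zeta>) - f (of_real s * \<zeta>))"
        by (rule sums_cong[THEN iffD1, rotated]) (simp add: power_mult_distrib algebra_simps)
      then have "(\<Sum>n. ?d n * \<zeta> ^ n) = f (of_real r * \<zeta>) - f (of_real s * \<zeta>)"
        by (rule sums_unique [symmetric])
      then show ?case by (simp only:)
    qed
    have [measurable]: "(\<lambda>\<zeta>. f (of_real r * \<zeta>)) \<in> borel_measurable borel" for r
      using f by (intro dilate_measurable) (simp add: taylor_def)
    show "(\<lambda>\<zeta>. (cmod (f (of_real r * \<zeta>) - f (of_real s * \<zeta>)))\<^sup>2) \<in> borel_measurable circle_measure" by measurable
  qed measurable
  finally show ?thesis unfolding nd .
qed

text \<open>Fatou's lemma as the second radius \<rho> tends to 1, combined with Parseval: once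
  \<rho> > r, \<open>\<bar>r ^ n - \<rho> ^ n\<bar>\<close> is at most \<open>1 - r ^ n\<close>. The
  nonnegative integral is used because square integrability of \<open>bdry f\<close> is deduced from
  this bound.\<close>

lemma nn_integral_dilate_bdry_le:
  assumes f: "taylor f c" and s: "summable (\<lambda>n. (cmod (c n))\<^sup>2)" and r: "0 \<le> r" "r < 1"
  shows "(\<integral>\<^sup>+\<zeta>. ennreal ((cmod (f (of_real r * \<zeta>) - bdry f \<zeta>))\<^sup>2) \<partial>circle_measure)
    \<le> ennreal (\<Sum>n. (cmod (c n) * (1 - r ^ n))\<^sup>2)"
proof -
  have fa: "disk_analytic f" and fH: "f \<in> H2" using f s taylor_H2_iff by (auto simp: taylor_def)
  define \<rho> where "\<rho> k = 1 - 1 / real (Suc k)" for k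
  have \<rho>: "0 \<le> \<rho> k" "\<rho> k < 1" for k by (auto simp: \<rho>_def)
  have lim: "filterlim \<rho> (at_left 1) sequentially" unfolding \<rho>_def by (rule filterlim_radii)
  have [measurable]: "(\<lambda>\<zeta>. f (of_real r * \<zeta>)) \<in> borel_measurable borel" for r by (rule dilate_measurable[OF fa])
  have pow: "r ^ n \<le> 1" for n using r by (simp add: power_le_one)
  have "(\<integral>\<^sup>+\<zeta>. ennreal ((cmod (f (of_real r * \<zeta>) - bdry f \<zeta>))\<^sup>2) \<partial>circle_measure)
     = (\<integral>\<^sup>+\<zeta>. liminf (\<lambda>k. ennreal ((cmod (f (of_real r * \<zeta>) - f (of_real (\<rho> k) * \<zeta>)))\<^sup>2)) \<partial>circle_measure)"
  proof (rule nn_integral_cong_AE)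
    show "AE \<zeta> in circle_measure. ennreal ((cmod (f (of_real r * \<zeta>) - bdry f \<zeta>))\<^sup>2) =
      liminf (\<lambda>k. ennreal ((cmod (f (of_real r * \<zeta>) - f (of_real (\<rho> k) * \<zeta>)))\<^sup>2))"
      using H2_radial_limit[OF fH]
    proof eventually_elim
      case (elim \<zeta>)
      have "(\<lambda>k. f (of_real (\<rho> k) * \<zeta>)) \<longlonglongrightarrow> bdry f \<zeta>" by (rule filterlim_compose[OF elim lim])
      then have "(\<lambda>k. ennreal ((cmod (f (of_real r * \<zeta>) - f (of_real (\<rho> k) * \<zeta>)))\<^sup>2)) \<longlonglongrightarrow>
        ennreal ((cmod (f (of_real r * \<zeta>) - bdry f \<zeta>))\<^sup>2)"
        by (intro tendsto_ennrealI tendsto_intros)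
      then show ?case by (intro lim_imp_Liminf [symmetric]) auto
    qed
  qed
  also have "\<dots> \<le> liminf (\<lambda>k. \<integral>\<^sup>+\<zeta>. ennreal ((cmod (f (of_real r * \<zeta>) - f (of_real (\<rho> k) * \<zeta>)))\<^sup>2) \<partial>circle_measure)"
    by (rule nn_integral_liminf) measurable
  also have "\<dots> \<le> ennreal (\<Sum>n. (cmod (c n) * (1 - r ^ n))\<^sup>2)"
  proof (rule Liminf_le)
    have "\<forall>\<^sub>F k in sequentially. \<rho> k \<in> {r<..<1}"
      using eventually_at_left_real[OF r(2)] lim by (auto simp: filterlim_iff)
    then show "\<forall>\<^sub>F k in sequentially. (\<integral>\<^sup>+\<zeta>. ennreal ((cmod (f (of_real r * \<zeta>) - f (of_real (\<rho> k) * \<zeta>)))\<^sup>2) \<partial>circle_measure)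
      \<le> ennreal (\<Sum>n. (cmod (c n) * (1 - r ^ n))\<^sup>2)"
    proof eventually_elim
      case (elim k)
      have ms: "summable (\<lambda>n. (cmod (c n) * (1 - r ^ n))\<^sup>2)"
      proof (rule summable_comparison_test'[OF s])
        show "norm ((cmod (c n) * (1 - r ^ n))\<^sup>2) \<le> (cmod (c n))\<^sup>2" for n
          using pow[of n] r by (auto intro!: power_mono mult_left_le)
      qed
      note L = L2_diff[OF dilate_L2[OF fa r] dilate_L2[OF fa \<rho>[of k]]]
      have "L2_sq (\<lambda>\<zeta>. f (of_real r * \<zeta>) - f (of_real (\<rho> k) * \<zeta>)) \<le> (\<Sum>n. (cmod (c n) * (1 - r ^ n))\<^sup>2)"
      proof (rule sums_le[OF _ parseval_taylor_diff[OF f r \<rho>] summable_sums[OF ms]])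
        fix n
        have "r ^ n \<le> \<rho> k ^ n" "\<rho> k ^ n \<le> 1" using elim r \<rho>[of k] by (auto intro: power_mono power_le_one)
        then show "(cmod (c n) * \<bar>r ^ n - \<rho> k ^ n\<bar>)\<^sup>2 \<le> (cmod (c n) * (1 - r ^ n))\<^sup>2"
          by (intro power_mono mult_left_mono) auto
      qed
      then show ?case unfolding nn_integral_L2_sq[OF L] by (rule ennreal_leI)
    qed
  qed auto
  finally show ?thesis .
qed

lemma H2_dilate_diff_L2:
  assumes f: "f \<in> H2" and r: "0 \<le> r" "r < 1"
  shows "(\<lambda>\<zeta>. f (of_real r * \<zeta>) - bdry f \<zeta>) \<in> L2"
proof -
  obtain c where c: "taylor f c" "summable (\<lambda>n. (cmod (c n))\<^sup>2)"
    using f disk_analytic_taylor H2_disk_analytic taylor_H2_iff by blast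
  note [measurable] = dilate_measurable[OF H2_disk_analytic[OF f]] bdry_measurable[OF H2_disk_analytic[OF f]]
  have "integrable circle_measure (\<lambda>\<zeta>. (cmod (f (of_real r * \<zeta>) - bdry f \<zeta>))\<^sup>2)"
  proof (rule integrableI_nonneg)
    show "(\<integral>\<^sup>+\<zeta>. ennreal ((cmod (f (of_real r * \<zeta>) - bdry f \<zeta>))\<^sup>2) \<partial>circle_measure) < \<infinity>"
      using nn_integral_dilate_bdry_le[OF c r] by (rule le_less_trans) simp
  qed auto
  then show ?thesis by (simp add: L2_def)
qed

lemma bdry_L2:
  assumes f: "f \<in> H2"
  shows "bdry f \<in> L2"
proof -
  \<comment> \<open>The dilate of radius 0 is the constant f 0; any radius below 1 would
    serve.\<close>
  have "(\<lambda>\<zeta>. f (of_real 0 * \<zeta>) - (f (of_real 0 * \<zeta>) - bdry f \<zeta>)) \<in> L2"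
    by (intro L2_diff[OF dilate_L2 H2_dilate_diff_L2] H2_disk_analytic f) auto
  then show ?thesis by simp
qed

lemma at_left_1_radius: "\<forall>\<^sub>F r in at_left (1::real). 0 < r \<and> r < 1"
  using eventually_at_left_real[of 0 "1::real"] by simp

text \<open>Tannery's theorem: each coefficient difference tends to 0, and the summable squared
  coefficients dominate them all.\<close>

lemma H2_dilate_tendsto:
  assumes f: "f \<in> H2"
  shows "((\<lambda>r. L2_sq (\<lambda>\<zeta>. f (of_real r * \<zeta>) - bdry f \<zeta>)) \<longlongrightarrow> 0) (at_left 1)"
proof -
  obtain c where c: "taylor f c" "summable (\<lambda>n. (cmod (c n))\<^sup>2)"
    using f disk_analytic_taylor H2_disk_analytic taylor_H2_iff by blast
  have "((\<lambda>r. \<Sum>n. (cmod (c n) * (1 - r ^ n))\<^sup>2) \<longlongrightarrow> (\<Sum>n. (cmod (c n) * (1 - 1 ^ n))\<^sup>2)) (at_left 1)"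
  proof (rule tannerys_theorem[THEN conjunct2, THEN conjunct2])
    show "((\<lambda>r. (cmod (c k) * (1 - r ^ k))\<^sup>2) \<longlongrightarrow> (cmod (c k) * (1 - 1 ^ k))\<^sup>2) (at_left 1)" for k
      by (intro tendsto_intros)
    have "\<forall>\<^sub>F (k::nat, r) in at_top \<times>\<^sub>F at_left (1::real). 0 < r \<and> r < 1"
      by (subst eventually_prod2) (auto intro: at_left_1_radius)
    then show "\<forall>\<^sub>F (k, r) in at_top \<times>\<^sub>F at_left (1::real). norm ((cmod (c k) * (1 - r ^ k))\<^sup>2) \<le> (cmod (c k))\<^sup>2"
      by eventually_elim (auto intro!: power_mono mult_left_le simp: power_le_one)
  qed (use c in auto)
  then have lim: "((\<lambda>r. \<Sum>n. (cmod (c n) * (1 - r ^ n))\<^sup>2) \<longlongrightarrow> 0) (at_left 1)" by simp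
  show ?thesis
  proof (rule Lim_null_comparison[OF _ lim])
    show "\<forall>\<^sub>F r in at_left 1. norm (L2_sq (\<lambda>\<zeta>. f (of_real r * \<zeta>) - bdry f \<zeta>)) \<le> (\<Sum>n. (cmod (c n) * (1 - r ^ n))\<^sup>2)"
      using at_left_1_radius
    proof eventually_elim
      case (elim r)
      then have r: "0 \<le> r" "r < 1" by auto
      have nn: "0 \<le> (\<Sum>n. (cmod (c n) * (1 - r ^ n))\<^sup>2)"
      proof (rule suminf_nonneg)
        show "summable (\<lambda>n. (cmod (c n) * (1 - r ^ n))\<^sup>2)"
          by (rule summable_comparison_test'[OF c(2)]) (use r in \<open>auto intro!: power_mono mult_left_le simp: power_le_one\<close>)
      qed auto
      have "ennreal (L2_sq (\<lambda>\<zeta>. f (of_real r * \<zeta>) - bdry f \<zeta>)) \<le> ennreal (\<Sum>n. (cmod (c n) * (1 - r ^ n))\<^sup>2)"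
        using nn_integral_dilate_bdry_le[OF c r] by (simp add: nn_integral_L2_sq[OF H2_dilate_diff_L2[OF f r]])
      then show ?case using nn by (simp add: ennreal_le_iff)
    qed
  qed
qed

lemma bdry_eqI: "((\<lambda>r. f (of_real r * \<zeta>)) \<longlongrightarrow> l) (at_left 1) \<Longrightarrow> bdry f \<zeta> = l"
  unfolding bdry_def by (intro tendsto_Lim) auto

lemma eventually_dilate_L2: "disk_analytic f \<Longrightarrow> \<forall>\<^sub>F r in at_left 1. (\<lambda>\<zeta>. f (of_real r * \<zeta>)) \<in> L2"
  using at_left_1_radius by eventually_elim (auto intro: dilate_L2)

lemma H2_tendsto_integral:
  assumes f: "f \<in> H2" and g: "g \<in> L2"
  shows "((\<lambda>r. \<integral>\<zeta>. f (of_real r * \<zeta>) * g \<zeta> \<partial>circle_measure) \<longlongrightarrow> (\<integral>\<zeta>. bdry f \<zeta> * g \<zeta> \<partial>circle_measure)) (at_left 1)"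
  by (rule L2_tendsto_integral[OF eventually_dilate_L2 bdry_L2 g H2_dilate_tendsto])
     (use f H2_disk_analytic in auto)

text \<open>By Parseval the mean squares increase with the radius, and they converge to that of the
  boundary function.\<close>

lemma L2_sq_dilate_le_bdry:
  assumes f: "f \<in> H2" and r: "0 \<le> r" "r < 1"
  shows "L2_sq (\<lambda>\<zeta>. f (of_real r * \<zeta>)) \<le> L2_sq (bdry f)"
proof -
  obtain c where c: "taylor f c" using disk_analytic_taylor H2_disk_analytic f by blast
  have lim: "((\<lambda>s. L2_sq (\<lambda>\<zeta>. f (of_real s * \<zeta>))) \<longlongrightarrow> L2_sq (bdry f)) (at_left 1)"
    by (rule L2_tendsto_sq[OF eventually_dilate_L2 bdry_L2 H2_dilate_tendsto])
       (use f H2_disk_analytic in auto)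
  show ?thesis
  proof (rule tendsto_lowerbound[OF lim])
    show "\<forall>\<^sub>F s in at_left 1. L2_sq (\<lambda>\<zeta>. f (of_real r * \<zeta>)) \<le> L2_sq (\<lambda>\<zeta>. f (of_real s * \<zeta>))"
      using eventually_at_left_real[OF r(2)]
    proof eventually_elim
      case (elim s)
      then have s: "0 \<le> s" "s < 1" "r \<le> s" using r by auto
      show ?case
        by (rule sums_le[OF _ parseval_taylor[OF c r] parseval_taylor[OF c s(1,2)]])
           (use r s in \<open>auto intro!: power_mono mult_left_mono\<close>)
    qed
  qed simp
qed

section \<open>Differences and bounded multiples of Hardy space functions\<close>

lemma H2_diff:
  assumes f: "f \<in> H2" and g: "g \<in> H2"
  shows "(\<lambda>z. f z - g z) \<in> H2"
proof -
  obtain c where c: "taylor f c" using disk_analytic_taylor[OF H2_disk_analytic[OF f]] by blast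
  obtain d where d: "taylor g d" using disk_analytic_taylor[OF H2_disk_analytic[OF g]] by blast
  have "summable (\<lambda>n. (cmod (c n - d n))\<^sup>2)"
  proof (rule summable_comparison_test')
    show "summable (\<lambda>n. 2 * (cmod (c n))\<^sup>2 + 2 * (cmod (d n))\<^sup>2)"
      using f g unfolding taylor_H2_iff[OF c] taylor_H2_iff[OF d] by (intro summable_add summable_mult)
    fix n
    have "(cmod (c n - d n))\<^sup>2 \<le> (cmod (c n) + cmod (d n))\<^sup>2" by (intro power_mono norm_triangle_ineq4) auto
    also have "\<dots> \<le> 2 * (cmod (c n))\<^sup>2 + 2 * (cmod (d n))\<^sup>2"
      using sum_squares_bound[of "cmod (c n)" "cmod (d n)"] by (simp add: power2_sum)
    finally show "norm ((cmod (c n - d n))\<^sup>2) \<le> 2 * (cmod (c n))\<^sup>2 + 2 * (cmod (d n))\<^sup>2" by simp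
  qed
  then show ?thesis using taylor_H2_iff[OF taylor_diff[OF c d]] by simp
qed

lemma bdry_diff:
  assumes "f \<in> H2" "g \<in> H2"
  shows "AE \<zeta> in circle_measure. bdry (\<lambda>z. f z - g z) \<zeta> = bdry f \<zeta> - bdry g \<zeta>"
  using H2_radial_limit[OF assms(1)] H2_radial_limit[OF assms(2)]
  by eventually_elim (intro bdry_eqI tendsto_diff)

lemma Hinf_bound: "a \<in> Hinf \<Longrightarrow> \<exists>B. 0 \<le> B \<and> (\<forall>z. cmod (a z) \<le> B)"
proof -
  assume a: "a \<in> Hinf"
  then have "\<exists>B. \<forall>z\<in>ball 0 1. cmod (a z) \<le> B" by (simp add: Hinf_def bounded_iff)
  then obtain B where B: "\<And>z. z \<in> ball 0 1 \<Longrightarrow> cmod (a z) \<le> B" by blast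
  have "cmod (a z) \<le> max B 0" for z
    using a B[of z] by (cases "z \<in> ball 0 1") (auto simp: Hinf_def disk_analytic_def)
  then show ?thesis by (intro exI[of _ "max B 0"]) auto
qed

lemma HinfI: "disk_analytic a \<Longrightarrow> (\<And>z. cmod z < 1 \<Longrightarrow> cmod (a z) \<le> B) \<Longrightarrow> a \<in> Hinf"
  unfolding Hinf_def bounded_iff by (simp, intro exI[of _ B]) auto

lemma disk_analytic_mult: "disk_analytic a \<Longrightarrow> disk_analytic f \<Longrightarrow> disk_analytic (\<lambda>z. a z * f z)"
  by (auto simp: disk_analytic_def intro!: holomorphic_intros)

lemma L2_sq_bounded_mult:
  assumes [measurable]: "a \<in> borel_measurable borel" and b: "AE \<zeta> in circle_measure. cmod (a \<zeta>) \<le> B"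
    and f: "f \<in> L2"
  shows "L2_sq (\<lambda>\<zeta>. a \<zeta> * f \<zeta>) \<le> B\<^sup>2 * L2_sq f"
proof -
  have "L2_sq (\<lambda>\<zeta>. a \<zeta> * f \<zeta>) \<le> (\<integral>\<zeta>. B\<^sup>2 * (cmod (f \<zeta>))\<^sup>2 \<partial>circle_measure)"
    unfolding L2_sq_def
  proof (rule integral_mono_AE)
    show "AE \<zeta> in circle_measure. (cmod (a \<zeta> * f \<zeta>))\<^sup>2 \<le> B\<^sup>2 * (cmod (f \<zeta>))\<^sup>2"
      using b by eventually_elim (auto simp: norm_mult power_mult_distrib intro!: mult_right_mono power_mono)
  qed (use L2_integrable_sq[OF f] L2_integrable_sq[OF L2_bounded_mult[OF assms]] in auto)
  then show ?thesis by (simp add: L2_sq_def)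
qed

lemma Hinf_mult_H2:
  assumes a: "a \<in> Hinf" and f: "f \<in> H2"
  shows "(\<lambda>z. a z * f z) \<in> H2"
proof -
  obtain B where B: "0 \<le> B" "\<And>z. cmod (a z) \<le> B" using Hinf_bound[OF a] by blast
  have da: "disk_analytic a" using a by (simp add: Hinf_def)
  have "L2_sq (\<lambda>\<zeta>. a (of_real r * \<zeta>) * f (of_real r * \<zeta>)) \<le> B\<^sup>2 * L2_sq (bdry f)" if r: "0 \<le> r" "r < 1" for r
  proof -
    have "L2_sq (\<lambda>\<zeta>. a (of_real r * \<zeta>) * f (of_real r * \<zeta>)) \<le> B\<^sup>2 * L2_sq (\<lambda>\<zeta>. f (of_real r * \<zeta>))"
      using B by (intro L2_sq_bounded_mult dilate_measurable dilate_L2 da H2_disk_analytic[OF f] r) auto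
    also have "\<dots> \<le> B\<^sup>2 * L2_sq (bdry f)"
      using L2_sq_dilate_le_bdry[OF f r] by (intro mult_left_mono) auto
    finally show ?thesis .
  qed
  then show ?thesis
    using disk_analytic_mult[OF da H2_disk_analytic[OF f]] by (auto simp: H2_iff_bounded)
qed

lemma Hinf_subset_H2: "a \<in> Hinf \<Longrightarrow> a \<in> H2"
proof -
  assume a: "a \<in> Hinf"
  obtain B where B: "0 \<le> B" "\<And>z. cmod (a z) \<le> B" using Hinf_bound[OF a] by blast
  have da: "disk_analytic a" using a by (simp add: Hinf_def)
  have one: "(\<lambda>_. 1) \<in> L2" "L2_sq (\<lambda>_. 1) = 1" by (auto simp: L2_def L2_sq_def)
  have "L2_sq (\<lambda>\<zeta>. a (of_real r * \<zeta>)) \<le> B\<^sup>2" if r: "0 \<le> r" "r < 1" for r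
    using L2_sq_bounded_mult[OF dilate_measurable[OF da], of r B, OF _ one(1)] B one(2) by simp
  then show ?thesis using da by (auto simp: H2_iff_bounded)
qed

lemma bdry_mult:
  assumes "a \<in> H2" and f: "f \<in> H2"
  shows "AE \<zeta> in circle_measure. bdry (\<lambda>z. a z * f z) \<zeta> = bdry a \<zeta> * bdry f \<zeta>"
  using H2_radial_limit[OF assms(1)] H2_radial_limit[OF f]
  by eventually_elim (intro bdry_eqI tendsto_mult)

lemma bdry_Hinf_bound:
  assumes a: "a \<in> H2" "\<And>z. cmod (a z) \<le> B"
  shows "AE \<zeta> in circle_measure. cmod (bdry a \<zeta>) \<le> B"
  using H2_radial_limit[OF a(1)]
proof eventually_elim
  case (elim \<zeta>)
  show ?case by (rule tendsto_upperbound[OF tendsto_norm[OF elim]]) (use a in auto)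
qed

subsection \<open>Reproducing kernels\<close>

definition inv_power :: "complex \<Rightarrow> nat \<Rightarrow> complex \<Rightarrow> complex" where
  "inv_power z n w = (if cmod w < 1 then 1 / (1 - cnj z * w) ^ n else 0)"

lemma disk_analytic_inv_power:
  assumes "cmod z \<le> 1"
  shows "disk_analytic (inv_power z n)"
proof -
  have "inv_power z n holomorphic_on ball 0 1"
    by (rule holomorphic_transform[of "\<lambda>w. 1 / (1 - cnj z * w) ^ n"])
       (use one_minus_cnj_mult_nonzero[OF assms] in \<open>auto simp: inv_power_def intro!: holomorphic_intros\<close>)
  then show ?thesis by (auto simp: disk_analytic_def inv_power_def)
qed

lemma inv_power_radial:
  assumes "1 - cnj z * \<zeta> \<noteq> 0" "cmod \<zeta> = 1"
  shows "((\<lambda>r. inv_power z n (of_real r * \<zeta>)) \<longlongrightarrow> 1 / (1 - cnj z * \<zeta>) ^ n) (at_left 1)"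
proof -
  have "((\<lambda>r. 1 / (1 - cnj z * (of_real r * \<zeta>)) ^ n) \<longlongrightarrow> 1 / (1 - cnj z * (of_real 1 * \<zeta>)) ^ n) (at_left 1)"
    using assms by (intro tendsto_intros) auto
  moreover have "\<forall>\<^sub>F r in at_left (1::real). 1 / (1 - cnj z * (of_real r * \<zeta>)) ^ n = inv_power z n (of_real r * \<zeta>)"
    using at_left_1_radius by eventually_elim (use assms in \<open>auto simp: inv_power_def norm_mult\<close>)
  ultimately show ?thesis by (simp add: tendsto_cong)
qed

lemma inv_power_Hinf:
  assumes "cmod z < 1"
  shows "inv_power z n \<in> Hinf"
proof (rule HinfI)
  show "disk_analytic (inv_power z n)" using assms by (intro disk_analytic_inv_power) simp
  fix w assume w: "cmod w < 1"
  have "1 - cmod z \<le> cmod (1 - cnj z * w)"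
  proof -
    have "cmod (cnj z * w) \<le> cmod z * 1" unfolding norm_mult using w by (intro mult_mono) auto
    then show ?thesis using norm_triangle_ineq2[of 1 "cnj z * w"] by simp
  qed
  then show "cmod (inv_power z n w) \<le> 1 / (1 - cmod z) ^ n"
    unfolding inv_power_def using w assms by (auto simp: norm_divide norm_power intro!: frac_le power_mono)
qed

definition monomial :: "nat \<Rightarrow> complex \<Rightarrow> complex" where
  "monomial l z = (if cmod z < 1 then fact l * z ^ l else 0)"

lemma monomial_Hinf: "monomial l \<in> Hinf"
proof (rule HinfI)
  have "monomial l holomorphic_on ball 0 1"
    by (rule holomorphic_transform[of "\<lambda>z. fact l * z ^ l"]) (auto simp: monomial_def intro!: holomorphic_intros)
  then show "disk_analytic (monomial l)" by (auto simp: disk_analytic_def monomial_def)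
  fix z :: complex assume "cmod z < 1"
  then show "cmod (monomial l z) \<le> fact l"
    by (simp add: monomial_def norm_mult norm_power power_le_one mult_left_le)
qed

lemma monomial_radial:
  assumes z: "cmod \<zeta> = 1"
  shows "((\<lambda>r. monomial l (of_real r * \<zeta>)) \<longlongrightarrow> fact l * \<zeta> ^ l) (at_left 1)"
proof -
  have "((\<lambda>r. fact l * (of_real r * \<zeta>) ^ l) \<longlongrightarrow> fact l * (of_real 1 * \<zeta>) ^ l) (at_left 1)"
    by (intro tendsto_intros)
  moreover have "\<forall>\<^sub>F r in at_left (1::real). fact l * (of_real r * \<zeta>) ^ l = monomial l (of_real r * \<zeta>)"
    using at_left_1_radius by eventually_elim (use z in \<open>auto simp: monomial_def norm_mult\<close>)
  ultimately show ?thesis by (simp add: tendsto_cong)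
qed

lemma Hinf_mult:
  assumes a: "a \<in> Hinf" and b: "b \<in> Hinf"
  shows "(\<lambda>z. a z * b z) \<in> Hinf"
proof -
  obtain A B where A: "\<And>z. cmod (a z) \<le> A" and B: "\<And>z. cmod (b z) \<le> B"
    using Hinf_bound[OF a] Hinf_bound[OF b] by blast
  have "cmod (a z * b z) \<le> A * B" for z
    unfolding norm_mult by (intro mult_mono A B order_trans[OF norm_ge_zero A] norm_ge_zero)
  then show ?thesis using a b by (intro HinfI[of _ "A * B"] disk_analytic_mult) (auto simp: Hinf_def)
qed

text \<open>The l-th derivative of the Szego kernel 1 / (1 - cnj z w) with respect to cnj z; the
  factorial is contained in \<open>monomial\<close>.\<close>

definition szego_deriv :: "complex \<Rightarrow> nat \<Rightarrow> complex \<Rightarrow> complex" where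
  "szego_deriv z l w = monomial l w * inv_power z (Suc l) w"

lemma szego_deriv_Hinf: "cmod z < 1 \<Longrightarrow> szego_deriv z l \<in> Hinf"
  unfolding szego_deriv_def[abs_def] by (intro Hinf_mult monomial_Hinf inv_power_Hinf)

lemma bdry_szego_deriv:
  assumes "1 - cnj z * \<zeta> \<noteq> 0" "cmod \<zeta> = 1"
  shows "bdry (szego_deriv z l) \<zeta> = fact l * \<zeta> ^ l / (1 - cnj z * \<zeta>) ^ Suc l"
proof -
  have "bdry (szego_deriv z l) \<zeta> = fact l * \<zeta> ^ l * (1 / (1 - cnj z * \<zeta>) ^ Suc l)"
    unfolding szego_deriv_def[abs_def]
    by (intro bdry_eqI tendsto_mult monomial_radial inv_power_radial assms)
  then show ?thesis by simp
qed

lemma bdry_szego_deriv_inside: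
  assumes "cmod z < 1" "cmod \<zeta> = 1"
  shows "bdry (szego_deriv z l) \<zeta> = fact l * \<zeta> ^ l / (1 - cnj z * \<zeta>) ^ Suc l"
  using one_minus_cnj_mult_nonzero[of z \<zeta>] assms by (intro bdry_szego_deriv) auto

text \<open>Since cnj \<zeta> = 1 / \<zeta> on the circle, conjugation turns the Szego kernel into
  the kernel of \<open>cauchy_circle\<close>.\<close>

lemma cnj_szego:
  assumes "cmod \<zeta> = 1"
  shows "cnj (fact l * \<zeta> ^ l / (1 - cnj z * \<zeta>) ^ Suc l) = fact l * (\<zeta> / (\<zeta> - z) ^ Suc l)"
proof -
  have u: "\<zeta> * cnj \<zeta> = 1" using assms by (rule unimodular_mult_cnj)
  then have "\<zeta> - z = \<zeta> * (1 - z * cnj \<zeta>)" by (simp add: algebra_simps)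
  then have "\<zeta> / (\<zeta> - z) ^ Suc l = \<zeta> / (\<zeta> ^ Suc l * (1 - z * cnj \<zeta>) ^ Suc l)"
    by (simp only: power_mult_distrib)
  also have "\<dots> = 1 / (\<zeta> ^ l * (1 - z * cnj \<zeta>) ^ Suc l)" using assms by auto
  also have "1 / \<zeta> ^ l = cnj \<zeta> ^ l"
    using u by (metis power_mult_distrib power_one nonzero_eq_divide_eq mult.commute mult_zero_left zero_neq_one)
  then have "1 / (\<zeta> ^ l * (1 - z * cnj \<zeta>) ^ Suc l) = cnj \<zeta> ^ l / (1 - z * cnj \<zeta>) ^ Suc l"
    by (metis divide_divide_eq_left)
  finally show ?thesis by simp
qed

text \<open>For a dilate of radius r this is Cauchy's formula, where the chain rule contributes
  \<open>r ^ l\<close> and moves the point to r z. As r tends to 1, one side converges by continuity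
  of the derivative inside the disk and the other by mean square convergence.\<close>

lemma H2_reproducing:
  assumes f: "f \<in> H2" and z: "cmod z < 1"
  shows "(deriv ^^ l) f z = L2_inner (bdry f) (bdry (szego_deriv z l))"
proof -
  have da: "disk_analytic f" by (rule H2_disk_analytic[OF f])
  then have hol: "f holomorphic_on ball 0 1" by (simp add: disk_analytic_def)
  define g where "g \<zeta> = cnj (bdry (szego_deriv z l) \<zeta>)" for \<zeta>
  have gL: "g \<in> L2"
    unfolding g_def by (intro L2_cnj bdry_L2 Hinf_subset_H2 szego_deriv_Hinf z)
  have g: "AE \<zeta> in circle_measure. g \<zeta> = fact l * (\<zeta> / (\<zeta> - z) ^ Suc l)"
    using AE_circle_norm by eventually_elim (simp only: g_def bdry_szego_deriv_inside[OF z] cnj_szego)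
  have eq: "(\<integral>\<zeta>. f (of_real r * \<zeta>) * g \<zeta> \<partial>circle_measure) = of_real r ^ l * (deriv ^^ l) f (of_real r * z)"
    if r: "0 \<le> r" "r < 1" for r
  proof -
    note [measurable] = L2_measurable[OF gL] dilate_measurable[OF da]
    have "(\<integral>\<zeta>. f (of_real r * \<zeta>) * g \<zeta> \<partial>circle_measure)
       = (\<integral>\<zeta>. fact l * (f (of_real r * \<zeta>) * \<zeta> / (\<zeta> - z) ^ Suc l) \<partial>circle_measure)"
      by (rule integral_cong_AE) (use g in \<open>auto elim!: eventually_mono\<close>)
    also have "\<dots> = fact l * ((deriv ^^ l) (\<lambda>\<zeta>. f (of_real r * \<zeta>)) z / fact l)"
      by (subst integral_mult_right_zero, subst cauchy_circle)
         (use z r in \<open>auto intro!: dilate_measurable da dilate_continuous hol holomorphic_on_subset[OF dilate_holomorphic[OF hol r]]\<close>)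
    also have "(deriv ^^ l) (\<lambda>\<zeta>. f (of_real r * \<zeta>)) z = of_real r ^ l * (deriv ^^ l) f (of_real r * z)"
      by (rule higher_deriv_compose_linear[OF hol, of "ball 0 1"])
         (use z r in \<open>auto intro!: dilate_norm_less\<close>)
    finally show ?thesis by simp
  qed
  have lim1: "((\<lambda>r. \<integral>\<zeta>. f (of_real r * \<zeta>) * g \<zeta> \<partial>circle_measure) \<longlongrightarrow> (\<integral>\<zeta>. bdry f \<zeta> * g \<zeta> \<partial>circle_measure)) (at_left 1)"
    by (rule H2_tendsto_integral[OF f gL])
  have "continuous_on (ball 0 1) ((deriv ^^ l) f)"
    by (intro holomorphic_on_imp_continuous_on holomorphic_higher_deriv hol open_ball)
  then have "isCont ((deriv ^^ l) f) z" using z by (simp add: continuous_on_eq_continuous_at)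
  moreover have "((\<lambda>r. of_real r * z) \<longlongrightarrow> of_real 1 * z) (at_left 1)" by (intro tendsto_intros)
  ultimately have "((\<lambda>r. (deriv ^^ l) f (of_real r * z)) \<longlongrightarrow> (deriv ^^ l) f z) (at_left 1)"
    using isCont_tendsto_compose[of z "(deriv ^^ l) f"] by simp
  then have "((\<lambda>r. of_real r ^ l * (deriv ^^ l) f (of_real r * z)) \<longlongrightarrow> of_real 1 ^ l * (deriv ^^ l) f z) (at_left 1)"
    by (intro tendsto_intros)
  then have "((\<lambda>r. of_real r ^ l * (deriv ^^ l) f (of_real r * z)) \<longlongrightarrow> (deriv ^^ l) f z) (at_left 1)"
    by simp
  then have lim2: "((\<lambda>r. \<integral>\<zeta>. f (of_real r * \<zeta>) * g \<zeta> \<partial>circle_measure) \<longlongrightarrow> (deriv ^^ l) f z) (at_left 1)"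
    by (rule Lim_transform_eventually) (use at_left_1_radius in \<open>auto elim!: eventually_mono simp: eq\<close>)
  have "(\<integral>\<zeta>. bdry f \<zeta> * g \<zeta> \<partial>circle_measure) = (deriv ^^ l) f z"
    by (rule tendsto_unique[OF _ lim1 lim2]) simp
  then show ?thesis by (simp add: L2_inner_def g_def)
qed

text \<open>The factor \<zeta> makes the product vanish at the origin. The product of two
  \<open>H2\<close> functions need not be square integrable, so v and w are dilated with separate
  radii that tend to 1 one after the other; each limit then pairs an \<open>H2\<close> function with
  a fixed member of \<open>L2\<close>.\<close>

lemma H2_mult_mean_zero:
  assumes v: "v \<in> H2" and w: "w \<in> H2"
  shows "(\<integral>\<zeta>. \<zeta> * (bdry v \<zeta> * bdry w \<zeta>) \<partial>circle_measure) = 0"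
proof -
  note dv = H2_disk_analytic[OF v] and dw = H2_disk_analytic[OF w]
  have hv: "v holomorphic_on ball 0 1" and hw: "w holomorphic_on ball 0 1" using dv dw by (auto simp: disk_analytic_def)
  have zL: "(\<lambda>\<zeta>. \<zeta> * f \<zeta>) \<in> L2" if "f \<in> L2" for f
    by (rule L2_bounded_mult[of "\<lambda>\<zeta>. \<zeta>" 1, OF _ _ that]) (use AE_circle_norm in \<open>auto elim!: eventually_mono\<close>)
  have 1: "(\<integral>\<zeta>. v (of_real r * \<zeta>) * (\<zeta> * w (of_real s * \<zeta>)) \<partial>circle_measure) = 0"
    if "0 < r \<and> r < 1" "0 < s \<and> s < 1" for r s
    using that by (subst cauchy_circle_0)
      (auto intro!: borel_measurable_times dilate_measurable dv dw continuous_intros dilate_continuous hv hw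
        holomorphic_intros holomorphic_on_subset[OF dilate_holomorphic[OF hv]] holomorphic_on_subset[OF dilate_holomorphic[OF hw]])
  have 2: "(\<integral>\<zeta>. w (of_real s * \<zeta>) * (\<zeta> * bdry v \<zeta>) \<partial>circle_measure) = 0" if s: "0 < s \<and> s < 1" for s
  proof -
    have "((\<lambda>r. \<integral>\<zeta>. v (of_real r * \<zeta>) * (\<zeta> * w (of_real s * \<zeta>)) \<partial>circle_measure) \<longlongrightarrow>
       (\<integral>\<zeta>. bdry v \<zeta> * (\<zeta> * w (of_real s * \<zeta>)) \<partial>circle_measure)) (at_left 1)"
      by (intro H2_tendsto_integral v zL dilate_L2 dw) (use s in auto)
    moreover have "((\<lambda>r. \<integral>\<zeta>. v (of_real r * \<zeta>) * (\<zeta> * w (of_real s * \<zeta>)) \<partial>circle_measure) \<longlongrightarrow> 0) (at_left 1)"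
      by (rule tendsto_eventually) (use at_left_1_radius s in \<open>auto elim!: eventually_mono intro!: 1\<close>)
    ultimately have "(\<integral>\<zeta>. bdry v \<zeta> * (\<zeta> * w (of_real s * \<zeta>)) \<partial>circle_measure) = 0"
      by (intro tendsto_unique[of "at_left (1::real)"]) auto
    then show ?thesis by (simp add: mult_ac)
  qed
  have "((\<lambda>s. \<integral>\<zeta>. w (of_real s * \<zeta>) * (\<zeta> * bdry v \<zeta>) \<partial>circle_measure) \<longlongrightarrow>
       (\<integral>\<zeta>. bdry w \<zeta> * (\<zeta> * bdry v \<zeta>) \<partial>circle_measure)) (at_left 1)"
    by (intro H2_tendsto_integral w zL bdry_L2 v)
  moreover have "((\<lambda>s. \<integral>\<zeta>. w (of_real s * \<zeta>) * (\<zeta> * bdry v \<zeta>) \<partial>circle_measure) \<longlongrightarrow> 0) (at_left 1)"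
    by (rule tendsto_eventually) (use at_left_1_radius in \<open>auto elim!: eventually_mono intro!: 2\<close>)
  ultimately have "(\<integral>\<zeta>. bdry w \<zeta> * (\<zeta> * bdry v \<zeta>) \<partial>circle_measure) = 0"
    by (intro tendsto_unique[of "at_left (1::real)"]) auto
  then show ?thesis by (simp add: mult_ac)
qed

subsection \<open>The orthogonal projection\<close>

text \<open>Reduces pairing with a dilated analytic function to Fourier coefficients of g; uniform
  absolute convergence for r < 1 justifies the exchange.\<close>

lemma taylor_dilate_integral:
  assumes u: "taylor u d" and g: "g \<in> L2" and r: "0 \<le> r" "r < 1"
  shows "(\<lambda>n. d n * of_real r ^ n * (\<integral>\<zeta>. g \<zeta> * \<zeta> ^ n \<partial>circle_measure)) sums (\<integral>\<zeta>. g \<zeta> * u (of_real r * \<zeta>) \<partial>circle_measure)"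
proof -
  note [measurable] = L2_measurable[OF g]
  have one: "(\<lambda>_. 1) \<in> L2" by (auto simp: L2_def)
  have gi: "integrable circle_measure g" using L2_mult_integrable[OF g one] by simp
  let ?S = "\<Sum>n. cmod (d n) * r ^ n"
  note sm = taylor_summable[OF u r]
  have S: "(\<integral>\<zeta>. g \<zeta> * (\<Sum>n<N. d n * (of_real r * \<zeta>) ^ n) \<partial>circle_measure)
      = (\<Sum>n<N. d n * of_real r ^ n * (\<integral>\<zeta>. g \<zeta> * \<zeta> ^ n \<partial>circle_measure))" for N
  proof -
    have "(\<integral>\<zeta>. g \<zeta> * (\<Sum>n<N. d n * (of_real r * \<zeta>) ^ n) \<partial>circle_measure)
      = (\<integral>\<zeta>. (\<Sum>n<N. d n * of_real r ^ n * (g \<zeta> * \<zeta> ^ n)) \<partial>circle_measure)"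
      by (simp add: sum_distrib_left power_mult_distrib mult_ac)
    also have "\<dots> = (\<Sum>n<N. d n * of_real r ^ n * (\<integral>\<zeta>. g \<zeta> * \<zeta> ^ n \<partial>circle_measure))"
      by (subst Bochner_Integration.integral_sum) (auto intro!: integrable_mult_right L2_mult_integrable g power_L2)
    finally show ?thesis .
  qed
  have "(\<lambda>N. \<integral>\<zeta>. g \<zeta> * (\<Sum>n<N. d n * (of_real r * \<zeta>) ^ n) \<partial>circle_measure) \<longlonglongrightarrow> (\<integral>\<zeta>. g \<zeta> * u (of_real r * \<zeta>) \<partial>circle_measure)"
  proof (rule integral_dominated_convergence[where w="\<lambda>\<zeta>. cmod (g \<zeta>) * ?S"])
    have [measurable]: "(\<lambda>\<zeta>. u (of_real r * \<zeta>)) \<in> borel_measurable borel"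
      using u by (intro dilate_measurable) (simp add: taylor_def)
    show "(\<lambda>\<zeta>. g \<zeta> * u (of_real r * \<zeta>)) \<in> borel_measurable circle_measure" by measurable
    show "integrable circle_measure (\<lambda>\<zeta>. cmod (g \<zeta>) * ?S)" using gi by auto
    show "AE \<zeta> in circle_measure. (\<lambda>N. g \<zeta> * (\<Sum>n<N. d n * (of_real r * \<zeta>) ^ n)) \<longlonglongrightarrow> g \<zeta> * u (of_real r * \<zeta>)"
      using AE_circle_norm
    proof eventually_elim
      case (elim \<zeta>)
      then have "(\<lambda>n. d n * (of_real r * \<zeta>) ^ n) sums u (of_real r * \<zeta>)"
        using u r dilate_norm_less[of r \<zeta>] by (auto simp: taylor_def)
      then show ?case unfolding sums_def by (intro tendsto_intros)
    qed
    show "AE \<zeta> in circle_measure. norm (g \<zeta> * (\<Sum>n<N. d n * (of_real r * \<zeta>) ^ n)) \<le> cmod (g \<zeta>) * ?S" for N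
      using AE_circle_norm
    proof eventually_elim
      case (elim \<zeta>)
      have "cmod (\<Sum>n<N. d n * (of_real r * \<zeta>) ^ n) \<le> (\<Sum>n<N. cmod (d n) * r ^ n)"
        by (rule order_trans[OF norm_sum]) (simp add: norm_mult norm_power elim r)
      also have "\<dots> \<le> ?S" by (rule sum_le_suminf[OF sm]) (use r in auto)
      finally show ?case by (simp add: norm_mult mult_left_mono)
    qed
  qed measurable
  then show ?thesis unfolding sums_def S .
qed

lemma L2_inner_diff_left:
  assumes "f \<in> L2" "g \<in> L2" "h \<in> L2"
  shows "L2_inner (\<lambda>\<zeta>. f \<zeta> - g \<zeta>) h = L2_inner f h - L2_inner g h"
  using L2_mult_integrable[OF assms(1) L2_cnj[OF assms(3)]] L2_mult_integrable[OF assms(2) L2_cnj[OF assms(3)]]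
  by (simp add: L2_inner_def left_diff_distrib)

text \<open>The squared distance from \<phi> to its partial Fourier sum is nonnegative, and both the
  mixed term and the norm of the sum equal the sum of squared coefficients.\<close>

lemma bessel_circle:
  assumes \<phi>: "\<phi> \<in> L2"
  defines "c \<equiv> \<lambda>n. \<integral>\<zeta>. \<phi> \<zeta> * cnj (\<zeta> ^ n) \<partial>circle_measure"
  shows "summable (\<lambda>n. (cmod (c n))\<^sup>2)"
proof (rule bounded_imp_summable)
  fix n
  let ?S = "\<lambda>\<zeta>. \<Sum>k<Suc n. c k * \<zeta> ^ k"
  have ms: "(\<lambda>\<zeta>. c k * \<zeta> ^ k) \<in> L2" for k
    by (rule L2_bounded_mult[of "\<lambda>_. c k" "cmod (c k)"]) (auto intro: power_L2)
  have S: "?S \<in> L2"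
  proof -
    have "(\<lambda>\<zeta>. \<Sum>k<m. c k * \<zeta> ^ k) \<in> L2" for m
    proof (induction m)
      case (Suc m)
      show ?case using L2_add[OF Suc ms] by simp
    qed (simp add: L2_def)
    then show ?thesis .
  qed
  have "(\<integral>\<zeta>. \<phi> \<zeta> * cnj (?S \<zeta>) \<partial>circle_measure) = (\<integral>\<zeta>. (\<Sum>k<Suc n. cnj (c k) * (\<phi> \<zeta> * cnj (\<zeta> ^ k))) \<partial>circle_measure)"
    by (simp add: sum_distrib_left mult_ac algebra_simps)
  also have "\<dots> = (\<Sum>k<Suc n. cnj (c k) * c k)"
    unfolding c_def by (subst Bochner_Integration.integral_sum) (auto intro!: integrable_mult_right L2_mult_integrable L2_cnj \<phi> power_L2 simp del: sum.lessThan_Suc complex_cnj_power)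
  also have "\<dots> = of_real (\<Sum>k<Suc n. (cmod (c k))\<^sup>2)"
    by (simp only: of_real_sum complex_norm_square mult.commute)
  finally have e: "(\<integral>\<zeta>. Re (\<phi> \<zeta> * cnj (?S \<zeta>)) \<partial>circle_measure) = (\<Sum>k<Suc n. (cmod (c k))\<^sup>2)"
    using Bochner_Integration.integral_Re[OF L2_mult_integrable[OF \<phi> L2_cnj[OF S]]] by (simp only: Re_complex_of_real)
  have "0 \<le> L2_sq (\<lambda>\<zeta>. \<phi> \<zeta> - ?S \<zeta>)" by simp
  also have "\<dots> = L2_sq \<phi> + L2_sq ?S - 2 * (\<Sum>k<Suc n. (cmod (c k))\<^sup>2)"
    by (simp only: L2_sq_diff[OF \<phi> S] e)
  also have "L2_sq ?S = (\<Sum>k<Suc n. (cmod (c k))\<^sup>2)" unfolding L2_sq_def by (rule parseval_sum)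
  finally show "(\<Sum>k\<le>n. (cmod (c k))\<^sup>2) \<le> L2_sq \<phi>" by (simp add: lessThan_Suc_atMost)
qed simp

text \<open>Riesz-Fischer: h has as Taylor coefficients the Fourier coefficients of \<phi> with
  index n \<ge> 0. They are square summable by Bessel, so h lies in \<open>H2\<close>.\<close>

lemma P_plus_exists:
  assumes \<phi>: "\<phi> \<in> L2"
  shows "\<exists>h\<in>H2. \<forall>u\<in>H2. L2_inner (\<lambda>\<zeta>. \<phi> \<zeta> - bdry h \<zeta>) (bdry u) = 0"
proof -
  define c where "c n = (\<integral>\<zeta>. \<phi> \<zeta> * cnj (\<zeta> ^ n) \<partial>circle_measure)" for n
  have cs: "summable (\<lambda>n. (cmod (c n))\<^sup>2)" unfolding c_def by (rule bessel_circle[OF \<phi>])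
  have "bounded (range c)"
  proof -
    have "(\<lambda>n. (cmod (c n))\<^sup>2) \<longlonglongrightarrow> 0" by (rule summable_LIMSEQ_zero[OF cs])
    then have "(\<lambda>n. sqrt ((cmod (c n))\<^sup>2)) \<longlonglongrightarrow> sqrt 0" by (rule tendsto_real_sqrt)
    then have "c \<longlonglongrightarrow> 0" by (simp add: tendsto_norm_zero_iff)
    then show ?thesis by (intro convergent_imp_bounded convergentI)
  qed
  then obtain h where h: "taylor h c" using taylor_of_bounded by blast
  have hH: "h \<in> H2" using taylor_H2_iff[OF h] cs by blast
  define D where "D \<zeta> = \<phi> \<zeta> - bdry h \<zeta>" for \<zeta>
  have D: "D \<in> L2" unfolding D_def by (intro L2_diff \<phi> bdry_L2 hH)
  \<comment> \<open>The dilate of radius r has Fourier coefficient \<open>c n * r ^ n\<close>; mean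
    square convergence lets r tend to 1.\<close>
  have hc: "(\<integral>\<zeta>. bdry h \<zeta> * cnj (\<zeta> ^ n) \<partial>circle_measure) = c n" for n
  proof -
    have lim: "((\<lambda>r. \<integral>\<zeta>. h (of_real r * \<zeta>) * cnj (\<zeta> ^ n) \<partial>circle_measure) \<longlongrightarrow> (\<integral>\<zeta>. bdry h \<zeta> * cnj (\<zeta> ^ n) \<partial>circle_measure)) (at_left 1)"
      by (intro H2_tendsto_integral hH L2_cnj power_L2)
    have eq: "(\<integral>\<zeta>. h (of_real r * \<zeta>) * cnj (\<zeta> ^ n) \<partial>circle_measure) = c n * of_real r ^ n" if r: "0 \<le> r" "r < 1" for r
    proof -
      have "(\<lambda>k. c k * of_real r ^ k * (\<integral>\<zeta>. cnj (\<zeta> ^ n) * \<zeta> ^ k \<partial>circle_measure)) sums (\<integral>\<zeta>. cnj (\<zeta> ^ n) * h (of_real r * \<zeta>) \<partial>circle_measure)"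
        by (intro taylor_dilate_integral h L2_cnj power_L2 r)
      moreover have mom: "(\<integral>\<zeta>. cnj (\<zeta> ^ n) * \<zeta> ^ k \<partial>circle_measure) = (if k = n then 1 else 0)" for k
        unfolding circle_moments[of k n, symmetric] by (simp only: mult.commute)
      ultimately have "(\<lambda>k. c k * of_real r ^ k * (if k = n then 1 else 0)) sums (\<integral>\<zeta>. cnj (\<zeta> ^ n) * h (of_real r * \<zeta>) \<partial>circle_measure)"
        by (simp only: mom)
      then have "(\<lambda>k. if k = n then c k * of_real r ^ k else 0) sums (\<integral>\<zeta>. cnj (\<zeta> ^ n) * h (of_real r * \<zeta>) \<partial>circle_measure)"
        by (rule sums_cong[THEN iffD1, rotated]) auto
      then have "(\<integral>\<zeta>. cnj (\<zeta> ^ n) * h (of_real r * \<zeta>) \<partial>circle_measure) = c n * of_real r ^ n"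
        using sums_single[of n "\<lambda>k. c k * of_real r ^ k"] sums_unique2 by blast
      then show ?thesis by (simp add: mult.commute)
    qed
    have "((\<lambda>r. c n * of_real r ^ n) \<longlongrightarrow> c n * of_real 1 ^ n) (at_left 1)" by (intro tendsto_intros)
    then have "((\<lambda>r. c n * of_real r ^ n) \<longlongrightarrow> c n) (at_left 1)" by simp
    then have "((\<lambda>r. \<integral>\<zeta>. h (of_real r * \<zeta>) * cnj (\<zeta> ^ n) \<partial>circle_measure) \<longlongrightarrow> c n) (at_left 1)"
    proof (rule Lim_transform_eventually)
      show "\<forall>\<^sub>F r in at_left 1. c n * of_real r ^ n = (\<integral>\<zeta>. h (of_real r * \<zeta>) * cnj (\<zeta> ^ n) \<partial>circle_measure)"
        using at_left_1_radius by eventually_elim (subst eq, auto)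
    qed
    from tendsto_unique[OF _ lim this] show ?thesis by simp
  qed
  \<comment> \<open>Orthogonality to monomials gives orthogonality to every dilate by its Taylor
    series, and to the boundary function in the limit.\<close>
  have D0: "(\<integral>\<zeta>. cnj (D \<zeta>) * \<zeta> ^ n \<partial>circle_measure) = 0" for n
  proof -
    have "(\<integral>\<zeta>. D \<zeta> * cnj (\<zeta> ^ n) \<partial>circle_measure)
      = (\<integral>\<zeta>. \<phi> \<zeta> * cnj (\<zeta> ^ n) \<partial>circle_measure) - (\<integral>\<zeta>. bdry h \<zeta> * cnj (\<zeta> ^ n) \<partial>circle_measure)"
      unfolding D_def left_diff_distrib
      by (intro Bochner_Integration.integral_diff L2_mult_integrable \<phi> bdry_L2 hH L2_cnj power_L2)
    also have "\<dots> = 0" unfolding hc by (simp only: c_def diff_self)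
    finally have "cnj (\<integral>\<zeta>. D \<zeta> * cnj (\<zeta> ^ n) \<partial>circle_measure) = 0" by simp
    then show ?thesis by (subst (asm) Bochner_Integration.integral_cnj [symmetric]) simp
  qed
  have "L2_inner D (bdry u) = 0" if u: "u \<in> H2" for u
  proof -
    obtain d where d: "taylor u d" using disk_analytic_taylor H2_disk_analytic u by blast
    have z: "(\<integral>\<zeta>. u (of_real r * \<zeta>) * cnj (D \<zeta>) \<partial>circle_measure) = 0" if r: "0 \<le> r" "r < 1" for r
    proof -
      have "(\<lambda>n. 0) sums (\<integral>\<zeta>. cnj (D \<zeta>) * u (of_real r * \<zeta>) \<partial>circle_measure)"
        using taylor_dilate_integral[OF d L2_cnj[OF D] r] by (simp add: D0)
      then have "(\<integral>\<zeta>. cnj (D \<zeta>) * u (of_real r * \<zeta>) \<partial>circle_measure) = 0"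
        using sums_unique2[OF _ sums_zero] by blast
      then show ?thesis by (simp add: mult.commute)
    qed
    have lim: "((\<lambda>r. \<integral>\<zeta>. u (of_real r * \<zeta>) * cnj (D \<zeta>) \<partial>circle_measure) \<longlongrightarrow> (\<integral>\<zeta>. bdry u \<zeta> * cnj (D \<zeta>) \<partial>circle_measure)) (at_left 1)"
      by (intro H2_tendsto_integral u L2_cnj D)
    have "((\<lambda>r. \<integral>\<zeta>. u (of_real r * \<zeta>) * cnj (D \<zeta>) \<partial>circle_measure) \<longlongrightarrow> 0) (at_left 1)"
      by (rule tendsto_eventually) (use at_left_1_radius in \<open>auto elim!: eventually_mono simp: z\<close>)
    then have "(\<integral>\<zeta>. bdry u \<zeta> * cnj (D \<zeta>) \<partial>circle_measure) = 0" using tendsto_unique[OF _ lim] by simp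
    then have "cnj (\<integral>\<zeta>. bdry u \<zeta> * cnj (D \<zeta>) \<partial>circle_measure) = 0" by simp
    then show ?thesis
      unfolding L2_inner_def by (subst (asm) Bochner_Integration.integral_cnj [symmetric]) (simp add: mult.commute)
  qed
  then show ?thesis using hH unfolding D_def by blast
qed

text \<open>Szego kernels lie in \<open>H2\<close>, so pairing with them does not distinguish \<phi>
  from its projection. This yields uniqueness of the projection (l = 0) and an integral formula for
  derivatives of Toeplitz images.\<close>

lemma projection_deriv:
  assumes \<phi>: "\<phi> \<in> L2" and h: "h \<in> H2" and o: "\<forall>u\<in>H2. L2_inner (\<lambda>\<zeta>. \<phi> \<zeta> - bdry h \<zeta>) (bdry u) = 0"
    and z: "cmod z < 1"
  shows "(deriv ^^ l) h z = L2_inner \<phi> (bdry (szego_deriv z l))"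
proof -
  have k: "szego_deriv z l \<in> H2" by (intro Hinf_subset_H2 szego_deriv_Hinf z)
  have "L2_inner (\<lambda>\<zeta>. \<phi> \<zeta> - bdry h \<zeta>) (bdry (szego_deriv z l)) = 0" using o k by blast
  then show ?thesis
    using H2_reproducing[OF h z, of l] L2_inner_diff_left[OF \<phi> bdry_L2[OF h] bdry_L2[OF k]] by simp
qed

lemma disk_analytic_eqI:
  assumes "disk_analytic f" "disk_analytic g" "\<And>z. cmod z < 1 \<Longrightarrow> f z = g z"
  shows "f = g"
proof
  fix z show "f z = g z"
    using assms by (cases "cmod z < 1") (auto simp: disk_analytic_def)
qed

lemma P_plus_eqI:
  assumes \<phi>: "\<phi> \<in> L2" and h: "h \<in> H2" "\<forall>u\<in>H2. L2_inner (\<lambda>\<zeta>. \<phi> \<zeta> - bdry h \<zeta>) (bdry u) = 0"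
  shows "P_plus \<phi> = h"
  unfolding P_plus_def
proof (rule the_equality)
  fix k assume k: "k \<in> H2 \<and> (\<forall>u\<in>H2. L2_inner (\<lambda>\<zeta>. \<phi> \<zeta> - bdry k \<zeta>) (bdry u) = 0)"
  show "k = h"
  proof (rule disk_analytic_eqI)
    fix z :: complex assume z: "cmod z < 1"
    then show "k z = h z"
      using projection_deriv[OF \<phi> h z, of 0] projection_deriv[OF \<phi> _ _ z, of k 0] k by simp
  qed (use k h H2_disk_analytic in auto)
qed (use h in blast)

lemma P_plus_projection:
  assumes \<phi>: "\<phi> \<in> L2"
  shows "P_plus \<phi> \<in> H2" "\<And>u. u \<in> H2 \<Longrightarrow> L2_inner (\<lambda>\<zeta>. \<phi> \<zeta> - bdry (P_plus \<phi>) \<zeta>) (bdry u) = 0"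
proof -
  obtain h where h: "h \<in> H2" "\<forall>u\<in>H2. L2_inner (\<lambda>\<zeta>. \<phi> \<zeta> - bdry h \<zeta>) (bdry u) = 0"
    using P_plus_exists[OF \<phi>] by blast
  then have "P_plus \<phi> = h" by (rule P_plus_eqI[OF \<phi>])
  then show "P_plus \<phi> \<in> H2" "\<And>u. u \<in> H2 \<Longrightarrow> L2_inner (\<lambda>\<zeta>. \<phi> \<zeta> - bdry (P_plus \<phi>) \<zeta>) (bdry u) = 0"
    using h by auto
qed

subsection \<open>Outer functions\<close>

text \<open>The exponent in \<open>outer_fun\<close>; its real part is the Poisson integral of
  m.\<close>

definition herglotz :: "(complex \<Rightarrow> real) \<Rightarrow> complex \<Rightarrow> complex" where
  "herglotz m z = (\<integral>\<zeta>. (\<zeta> + z) / (\<zeta> - z) * of_real (m \<zeta>) \<partial>circle_measure)"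

lemma herglotz_kernel_bound:
  assumes "cmod z < 1" "cmod \<zeta> = 1"
  shows "cmod ((\<zeta> + z) / (\<zeta> - z)) \<le> 2 / (1 - cmod z)"
  unfolding norm_divide
proof (rule frac_le)
  show "cmod (\<zeta> + z) \<le> 2" using norm_triangle_ineq[of \<zeta> z] assms by simp
  show "1 - cmod z \<le> cmod (\<zeta> - z)" using norm_triangle_ineq2[of \<zeta> z] assms by simp
qed (use assms in auto)

lemma herglotz_integrable:
  assumes z: "cmod z < 1" and m: "integrable circle_measure m"
  shows "integrable circle_measure (\<lambda>\<zeta>. (\<zeta> + z) / (\<zeta> - z) * of_real (m \<zeta>))"
proof (rule Bochner_Integration.integrable_bound)
  show "integrable circle_measure (\<lambda>\<zeta>. 2 / (1 - cmod z) * m \<zeta>)" using m by (rule integrable_mult_right)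
  have [measurable]: "m \<in> borel_measurable circle_measure" using m by auto
  show "(\<lambda>\<zeta>. (\<zeta> + z) / (\<zeta> - z) * of_real (m \<zeta>)) \<in> borel_measurable circle_measure" by measurable
  show "AE \<zeta> in circle_measure. norm ((\<zeta> + z) / (\<zeta> - z) * of_real (m \<zeta>)) \<le> norm (2 / (1 - cmod z) * m \<zeta>)"
    using AE_circle_norm
  proof eventually_elim
    case (elim \<zeta>)
    have "cmod ((\<zeta> + z) / (\<zeta> - z)) * \<bar>m \<zeta>\<bar> \<le> 2 / (1 - cmod z) * \<bar>m \<zeta>\<bar>"
      by (rule mult_right_mono[OF herglotz_kernel_bound[OF z elim]]) simp
    moreover have "norm (2 / (1 - cmod z) * m \<zeta>) = 2 / (1 - cmod z) * \<bar>m \<zeta>\<bar>"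
      using z by (simp add: abs_mult)
    ultimately show ?case by (simp only: norm_mult norm_of_real)
  qed
qed

lemma herglotz_add:
  assumes "cmod z < 1" "integrable circle_measure m" "integrable circle_measure m'"
  shows "herglotz (\<lambda>\<zeta>. m \<zeta> + m' \<zeta>) z = herglotz m z + herglotz m' z"
  using herglotz_integrable[OF assms(1,2)] herglotz_integrable[OF assms(1,3)]
  by (simp add: herglotz_def distrib_left)

lemma Re_herglotz:
  assumes z: "cmod z < 1" and m: "integrable circle_measure m"
  shows "integrable circle_measure (\<lambda>\<zeta>. poisson z \<zeta> * m \<zeta>)"
    and "Re (herglotz m z) = (\<integral>\<zeta>. poisson z \<zeta> * m \<zeta> \<partial>circle_measure)"
proof -
  have [measurable]: "m \<in> borel_measurable circle_measure" using m by auto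
  have ae: "AE \<zeta> in circle_measure. Re ((\<zeta> + z) / (\<zeta> - z) * of_real (m \<zeta>)) = poisson z \<zeta> * m \<zeta>"
    using AE_circle_norm
  proof eventually_elim
    case (elim \<zeta>)
    \<comment> \<open>The second bracket is a number minus its conjugate, hence purely
      imaginary.\<close>
    have "(\<zeta> + z) * cnj (\<zeta> - z) = (\<zeta> * cnj \<zeta> - z * cnj z) + (z * cnj \<zeta> - cnj (z * cnj \<zeta>))"
      by (simp add: algebra_simps)
    then have "Re ((\<zeta> + z) * cnj (\<zeta> - z)) = Re (\<zeta> * cnj \<zeta>) - Re (z * cnj z)"
      by (simp only: minus_complex.sel plus_complex.sel) simp
    also have "\<dots> = 1 - (cmod z)\<^sup>2"
      using elim unfolding complex_norm_square [symmetric] by simp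
    finally have "Re ((\<zeta> + z) / (\<zeta> - z)) = poisson z \<zeta>"
      by (simp add: poisson_def Re_complex_div_gt_0 complex_div_cnj[of "\<zeta> + z"] Re_divide_of_real flip: of_real_power)
    moreover have "Re (x * of_real t) = Re x * t" for x t by simp
    ultimately show ?case by (simp only:)
  qed
  have "integrable circle_measure (\<lambda>\<zeta>. Re ((\<zeta> + z) / (\<zeta> - z) * of_real (m \<zeta>)))"
    by (intro integrable_Re herglotz_integrable z m)
  then show "integrable circle_measure (\<lambda>\<zeta>. poisson z \<zeta> * m \<zeta>)"
    by (rule integrable_cong_AE_imp) (use ae in \<open>auto elim!: eventually_mono\<close>)
  have "Re (herglotz m z) = (\<integral>\<zeta>. Re ((\<zeta> + z) / (\<zeta> - z) * of_real (m \<zeta>)) \<partial>circle_measure)"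
    unfolding herglotz_def by (rule Bochner_Integration.integral_Re [symmetric]) (intro herglotz_integrable z m)
  also have "\<dots> = (\<integral>\<zeta>. poisson z \<zeta> * m \<zeta> \<partial>circle_measure)"
    by (rule integral_cong_AE) (use ae in auto)
  finally show "Re (herglotz m z) = (\<integral>\<zeta>. poisson z \<zeta> * m \<zeta> \<partial>circle_measure)" .
qed

lemma Re_herglotz_le:
  assumes z: "cmod z < 1" and m: "integrable circle_measure m" and b: "\<And>\<zeta>. m \<zeta> \<le> B"
  shows "Re (herglotz m z) \<le> B"
proof -
  have "Re (herglotz m z) \<le> (\<integral>\<zeta>. poisson z \<zeta> * B \<partial>circle_measure)"
    unfolding Re_herglotz(2)[OF z m] using z b
    by (intro integral_mono Re_herglotz(1)[OF z m] integrable_mult_left poisson_integrable mult_left_mono poisson_nonneg) auto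
  also have "\<dots> = B" using integral_poisson[OF z] by simp
  finally show ?thesis .
qed

text \<open>On the circle the kernel equals (1 + x) / (1 - x) with x = z cnj \<zeta>, whose
  expansion has coefficients 1, 2, 2, ...; integrating term by term gives a power series in
  z.\<close>

lemma herglotz_holomorphic:
  assumes m: "integrable circle_measure m"
  shows "herglotz m holomorphic_on ball 0 1"
proof (rule power_series_holomorphic)
  have [measurable]: "m \<in> borel_measurable circle_measure" using m by auto
  define w :: "nat \<Rightarrow> complex" where "w k = (if k = 0 then 1 else 2)" for k
  define c where "c k = w k * (\<integral>\<zeta>. cnj \<zeta> ^ k * of_real (m \<zeta>) \<partial>circle_measure)" for k
  fix z :: complex assume "z \<in> ball 0 1"
  then have z: "cmod z < 1" by simp
  have int: "integrable circle_measure (\<lambda>\<zeta>. cnj \<zeta> ^ k * of_real (m \<zeta>))" for k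
  proof (rule Bochner_Integration.integrable_bound[OF m])
    show "AE \<zeta> in circle_measure. norm (cnj \<zeta> ^ k * of_real (m \<zeta>)) \<le> norm (m \<zeta>)"
      using AE_circle_norm by eventually_elim (simp add: norm_mult norm_power)
  qed measurable
  have S: "(\<Sum>k<N. c k * z ^ k) = (\<integral>\<zeta>. (\<Sum>k<N. w k * (z * cnj \<zeta>) ^ k) * of_real (m \<zeta>) \<partial>circle_measure)" for N
  proof -
    have "(\<integral>\<zeta>. (\<Sum>k<N. w k * (z * cnj \<zeta>) ^ k) * of_real (m \<zeta>) \<partial>circle_measure)
      = (\<integral>\<zeta>. (\<Sum>k<N. w k * z ^ k * (cnj \<zeta> ^ k * of_real (m \<zeta>))) \<partial>circle_measure)"
      by (simp add: sum_distrib_right sum_distrib_left power_mult_distrib mult_ac)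
    also have "\<dots> = (\<Sum>k<N. w k * z ^ k * (\<integral>\<zeta>. cnj \<zeta> ^ k * of_real (m \<zeta>) \<partial>circle_measure))"
      by (subst Bochner_Integration.integral_sum) (auto intro!: integrable_mult_right int)
    finally show ?thesis by (simp add: c_def mult_ac)
  qed
  have geo: "(\<lambda>k. w k * x ^ k) sums ((1 + x) / (1 - x))" if x: "cmod x < 1" for x
  proof -
    have "(\<lambda>k. 2 * x ^ k - (if k = 0 then 1 else 0)) sums (2 * (1 / (1 - x)) - 1)"
      using sums_single[of 0 "\<lambda>_. 1::complex"] by (intro sums_diff sums_mult geometric_sums x) auto
    moreover have "2 * (1 / (1 - x)) - 1 = (1 + x) / (1 - x)"
    proof -
      have "1 - x \<noteq> 0" using x by auto
      then show ?thesis by (simp add: field_simps)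
    qed
    ultimately have "(\<lambda>k. 2 * x ^ k - (if k = 0 then 1 else 0)) sums ((1 + x) / (1 - x))" by simp
    then show ?thesis by (rule sums_cong[THEN iffD1, rotated]) (auto simp: w_def)
  qed
  show "(\<lambda>k. c k * (z - 0) ^ k) sums herglotz m z"
    unfolding sums_def diff_zero S herglotz_def
  proof (rule integral_dominated_convergence[where w="\<lambda>\<zeta>. 2 / (1 - cmod z) * \<bar>m \<zeta>\<bar>"])
    show "integrable circle_measure (\<lambda>\<zeta>. 2 / (1 - cmod z) * \<bar>m \<zeta>\<bar>)" using m by auto
    show "AE \<zeta> in circle_measure. (\<lambda>N. (\<Sum>k<N. w k * (z * cnj \<zeta>) ^ k) * of_real (m \<zeta>)) \<longlonglongrightarrow> (\<zeta> + z) / (\<zeta> - z) * of_real (m \<zeta>)"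
      using AE_circle_norm
    proof eventually_elim
      case (elim \<zeta>)
      have "\<zeta> * cnj \<zeta> = 1" using elim by (rule unimodular_mult_cnj)
      then have "\<zeta> * (1 + z * cnj \<zeta>) = \<zeta> + z" "\<zeta> * (1 - z * cnj \<zeta>) = \<zeta> - z"
        by (simp_all add: algebra_simps)
      moreover have "\<zeta> \<noteq> 0" using elim by auto
      ultimately have "(\<zeta> + z) / (\<zeta> - z) = (1 + z * cnj \<zeta>) / (1 - z * cnj \<zeta>)"
        by (metis mult_divide_mult_cancel_left)
      moreover have "cmod (z * cnj \<zeta>) < 1" using z elim by (simp add: norm_mult)
      ultimately show ?case using geo[of "z * cnj \<zeta>"] unfolding sums_def by (intro tendsto_mult tendsto_const) auto
    qed
    show "AE \<zeta> in circle_measure. norm ((\<Sum>k<N. w k * (z * cnj \<zeta>) ^ k) * of_real (m \<zeta>)) \<le> 2 / (1 - cmod z) * \<bar>m \<zeta>\<bar>" for N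
      using AE_circle_norm
    proof eventually_elim
      case (elim \<zeta>)
      have "cmod (\<Sum>k<N. w k * (z * cnj \<zeta>) ^ k) \<le> (\<Sum>k<N. 2 * cmod z ^ k)"
        by (rule order_trans[OF norm_sum]) (intro sum_mono, auto simp: norm_mult norm_power elim w_def)
      also have "\<dots> \<le> (\<Sum>k. 2 * cmod z ^ k)"
        using z by (intro sum_le_suminf summable_mult summable_geometric) auto
      also have "\<dots> = 2 / (1 - cmod z)"
        using sums_mult[OF geometric_sums[of "cmod z"], of 2] z by (simp add: sums_iff)
      finally show ?case by (simp only: norm_mult norm_of_real) (rule mult_right_mono, auto)
    qed
  qed measurable
qed

text \<open>\<open>m n\<close> and \<open>M n\<close> are the logarithms of the boundary moduli of
  \<open>b n\<close> and \<open>a * b n\<close>. Since \<open>M n\<close> is at most 0, the product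
  is bounded by 1; since \<open>M n\<close> is dominated by |L| and vanishes at each point from some
  n on, its mean, which is the exponent at the origin, tends to 0.\<close>

lemma outer_approximants:
  assumes o: "outer_fun a"
  shows "\<exists>b. (\<forall>n::nat. b n \<in> Hinf \<and> (\<forall>z. cmod (a z * b n z) \<le> 1)) \<and> (\<lambda>n. a 0 * b n 0) \<longlonglongrightarrow> 1"
proof -
  define L where "L \<zeta> = ln (cmod (bdry a \<zeta>))" for \<zeta>
  have da: "disk_analytic a" and Li: "integrable circle_measure L" using o by (auto simp: outer_fun_def L_def[abs_def])
  obtain \<alpha> where \<alpha>: "cmod \<alpha> = 1" "\<And>z. cmod z < 1 \<Longrightarrow> a z = \<alpha> * exp (herglotz L z)"
    using o unfolding outer_fun_def L_def[abs_def] herglotz_def by auto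
  have [measurable]: "L \<in> borel_measurable circle_measure" using Li by auto
  define m where "m n \<zeta> = min (ln (real (Suc n))) (- L \<zeta>)" for n \<zeta>
  define M where "M n \<zeta> = min (ln (real (Suc n)) + L \<zeta>) 0" for n \<zeta>
  have ln0: "0 \<le> ln (real (Suc n))" for n by simp
  have Mb: "\<bar>M n \<zeta>\<bar> \<le> \<bar>L \<zeta>\<bar>" for n \<zeta> using ln0[of n] unfolding M_def by linarith
  have [measurable]: "M n \<in> borel_measurable circle_measure" "m n \<in> borel_measurable circle_measure" for n
    unfolding M_def m_def by measurable
  have Mi: "integrable circle_measure (M n)" for n
    by (rule Bochner_Integration.integrable_bound[OF Li]) (use Mb in auto)
  have mM: "M n \<zeta> = L \<zeta> + m n \<zeta>" for n \<zeta> by (auto simp: m_def M_def min_def simp del: of_nat_Suc)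
  have mi: "integrable circle_measure (m n)" for n
    using Bochner_Integration.integrable_diff[OF Mi Li, of n] by (simp add: mM)
  \<comment> \<open>The factor cnj \<alpha> cancels the unimodular constant of a, so the product
    tends to 1 and not merely to a unimodular number.\<close>
  define b where "b n z = (if cmod z < 1 then cnj \<alpha> * exp (herglotz (m n) z) else 0)" for n z
  have bH: "b n \<in> Hinf" for n
  proof (rule HinfI)
    have "b n holomorphic_on ball 0 1"
      by (rule holomorphic_transform[of "\<lambda>z. cnj \<alpha> * exp (herglotz (m n) z)"])
         (auto simp: b_def intro!: holomorphic_intros herglotz_holomorphic mi)
    then show "disk_analytic (b n)" by (auto simp: disk_analytic_def b_def)
    fix z :: complex assume z: "cmod z < 1"
    have "Re (herglotz (m n) z) \<le> ln (real (Suc n))" by (rule Re_herglotz_le[OF z mi]) (simp add: m_def)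
    then show "cmod (b n z) \<le> exp (ln (real (Suc n)))" using z \<alpha> by (simp add: b_def norm_mult del: of_nat_Suc exp_ln)
  qed
  have ab: "a z * b n z = exp (herglotz (M n) z)" if z: "cmod z < 1" for n z
  proof -
    have "\<alpha> * cnj \<alpha> = 1" using \<alpha>(1) by (rule unimodular_mult_cnj)
    have "a z * b n z = (\<alpha> * cnj \<alpha>) * (exp (herglotz L z) * exp (herglotz (m n) z))"
      using z \<alpha>(2)[OF z] by (simp add: b_def mult_ac)
    also have "\<dots> = exp (herglotz L z + herglotz (m n) z)"
      using \<open>\<alpha> * cnj \<alpha> = 1\<close> by (simp add: exp_add)
    also have "herglotz L z + herglotz (m n) z = herglotz (M n) z"
      by (simp add: mM[abs_def] herglotz_add[OF z Li mi])
    finally show ?thesis .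
  qed
  have le1: "cmod (a z * b n z) \<le> 1" for n z
  proof (cases "cmod z < 1")
    case True
    have "Re (herglotz (M n) z) \<le> 0" by (rule Re_herglotz_le[OF True Mi]) (simp add: M_def)
    then show ?thesis unfolding ab[OF True] norm_exp_eq_Re by simp
  qed (simp add: b_def)
  have h0: "herglotz (M n) 0 = of_real (\<integral>\<zeta>. M n \<zeta> \<partial>circle_measure)" for n
  proof -
    have "herglotz (M n) 0 = (\<integral>\<zeta>. of_real (M n \<zeta>) \<partial>circle_measure)"
      unfolding herglotz_def
    proof (rule integral_cong_AE)
      show "AE \<zeta> in circle_measure. (\<zeta> + 0) / (\<zeta> - 0) * complex_of_real (M n \<zeta>) = of_real (M n \<zeta>)"
        using AE_circle_neq[of 0] by eventually_elim simp
    qed measurable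
    then show ?thesis by simp
  qed
  have "(\<lambda>n. \<integral>\<zeta>. M n \<zeta> \<partial>circle_measure) \<longlonglongrightarrow> (\<integral>\<zeta>. 0 \<partial>circle_measure)"
  proof (rule integral_dominated_convergence[where w="\<lambda>\<zeta>. \<bar>L \<zeta>\<bar>"])
    show "AE \<zeta> in circle_measure. (\<lambda>n. M n \<zeta>) \<longlonglongrightarrow> 0"
    proof (rule AE_I2, rule tendsto_eventually)
      fix \<zeta>
      have "filterlim (\<lambda>n. ln (real (Suc n))) at_top sequentially"
        by (rule filterlim_compose[OF ln_at_top]) (rule filterlim_compose[OF filterlim_real_sequentially filterlim_Suc])
      then have "\<forall>\<^sub>F n in sequentially. - L \<zeta> \<le> ln (real (Suc n))" by (simp add: filterlim_at_top del: of_nat_Suc)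
      then show "\<forall>\<^sub>F n in sequentially. M n \<zeta> = 0" by eventually_elim (simp add: M_def del: of_nat_Suc)
    qed
  qed (use Mb Li in auto)
  then have "(\<lambda>n. exp (complex_of_real (\<integral>\<zeta>. M n \<zeta> \<partial>circle_measure))) \<longlonglongrightarrow> exp (of_real 0)"
    by (intro tendsto_intros) simp
  then have "(\<lambda>n. a 0 * b n 0) \<longlonglongrightarrow> 1" by (simp add: ab h0)
  then show ?thesis using bH le1 by blast
qed

lemma bdry_mean: 
  assumes "f \<in> H2"
  shows "(\<integral>\<zeta>. bdry f \<zeta> \<partial>circle_measure) = f 0"
proof -
  have "f 0 = L2_inner (bdry f) (bdry (szego_deriv 0 0))" using H2_reproducing[OF assms, of 0 0] by simp
  also have "\<dots> = (\<integral>\<zeta>. bdry f \<zeta> \<partial>circle_measure)"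
    unfolding L2_inner_def
  proof (rule integral_cong_AE)
    note [measurable] = L2_measurable[OF bdry_L2[OF assms]] L2_measurable[OF bdry_L2[OF Hinf_subset_H2[OF szego_deriv_Hinf[of 0 0]]], simplified]
    show "(\<lambda>\<zeta>. bdry f \<zeta> * cnj (bdry (szego_deriv 0 0) \<zeta>)) \<in> borel_measurable circle_measure"
      by measurable
    show "bdry f \<in> borel_measurable circle_measure" by measurable
    show "AE \<zeta> in circle_measure. bdry f \<zeta> * cnj (bdry (szego_deriv 0 0) \<zeta>) = bdry f \<zeta>"
      using AE_circle_norm by eventually_elim (simp add: bdry_szego_deriv_inside)
  qed
  finally show ?thesis by simp
qed

text \<open>Testing with \<open>b n\<close> times the Szego kernel at w makes the mean of cnj (a
  b_n) cnj k g vanish. As a b_n tends to 1 in mean square, the limit is the value g w.\<close>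

lemma outer_cyclic:
  assumes a: "a \<in> Hinf" and o: "outer_fun a" and g: "g \<in> H2"
    and z: "\<And>u. u \<in> H2 \<Longrightarrow> (\<integral>\<zeta>. cnj (bdry a \<zeta>) * bdry g \<zeta> * cnj (bdry u \<zeta>) \<partial>circle_measure) = 0"
  shows "g = (\<lambda>_. 0)"
proof (rule disk_analytic_eqI)
  show "disk_analytic g" by (rule H2_disk_analytic[OF g])
  show "disk_analytic (\<lambda>_. 0)" by (simp add: disk_analytic_def)
  obtain b where b: "\<And>n::nat. b n \<in> Hinf" "\<And>n z. cmod (a z * b n z) \<le> 1" and lim0: "(\<lambda>n. a 0 * b n 0) \<longlonglongrightarrow> 1"
    using outer_approximants[OF o] by blast
  define \<phi> where "\<phi> n z = a z * b n z" for n z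
  have \<phi>: "\<phi> n \<in> H2" for n unfolding \<phi>_def by (intro Hinf_mult_H2 a Hinf_subset_H2 b)
  have \<phi>b: "AE \<zeta> in circle_measure. cmod (bdry (\<phi> n) \<zeta>) \<le> 1" for n
    by (rule bdry_Hinf_bound[OF \<phi>]) (simp add: \<phi>_def b)
  have one: "(\<lambda>_. 1) \<in> L2" "L2_sq (\<lambda>_. 1) = 1" by (auto simp: L2_def L2_sq_def)
  \<comment> \<open>Expanding the square leaves two terms at most 1 and a mixed term that is the
    mean of \<open>\<phi> n\<close>, its value at the origin; convergence at one point thus controls
    the whole norm.\<close>
  have sq: "L2_sq (\<lambda>\<zeta>. cnj (bdry (\<phi> n) \<zeta>) - 1) \<le> 2 - 2 * Re (\<phi> n 0)" for n
  proof -
    have "L2_sq (\<lambda>\<zeta>. cnj (bdry (\<phi> n) \<zeta>)) \<le> 1"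
      using L2_sq_bounded_mult[OF L2_measurable[OF bdry_L2[OF \<phi>]] \<phi>b one(1)] one(2) by simp
    moreover have "(\<integral>\<zeta>. Re (cnj (bdry (\<phi> n) \<zeta>) * cnj 1) \<partial>circle_measure) = Re (\<phi> n 0)"
    proof -
      have "integrable circle_measure (bdry (\<phi> n))" using L2_mult_integrable[OF bdry_L2[OF \<phi>] one(1)] by simp
      then show ?thesis using bdry_mean[OF \<phi>, of n] by (simp flip: bdry_mean)
    qed
    ultimately show ?thesis
      using L2_sq_diff[OF L2_cnj[OF bdry_L2[OF \<phi>[of n]]] one(1)] one(2) by simp
  qed
  have lim: "(\<lambda>n. L2_sq (\<lambda>\<zeta>. cnj (bdry (\<phi> n) \<zeta>) - 1)) \<longlonglongrightarrow> 0"
  proof (rule Lim_null_comparison)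
    show "\<forall>\<^sub>F n in sequentially. norm (L2_sq (\<lambda>\<zeta>. cnj (bdry (\<phi> n) \<zeta>) - 1)) \<le> 2 - 2 * Re (\<phi> n 0)"
      using sq by simp
    have "(\<lambda>n. 2 - 2 * Re (\<phi> n 0)) \<longlonglongrightarrow> 2 - 2 * Re 1" unfolding \<phi>_def by (intro tendsto_intros lim0)
    then show "(\<lambda>n. 2 - 2 * Re (\<phi> n 0)) \<longlonglongrightarrow> 0" by simp
  qed
  fix w :: complex assume w: "cmod w < 1"
  define k where "k = szego_deriv w 0"
  have k: "k \<in> Hinf" "k \<in> H2" unfolding k_def using szego_deriv_Hinf[OF w] Hinf_subset_H2 by auto
  obtain B where B: "\<And>z. cmod (k z) \<le> B" using Hinf_bound[OF k(1)] by blast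
  have G: "(\<lambda>\<zeta>. cnj (bdry k \<zeta>) * bdry g \<zeta>) \<in> L2"
    by (rule L2_bounded_mult[OF _ _ bdry_L2[OF g]])
       (use bdry_Hinf_bound[OF k(2) B] L2_measurable[OF L2_cnj[OF bdry_L2[OF k(2)]]] in auto)
  have "(\<lambda>n. \<integral>\<zeta>. cnj (bdry (\<phi> n) \<zeta>) * (cnj (bdry k \<zeta>) * bdry g \<zeta>) \<partial>circle_measure) \<longlonglongrightarrow> (\<integral>\<zeta>. 1 * (cnj (bdry k \<zeta>) * bdry g \<zeta>) \<partial>circle_measure)"
    by (rule L2_tendsto_integral[OF _ one(1) G lim]) (intro always_eventually allI L2_cnj bdry_L2 \<phi>)
  moreover have "(\<integral>\<zeta>. cnj (bdry (\<phi> n) \<zeta>) * (cnj (bdry k \<zeta>) * bdry g \<zeta>) \<partial>circle_measure) = 0" for n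
  proof -
    have bk: "(\<lambda>z. b n z * k z) \<in> H2" by (intro Hinf_mult_H2 b k)
    note [measurable] = L2_measurable[OF bdry_L2[OF \<phi>]] L2_measurable[OF bdry_L2[OF g]] L2_measurable[OF bdry_L2[OF k(2)]]
      L2_measurable[OF bdry_L2[OF bk]] L2_measurable[OF bdry_L2[OF Hinf_subset_H2[OF a]]]
    have "(\<integral>\<zeta>. cnj (bdry (\<phi> n) \<zeta>) * (cnj (bdry k \<zeta>) * bdry g \<zeta>) \<partial>circle_measure)
      = (\<integral>\<zeta>. cnj (bdry a \<zeta>) * bdry g \<zeta> * cnj (bdry (\<lambda>z. b n z * k z) \<zeta>) \<partial>circle_measure)"
    proof (rule integral_cong_AE)
      show "AE \<zeta> in circle_measure. cnj (bdry (\<phi> n) \<zeta>) * (cnj (bdry k \<zeta>) * bdry g \<zeta>)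
        = cnj (bdry a \<zeta>) * bdry g \<zeta> * cnj (bdry (\<lambda>z. b n z * k z) \<zeta>)"
        using bdry_mult[OF Hinf_subset_H2[OF a] Hinf_subset_H2[OF b(1)[of n]]] bdry_mult[OF Hinf_subset_H2[OF b(1)[of n]] k(2)]
        by eventually_elim (simp add: \<phi>_def[abs_def] mult_ac)
    qed measurable
    also have "\<dots> = 0" by (rule z[OF bk])
    finally show ?thesis .
  qed
  ultimately have "(\<integral>\<zeta>. cnj (bdry k \<zeta>) * bdry g \<zeta> \<partial>circle_measure) = 0"
    by (simp add: LIMSEQ_const_iff)
  then show "g w = 0"
    using H2_reproducing[OF g w, of 0] by (simp add: L2_inner_def k_def mult.commute)
qed

section \<open>The Toeplitz operator with conjugate symbol\<close>

lemma conj_symbol_mult_L2: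
  assumes a: "a \<in> Hinf" and g: "g \<in> L2"
  shows "(\<lambda>\<zeta>. conj_symbol a \<zeta> * g \<zeta>) \<in> L2"
proof -
  obtain B where B: "\<And>z. cmod (a z) \<le> B" using Hinf_bound[OF a] by blast
  show ?thesis
    unfolding conj_symbol_def
    by (rule L2_bounded_mult[OF _ _ g])
       (use bdry_Hinf_bound[OF Hinf_subset_H2[OF a] B] L2_measurable[OF L2_cnj[OF bdry_L2[OF Hinf_subset_H2[OF a]]]] in auto)
qed

lemma toeplitz_conj_H2: "a \<in> Hinf \<Longrightarrow> g \<in> H2 \<Longrightarrow> toeplitz (conj_symbol a) g \<in> H2"
  unfolding toeplitz_def by (intro P_plus_projection conj_symbol_mult_L2 bdry_L2)

text \<open>Equal projections mean that cnj a (g - h) is orthogonal to \<open>H2\<close>, which is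
  the hypothesis of \<open>outer_cyclic\<close>. Working with inner products avoids a separate proof
  that \<open>toeplitz\<close> is linear.\<close>

lemma toeplitz_conj_inj:
  assumes a: "a \<in> Hinf" and o: "outer_fun a"
  shows "inj_on (toeplitz (conj_symbol a)) H2"
proof (rule inj_onI)
  fix g h assume g: "g \<in> H2" and h: "h \<in> H2" and eq: "toeplitz (conj_symbol a) g = toeplitz (conj_symbol a) h"
  have gh: "(\<lambda>z. g z - h z) \<in> H2" by (rule H2_diff[OF g h])
  have L: "(\<lambda>\<zeta>. conj_symbol a \<zeta> * bdry f \<zeta>) \<in> L2" if "f \<in> H2" for f
    by (intro conj_symbol_mult_L2 a bdry_L2 that)
  have "(\<lambda>z. g z - h z) = (\<lambda>_. 0)"
  proof (rule outer_cyclic[OF a o gh])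
    fix u assume u: "u \<in> H2"
    let ?T = "toeplitz (conj_symbol a) g"
    have T: "?T \<in> H2" by (rule toeplitz_conj_H2[OF a g])
    have "L2_inner (\<lambda>\<zeta>. conj_symbol a \<zeta> * bdry g \<zeta>) (bdry u) = L2_inner (bdry ?T) (bdry u)"
      using P_plus_projection(2)[OF L[OF g] u] L2_inner_diff_left[OF L[OF g] bdry_L2[OF T] bdry_L2[OF u]]
      by (simp add: toeplitz_def)
    moreover have "L2_inner (\<lambda>\<zeta>. conj_symbol a \<zeta> * bdry h \<zeta>) (bdry u) = L2_inner (bdry ?T) (bdry u)"
      using P_plus_projection(2)[OF L[OF h] u] L2_inner_diff_left[OF L[OF h] bdry_L2[OF T] bdry_L2[OF u]]
      unfolding eq by (simp add: toeplitz_def)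
    ultimately have 0: "L2_inner (\<lambda>\<zeta>. conj_symbol a \<zeta> * bdry g \<zeta> - conj_symbol a \<zeta> * bdry h \<zeta>) (bdry u) = 0"
      by (simp add: L2_inner_diff_left[OF L[OF g] L[OF h] bdry_L2[OF u]])
    note [measurable] = L2_measurable[OF bdry_L2[OF g]] L2_measurable[OF bdry_L2[OF h]] L2_measurable[OF bdry_L2[OF u]]
      L2_measurable[OF bdry_L2[OF gh]] L2_measurable[OF bdry_L2[OF Hinf_subset_H2[OF a]]]
    have "(\<integral>\<zeta>. cnj (bdry a \<zeta>) * bdry (\<lambda>z. g z - h z) \<zeta> * cnj (bdry u \<zeta>) \<partial>circle_measure)
       = L2_inner (\<lambda>\<zeta>. conj_symbol a \<zeta> * bdry g \<zeta> - conj_symbol a \<zeta> * bdry h \<zeta>) (bdry u)"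
      unfolding L2_inner_def conj_symbol_def
    proof (rule integral_cong_AE)
      show "AE \<zeta> in circle_measure. cnj (bdry a \<zeta>) * bdry (\<lambda>z. g z - h z) \<zeta> * cnj (bdry u \<zeta>)
        = (cnj (bdry a \<zeta>) * bdry g \<zeta> - cnj (bdry a \<zeta>) * bdry h \<zeta>) * cnj (bdry u \<zeta>)"
        using bdry_diff[OF g h] by eventually_elim (simp only: right_diff_distrib)
    qed measurable
    with 0 show "(\<integral>\<zeta>. cnj (bdry a \<zeta>) * bdry (\<lambda>z. g z - h z) \<zeta> * cnj (bdry u \<zeta>) \<partial>circle_measure) = 0" by simp
  qed
  then show "g = h" by (simp add: fun_eq_iff)
qed

subsection \<open>Boundary kernels\<close>

text \<open>Fatou's lemma on each circle of radius r < 1, where the pointwise limit is available;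
  there the means are bounded by those on the boundary.\<close>

lemma H2_pointwise_limit:
  assumes F: "disk_analytic F" and f: "\<And>n::nat. f n \<in> H2" and B: "\<And>n. L2_sq (bdry (f n)) \<le> B"
    and lim: "\<And>z. cmod z < 1 \<Longrightarrow> (\<lambda>n. f n z) \<longlonglongrightarrow> F z"
  shows "F \<in> H2"
proof -
  have B0: "0 \<le> B" using B[of 0] L2_sq_nonneg[of "bdry (f 0)"] by linarith
  have "L2_sq (\<lambda>\<zeta>. F (of_real r * \<zeta>)) \<le> B" if r: "0 \<le> r" "r < 1" for r
  proof -
    note df = H2_disk_analytic[OF f]
    note [measurable] = dilate_measurable[OF df] dilate_measurable[OF F]
    have "ennreal (L2_sq (\<lambda>\<zeta>. F (of_real r * \<zeta>))) = (\<integral>\<^sup>+\<zeta>. ennreal ((cmod (F (of_real r * \<zeta>)))\<^sup>2) \<partial>circle_measure)"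
      by (rule nn_integral_L2_sq [symmetric]) (rule dilate_L2[OF F r])
    also have "\<dots> = (\<integral>\<^sup>+\<zeta>. liminf (\<lambda>n. ennreal ((cmod (f n (of_real r * \<zeta>)))\<^sup>2)) \<partial>circle_measure)"
    proof (rule nn_integral_cong_AE)
      show "AE \<zeta> in circle_measure. ennreal ((cmod (F (of_real r * \<zeta>)))\<^sup>2) = liminf (\<lambda>n. ennreal ((cmod (f n (of_real r * \<zeta>)))\<^sup>2))"
        using AE_circle_norm
      proof eventually_elim
        case (elim \<zeta>)
        have "(\<lambda>n. ennreal ((cmod (f n (of_real r * \<zeta>)))\<^sup>2)) \<longlonglongrightarrow> ennreal ((cmod (F (of_real r * \<zeta>)))\<^sup>2)"
          using r elim by (intro tendsto_ennrealI tendsto_intros lim dilate_norm_less) auto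
        then show ?case by (intro lim_imp_Liminf [symmetric]) auto
      qed
    qed
    also have "\<dots> \<le> liminf (\<lambda>n. \<integral>\<^sup>+\<zeta>. ennreal ((cmod (f n (of_real r * \<zeta>)))\<^sup>2) \<partial>circle_measure)"
      by (rule nn_integral_liminf) measurable
    also have "\<dots> \<le> ennreal B"
    proof (rule Liminf_le)
      show "\<forall>\<^sub>F n in sequentially. (\<integral>\<^sup>+\<zeta>. ennreal ((cmod (f n (of_real r * \<zeta>)))\<^sup>2) \<partial>circle_measure) \<le> ennreal B"
        unfolding nn_integral_L2_sq[OF dilate_L2[OF df r]]
        using order_trans[OF L2_sq_dilate_le_bdry[OF f r] B] by (auto intro!: always_eventually ennreal_leI)
    qed simp
    finally show ?thesis using B0 by (simp add: ennreal_le_iff)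
  qed
  then show ?thesis using F by (auto simp: H2_iff_bounded)
qed

text \<open>1 - w is the sum of 1 - r w and r w - w, and the latter has modulus 1 - r, which is at
  most |1 - r w|.\<close>

lemma one_minus_scaled_lower_bound:
  assumes "cmod w = 1" "0 \<le> r" "r \<le> 1"
  shows "cmod (1 - w) \<le> 2 * cmod (1 - of_real r * w)"
proof -
  have "cmod (of_real r * w) = r" using assms by (simp add: norm_mult)
  then have "1 - r \<le> cmod (1 - of_real r * w)" using norm_triangle_ineq2[of 1 "of_real r * w"] by simp
  moreover have "cmod (of_real r * w - w) = 1 - r"
  proof -
    have "of_real r * w - w = of_real (r - 1) * w" by (simp add: algebra_simps)
    then show ?thesis using assms by (simp only: norm_mult norm_of_real) simp
  qed
  moreover have "cmod (1 - w) \<le> cmod (1 - of_real r * w) + cmod (of_real r * w - w)"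
    using norm_triangle_ineq[of "1 - of_real r * w" "of_real r * w - w"] by simp
  ultimately show ?thesis by simp
qed

lemma cmod_one_minus_cnj_mult:
  assumes "cmod \<zeta> = 1"
  shows "cmod (1 - cnj z * \<zeta>) = cmod (\<zeta> - z)"
proof -
  have u: "\<zeta> * cnj \<zeta> = 1" using assms by (rule unimodular_mult_cnj)
  have "\<zeta> * cnj (\<zeta> - z) = 1 - cnj z * \<zeta>" using u by (simp add: algebra_simps)
  then have "cmod (1 - cnj z * \<zeta>) = cmod \<zeta> * cmod (cnj (\<zeta> - z))" by (metis norm_mult)
  then show ?thesis using assms by (simp only: complex_mod_cnj)
qed

text \<open>The exponent 2 N + 2 is the square of the power N + 1, so the condition is the case l =
  N. Each power removed from the denominator costs a factor of at most 2, the diameter of the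
  circle.\<close>

lemma AC_condition_integrable:
  assumes a: "a \<in> Hinf" and z0: "cmod \<zeta>\<^sub>0 = 1" and ac: "AC_condition a N \<zeta>\<^sub>0" and l: "l \<le> N"
  shows "(\<lambda>\<zeta>. bdry a \<zeta> / (1 - cnj \<zeta>\<^sub>0 * \<zeta>) ^ Suc l) \<in> L2"
proof -
  note [measurable] = L2_measurable[OF bdry_L2[OF Hinf_subset_H2[OF a]]]
  define V where "V l \<zeta> = bdry a \<zeta> / (1 - cnj \<zeta>\<^sub>0 * \<zeta>) ^ Suc l" for l \<zeta>
  have [measurable]: "V l \<in> borel_measurable borel" for l unfolding V_def by measurable
  have "(cmod (V N (cis t)))\<^sup>2 = (cmod (bdry a (cis t)))\<^sup>2 / cmod (cis t - \<zeta>\<^sub>0) ^ (2 * N + 2)" for t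
    by (simp add: V_def norm_divide norm_power cmod_one_minus_cnj_mult power_divide power_mult [symmetric] del: power_Suc)
       (simp add: mult.commute)
  then have "(\<integral>\<^sup>+t\<in>{0..2 * pi}. ennreal ((cmod (V N (cis t)))\<^sup>2) \<partial>lborel) < \<infinity>"
    using ac by (simp add: AC_condition_def)
  then have "(\<integral>\<^sup>+\<zeta>. ennreal ((cmod (V N \<zeta>))\<^sup>2) \<partial>circle_measure) < \<infinity>"
    by (subst (asm) nn_integral_circle') (auto simp: ennreal_mult_less_top)
  then have "integrable circle_measure (\<lambda>\<zeta>. (cmod (V N \<zeta>))\<^sup>2)"
    by (intro integrableI_nonneg) auto
  then have N: "V N \<in> L2" by (simp add: L2_def)
  have "V l \<in> L2"
  proof (rule L2_dominated[OF _ N])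
    show "AE \<zeta> in circle_measure. cmod (V l \<zeta>) \<le> 2 ^ (N - l) * cmod (V N \<zeta>)"
      using AE_circle_norm AE_circle_neq[of \<zeta>\<^sub>0]
    proof eventually_elim
      case (elim \<zeta>)
      have nz: "1 - cnj \<zeta>\<^sub>0 * \<zeta> \<noteq> 0" using cmod_one_minus_cnj_mult[OF elim(1), of \<zeta>\<^sub>0] elim by auto
      have "cmod (1 - cnj \<zeta>\<^sub>0 * \<zeta>) \<le> 2"
        using norm_triangle_ineq4[of 1 "cnj \<zeta>\<^sub>0 * \<zeta>"] z0 elim by (simp add: norm_mult)
      then have le: "cmod ((1 - cnj \<zeta>\<^sub>0 * \<zeta>) ^ (N - l)) \<le> 2 ^ (N - l)" by (simp add: norm_power power_mono)
      have "(1 - cnj \<zeta>\<^sub>0 * \<zeta>) ^ Suc N = (1 - cnj \<zeta>\<^sub>0 * \<zeta>) ^ Suc l * (1 - cnj \<zeta>\<^sub>0 * \<zeta>) ^ (N - l)"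
        using l by (simp only: power_add [symmetric]) simp
      then have "V l \<zeta> = (1 - cnj \<zeta>\<^sub>0 * \<zeta>) ^ (N - l) * V N \<zeta>"
        using nz by (simp add: V_def del: power_Suc)
      then show ?case using le by (simp add: norm_mult mult_right_mono)
    qed
  qed measurable
  then show ?thesis by (simp add: V_def[abs_def])
qed

text \<open>The denominators are replaced by \<open>1 - r * cnj \<zeta>\<^sub>0 * z\<close> with \<open>r < 1\<close>; on the circle this at most
  doubles the quotient for each factor, so the norms stay bounded as \<open>r\<close> tends to 1.\<close>

lemma AC_quotient_H2:
  assumes a: "a \<in> Hinf" and z0: "cmod \<zeta>\<^sub>0 = 1"
    and V: "(\<lambda>\<zeta>. bdry a \<zeta> / (1 - cnj \<zeta>\<^sub>0 * \<zeta>) ^ n) \<in> L2"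
  shows "(\<lambda>z. a z * inv_power \<zeta>\<^sub>0 n z) \<in> H2"
proof -
  define \<rho> :: "nat \<Rightarrow> real" where "\<rho> k = 1 - 1 / real (Suc k)" for k
  have \<rho>: "0 \<le> \<rho> k" "\<rho> k < 1" for k by (auto simp: \<rho>_def)
  have \<rho>lim: "\<rho> \<longlonglongrightarrow> 1" using filterlim_radii unfolding \<rho>_def by (simp add: filterlim_at)
  define f where "f k z = a z * inv_power (of_real (\<rho> k) * \<zeta>\<^sub>0) n z" for k z
  have zk: "cmod (of_real (\<rho> k) * \<zeta>\<^sub>0) < 1" for k using \<rho> z0 by (simp add: norm_mult)
  have aH: "a \<in> H2" and da: "disk_analytic a" using a Hinf_subset_H2 H2_disk_analytic by auto
  have pH: "inv_power (of_real (\<rho> k) * \<zeta>\<^sub>0) n \<in> H2" for k by (intro Hinf_subset_H2 inv_power_Hinf zk)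
  have f: "f k \<in> H2" for k unfolding f_def by (intro Hinf_mult_H2 a pH)
  have sq: "L2_sq (bdry (f k)) \<le> (2 ^ n)\<^sup>2 * L2_sq (\<lambda>\<zeta>. bdry a \<zeta> / (1 - cnj \<zeta>\<^sub>0 * \<zeta>) ^ n)" for k
  proof -
    have "AE \<zeta> in circle_measure. (cmod (bdry (f k) \<zeta>))\<^sup>2 \<le> (2 ^ n)\<^sup>2 * (cmod (bdry a \<zeta> / (1 - cnj \<zeta>\<^sub>0 * \<zeta>) ^ n))\<^sup>2"
      using AE_circle_norm AE_circle_neq[of \<zeta>\<^sub>0] H2_radial_limit[OF aH]
    proof eventually_elim
      case (elim \<zeta>)
      have nz: "1 - cnj \<zeta>\<^sub>0 * \<zeta> \<noteq> 0" using cmod_one_minus_cnj_mult[OF elim(1), of \<zeta>\<^sub>0] elim by auto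
      define d where "d = 1 - cnj (of_real (\<rho> k) * \<zeta>\<^sub>0) * \<zeta>"
      have d0: "d \<noteq> 0" using one_minus_cnj_mult_nonzero[of "of_real (\<rho> k) * \<zeta>\<^sub>0" \<zeta>] zk[of k] elim by (auto simp: d_def)
      have le: "cmod (1 - cnj \<zeta>\<^sub>0 * \<zeta>) \<le> 2 * cmod d"
        using one_minus_scaled_lower_bound[of "cnj \<zeta>\<^sub>0 * \<zeta>" "\<rho> k"] elim z0 \<rho>[of k] by (simp add: d_def norm_mult mult_ac)
      have "bdry (f k) \<zeta> = bdry a \<zeta> * (1 / d ^ n)"
        unfolding f_def d_def by (intro bdry_eqI tendsto_mult elim inv_power_radial) (use d0 in \<open>simp add: d_def\<close>)
      moreover have "1 / cmod d ^ n \<le> 2 ^ n / cmod (1 - cnj \<zeta>\<^sub>0 * \<zeta>) ^ n"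
      proof -
        have "cmod (1 - cnj \<zeta>\<^sub>0 * \<zeta>) ^ n \<le> 2 ^ n * cmod d ^ n"
          using power_mono[OF le, of n] by (simp add: power_mult_distrib)
        then show ?thesis using d0 nz by (simp add: field_simps)
      qed
      ultimately have "cmod (bdry (f k) \<zeta>) \<le> 2 ^ n * cmod (bdry a \<zeta> / (1 - cnj \<zeta>\<^sub>0 * \<zeta>) ^ n)"
        using mult_left_mono[of "1 / cmod d ^ n" "2 ^ n / cmod (1 - cnj \<zeta>\<^sub>0 * \<zeta>) ^ n" "cmod (bdry a \<zeta>)"]
        by (simp add: norm_mult norm_divide norm_power mult_ac)
      then show ?case by (simp only: power_mult_distrib [symmetric]) (rule power_mono, auto)
    qed
    then have "L2_sq (bdry (f k)) \<le> (\<integral>\<zeta>. (2 ^ n)\<^sup>2 * (cmod (bdry a \<zeta> / (1 - cnj \<zeta>\<^sub>0 * \<zeta>) ^ n))\<^sup>2 \<partial>circle_measure)"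
      unfolding L2_sq_def
      by (intro integral_mono_AE integrable_mult_right L2_integrable_sq V bdry_L2 f)
    then show ?thesis by (simp add: L2_sq_def)
  qed
  show ?thesis
  proof (rule H2_pointwise_limit[OF _ f sq])
    show "disk_analytic (\<lambda>z. a z * inv_power \<zeta>\<^sub>0 n z)"
      using z0 by (intro disk_analytic_mult da disk_analytic_inv_power) simp
    fix z :: complex assume z: "cmod z < 1"
    have "1 - cnj \<zeta>\<^sub>0 * z \<noteq> 0" using one_minus_cnj_mult_nonzero[of \<zeta>\<^sub>0 z] z z0 by simp
    then have "(\<lambda>k. a z * (1 / (1 - cnj (of_real (\<rho> k) * \<zeta>\<^sub>0) * z) ^ n)) \<longlonglongrightarrow> a z * (1 / (1 - cnj (of_real 1 * \<zeta>\<^sub>0) * z) ^ n)"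
      by (intro tendsto_intros \<rho>lim) auto
    then show "(\<lambda>k. f k z) \<longlonglongrightarrow> a z * inv_power \<zeta>\<^sub>0 n z"
      using z by (simp add: f_def inv_power_def)
  qed
qed

section \<open>Non-tangential approach\<close>

lemma stolz_islimpt:
  assumes "cmod \<zeta>\<^sub>0 = 1" "1 < \<alpha>"
  shows "\<zeta>\<^sub>0 islimpt stolz_region \<alpha> \<zeta>\<^sub>0"
  unfolding islimpt_approachable
proof (intro allI impI)
  fix e :: real assume e: "0 < e"
  define \<delta> where "\<delta> = min (e / 2) (1 / 2)"
  have \<delta>: "0 < \<delta>" "\<delta> < e" "\<delta> < 1" using e by (auto simp: \<delta>_def)
  \<comment> \<open>A point on the radius: its distances to the circle and to
    \<open>\<zeta>\<^sub>0\<close> are both \<delta>, so \<alpha> > 1 puts it into the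
    region.\<close>
  let ?x = "of_real (1 - \<delta>) * \<zeta>\<^sub>0"
  have nx: "cmod ?x = 1 - \<delta>" using \<delta> assms by (simp add: norm_mult del: of_real_diff)
  have "?x - \<zeta>\<^sub>0 = of_real (- \<delta>) * \<zeta>\<^sub>0" by (simp add: algebra_simps)
  then have d: "cmod (?x - \<zeta>\<^sub>0) = \<delta>" using \<delta> assms by (simp only: norm_mult norm_of_real)
  have "?x \<in> stolz_region \<alpha> \<zeta>\<^sub>0"
    unfolding stolz_region_def using nx d \<delta> assms by simp
  moreover have "?x \<noteq> \<zeta>\<^sub>0" using d \<delta> by auto
  moreover have "dist ?x \<zeta>\<^sub>0 < e" using d \<delta> by (simp add: dist_norm)
  ultimately show "\<exists>x'\<in>stolz_region \<alpha> \<zeta>\<^sub>0. x' \<noteq> \<zeta>\<^sub>0 \<and> dist x' \<zeta>\<^sub>0 < e" by blast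
qed

lemma has_nt_limit_unique:
  assumes "cmod \<zeta>\<^sub>0 = 1" "has_nt_limit f \<zeta>\<^sub>0 L" "has_nt_limit f \<zeta>\<^sub>0 L'"
  shows "L = L'"
proof (rule tendsto_unique[of "at \<zeta>\<^sub>0 within stolz_region 2 \<zeta>\<^sub>0" f])
  show "at \<zeta>\<^sub>0 within stolz_region 2 \<zeta>\<^sub>0 \<noteq> bot"
    using stolz_islimpt[OF assms(1), of 2] by (simp add: trivial_limit_within)
qed (use assms(2,3) in \<open>simp_all add: has_nt_limit_def\<close>)

text \<open>The distance from \<zeta> to \<open>\<zeta>\<^sub>0\<close> is at most |\<zeta> - z|
  plus a number below \<alpha> (1 - |z|), and 1 - |z| is itself at most |\<zeta> - z|.\<close>

lemma stolz_kernel_bound: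
  assumes "z \<in> stolz_region \<alpha> \<zeta>\<^sub>0" "cmod \<zeta> = 1" "0 \<le> \<alpha>"
  shows "cmod (1 - cnj \<zeta>\<^sub>0 * \<zeta>) \<le> (1 + \<alpha>) * cmod (1 - cnj z * \<zeta>)"
proof -
  have "1 - cmod z \<le> cmod (\<zeta> - z)" using norm_triangle_ineq2[of \<zeta> z] assms by simp
  then have "\<alpha> * (1 - cmod z) \<le> \<alpha> * cmod (\<zeta> - z)" using assms by (intro mult_left_mono)
  moreover have "cmod (\<zeta> - \<zeta>\<^sub>0) \<le> cmod (\<zeta> - z) + cmod (z - \<zeta>\<^sub>0)"
    using norm_triangle_ineq[of "\<zeta> - z" "z - \<zeta>\<^sub>0"] by simp
  ultimately show ?thesis
    using assms unfolding cmod_one_minus_cnj_mult[OF assms(2)] by (simp add: stolz_region_def algebra_simps)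
qed

lemma zero_H2: "(\<lambda>_. 0) \<in> H2"
  by (intro Hinf_subset_H2 HinfI[of _ 0]) (auto simp: disk_analytic_def)

lemma bdry_zero [simp]: "bdry (\<lambda>_. 0) \<zeta> = 0"
  by (intro bdry_eqI tendsto_const)

section \<open>The boundary kernel and its preimage\<close>

context
  fixes a :: "complex \<Rightarrow> complex" and \<zeta>\<^sub>0 :: complex and l :: nat
  assumes a: "a \<in> Hinf" and outer: "outer_fun a" and z0: "cmod \<zeta>\<^sub>0 = 1"
    and V: "(\<lambda>z. a z * inv_power \<zeta>\<^sub>0 (Suc l) z) \<in> H2"
begin

definition kernel_preimage :: "complex \<Rightarrow> complex" where
  "kernel_preimage z = a z * szego_deriv \<zeta>\<^sub>0 l z"

lemma kernel_preimage_H2: "kernel_preimage \<in> H2"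
proof -
  have "kernel_preimage = (\<lambda>z. monomial l z * (a z * inv_power \<zeta>\<^sub>0 (Suc l) z))"
    by (simp add: kernel_preimage_def[abs_def] szego_deriv_def mult_ac)
  then show ?thesis using Hinf_mult_H2[OF monomial_Hinf V] by simp
qed

lemma bdry_kernel_preimage:
  "AE \<zeta> in circle_measure. bdry (\<lambda>z. a z * inv_power \<zeta>\<^sub>0 (Suc l) z) \<zeta> = bdry a \<zeta> / (1 - cnj \<zeta>\<^sub>0 * \<zeta>) ^ Suc l \<and>
     bdry kernel_preimage \<zeta> = bdry a \<zeta> * (fact l * \<zeta> ^ l / (1 - cnj \<zeta>\<^sub>0 * \<zeta>) ^ Suc l)"
  using AE_circle_norm AE_circle_neq[of \<zeta>\<^sub>0] H2_radial_limit[OF Hinf_subset_H2[OF a]]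
proof eventually_elim
  case (elim \<zeta>)
  have nz: "1 - cnj \<zeta>\<^sub>0 * \<zeta> \<noteq> 0" using cmod_one_minus_cnj_mult[OF elim(1), of \<zeta>\<^sub>0] elim by auto
  have "bdry (\<lambda>z. a z * inv_power \<zeta>\<^sub>0 (Suc l) z) \<zeta> = bdry a \<zeta> * (1 / (1 - cnj \<zeta>\<^sub>0 * \<zeta>) ^ Suc l)"
    by (intro bdry_eqI tendsto_mult elim inv_power_radial nz)
  moreover have "bdry kernel_preimage \<zeta> = bdry a \<zeta> * (fact l * \<zeta> ^ l * (1 / (1 - cnj \<zeta>\<^sub>0 * \<zeta>) ^ Suc l))"
    unfolding kernel_preimage_def[abs_def] szego_deriv_def
    by (intro bdry_eqI tendsto_mult elim monomial_radial inv_power_radial nz)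
  ultimately show ?case by (simp del: power_Suc)
qed

text \<open>On the circle, \<open>\<zeta>\<^sup>l / (1 - cnj \<zeta>\<^sub>0 * \<zeta>)\<^sup>l\<^sup>+\<^sup>1\<close> is a constant times the conjugate of
  \<open>\<zeta> / (1 - cnj \<zeta>\<^sub>0 * \<zeta>)\<^sup>l\<^sup>+\<^sup>1\<close>, so \<open>cnj a / a\<close> times the boundary function is conjugate analytic.\<close>

lemma kernel_preimage_in_ker: "kernel_preimage \<in> toeplitz_ker (conj_quot_symbol a)"
proof -
  define W where "W z = a z * inv_power \<zeta>\<^sub>0 (Suc l) z" for z
  have W: "W \<in> H2" using V unfolding W_def .
  define \<phi> where "\<phi> \<zeta> = conj_quot_symbol a \<zeta> * bdry kernel_preimage \<zeta>" for \<zeta>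
  \<comment> \<open>The factorial of the kernel and the unimodular constant produced by conjugating
    the denominator l + 1 times.\<close>
  define \<kappa> where "\<kappa> = fact l * (- \<zeta>\<^sub>0) ^ Suc l"
  note [measurable] = L2_measurable[OF bdry_L2[OF Hinf_subset_H2[OF a]]]
  have \<phi>L: "\<phi> \<in> L2"
    unfolding \<phi>_def
  proof (rule L2_bounded_mult[OF _ _ bdry_L2[OF kernel_preimage_H2]])
    show "conj_quot_symbol a \<in> borel_measurable borel" unfolding conj_quot_symbol_def[abs_def] by measurable
    \<comment> \<open>The modulus is 1, or 0 where \<open>bdry a\<close> vanishes, since division by
      zero yields 0; so the bound holds at every point.\<close>
    show "AE \<zeta> in circle_measure. cmod (conj_quot_symbol a \<zeta>) \<le> 1"
      by (intro AE_I2) (simp add: conj_quot_symbol_def norm_divide)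
  qed
  have \<phi>W: "AE \<zeta> in circle_measure. \<phi> \<zeta> = \<kappa> * cnj (\<zeta> * bdry W \<zeta>)"
  proof -
    have "AE \<zeta> in circle_measure. bdry a \<zeta> \<noteq> 0" using outer by (simp add: outer_fun_def)
    then show ?thesis using bdry_kernel_preimage AE_circle_norm AE_circle_neq[of \<zeta>\<^sub>0]
    proof eventually_elim
      case (elim \<zeta>)
      define q where "q = 1 - cnj \<zeta>\<^sub>0 * \<zeta>"
      have q: "q \<noteq> 0" using cmod_one_minus_cnj_mult[OF elim(3), of \<zeta>\<^sub>0] elim by (auto simp: q_def)
      have u: "\<zeta> * cnj \<zeta> = 1" "\<zeta>\<^sub>0 * cnj \<zeta>\<^sub>0 = 1"
        using elim z0 by (simp_all add: unimodular_mult_cnj)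
      have "- \<zeta>\<^sub>0 * cnj \<zeta> * q = (\<zeta>\<^sub>0 * cnj \<zeta>\<^sub>0) * (\<zeta> * cnj \<zeta>) - \<zeta>\<^sub>0 * cnj \<zeta>" by (simp add: q_def algebra_simps)
      then have cq: "cnj q = - \<zeta>\<^sub>0 * cnj \<zeta> * q" unfolding u by (simp add: q_def)
      have pw: "\<zeta> ^ l * cnj \<zeta> ^ Suc l = cnj \<zeta>"
      proof -
        have "\<zeta> ^ l * cnj \<zeta> ^ Suc l = (\<zeta> * cnj \<zeta>) ^ l * cnj \<zeta>" by (simp add: power_mult_distrib mult_ac)
        then show ?thesis by (simp add: u)
      qed
      have "\<zeta> ^ l * cnj q ^ Suc l = (- \<zeta>\<^sub>0) ^ Suc l * (\<zeta> ^ l * cnj \<zeta> ^ Suc l) * q ^ Suc l"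
        unfolding cq by (simp only: power_mult_distrib mult_ac)
      then have main: "\<zeta> ^ l / q ^ Suc l = (- \<zeta>\<^sub>0) ^ Suc l * cnj \<zeta> / cnj q ^ Suc l"
        unfolding pw using q by (simp add: frac_eq_eq del: power_Suc)
      have "\<phi> \<zeta> = cnj (bdry a \<zeta>) * (fact l * (\<zeta> ^ l / q ^ Suc l))"
        using elim by (simp add: \<phi>_def conj_quot_symbol_def q_def del: power_Suc)
      also have "\<dots> = \<kappa> * cnj (\<zeta> * (bdry a \<zeta> / q ^ Suc l))"
        unfolding main by (simp add: \<kappa>_def del: power_Suc)
      finally show ?case using elim unfolding W_def q_def by simp
    qed
  qed
  have o: "L2_inner \<phi> (bdry w) = 0" if w: "w \<in> H2" for w
  proof -
    note [measurable] = L2_measurable[OF \<phi>L] L2_measurable[OF bdry_L2[OF w]] L2_measurable[OF bdry_L2[OF W]]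
    have "L2_inner \<phi> (bdry w) = (\<integral>\<zeta>. \<kappa> * cnj (\<zeta> * (bdry W \<zeta> * bdry w \<zeta>)) \<partial>circle_measure)"
      unfolding L2_inner_def
    proof (rule integral_cong_AE)
      show "AE \<zeta> in circle_measure. \<phi> \<zeta> * cnj (bdry w \<zeta>) = \<kappa> * cnj (\<zeta> * (bdry W \<zeta> * bdry w \<zeta>))"
        using \<phi>W by eventually_elim (simp add: mult_ac)
    qed measurable
    also have "\<dots> = \<kappa> * cnj (\<integral>\<zeta>. \<zeta> * (bdry W \<zeta> * bdry w \<zeta>) \<partial>circle_measure)"
      by (simp only: integral_mult_right_zero Bochner_Integration.integral_cnj)
    finally show ?thesis by (simp add: H2_mult_mean_zero[OF W w])
  qed
  have "P_plus \<phi> = (\<lambda>_. 0)"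
    by (rule P_plus_eqI[OF \<phi>L zero_H2]) (use o in simp)
  then show ?thesis
    using kernel_preimage_H2 by (simp add: toeplitz_ker_def toeplitz_def \<phi>_def[abs_def])
qed

lemma toeplitz_conj_nt_limit:
  assumes g: "g \<in> H2"
  shows "has_nt_limit ((deriv ^^ l) (toeplitz (conj_symbol a) g)) \<zeta>\<^sub>0 (H2_inner g kernel_preimage)"
  unfolding has_nt_limit_def
proof (intro allI impI)
  fix \<alpha> :: real assume \<alpha>: "1 < \<alpha>"
  note aH = Hinf_subset_H2[OF a]
  define W where "W z = a z * inv_power \<zeta>\<^sub>0 (Suc l) z" for z
  have W: "W \<in> H2" using V unfolding W_def .
  define K where "K z \<zeta> = fact l * \<zeta> ^ l / (1 - cnj z * \<zeta>) ^ Suc l" for z \<zeta>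
  have [measurable]: "K z \<in> borel_measurable borel" for z unfolding K_def by measurable
  note [measurable] = L2_measurable[OF bdry_L2[OF aH]] L2_measurable[OF bdry_L2[OF g]]
    L2_measurable[OF bdry_L2[OF W]] L2_measurable[OF bdry_L2[OF kernel_preimage_H2]]
  have deriv: "(deriv ^^ l) (toeplitz (conj_symbol a) g) z = (\<integral>\<zeta>. bdry g \<zeta> * cnj (bdry a \<zeta> * K z \<zeta>) \<partial>circle_measure)"
    if z: "cmod z < 1" for z
  proof -
    have L: "(\<lambda>\<zeta>. conj_symbol a \<zeta> * bdry g \<zeta>) \<in> L2" by (intro conj_symbol_mult_L2 a bdry_L2 g)
    have "(deriv ^^ l) (toeplitz (conj_symbol a) g) z
       = L2_inner (\<lambda>\<zeta>. conj_symbol a \<zeta> * bdry g \<zeta>) (bdry (szego_deriv z l))"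
      unfolding toeplitz_def using P_plus_projection[OF L] by (intro projection_deriv L z) auto
    also have "\<dots> = (\<integral>\<zeta>. bdry g \<zeta> * cnj (bdry a \<zeta> * K z \<zeta>) \<partial>circle_measure)"
      unfolding L2_inner_def
    proof (rule integral_cong_AE)
      note [measurable] = L2_measurable[OF bdry_L2[OF Hinf_subset_H2[OF szego_deriv_Hinf[OF z, of l]]]]
      show "(\<lambda>\<zeta>. conj_symbol a \<zeta> * bdry g \<zeta> * cnj (bdry (szego_deriv z l) \<zeta>)) \<in> borel_measurable circle_measure"
        unfolding conj_symbol_def by measurable
      show "AE \<zeta> in circle_measure. conj_symbol a \<zeta> * bdry g \<zeta> * cnj (bdry (szego_deriv z l) \<zeta>)
        = bdry g \<zeta> * cnj (bdry a \<zeta> * K z \<zeta>)"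
        using AE_circle_norm by eventually_elim (simp add: conj_symbol_def K_def bdry_szego_deriv_inside[OF z] mult_ac del: power_Suc)
    qed measurable
    finally show ?thesis .
  qed
  have inner: "H2_inner g kernel_preimage = (\<integral>\<zeta>. bdry g \<zeta> * cnj (bdry a \<zeta> * K \<zeta>\<^sub>0 \<zeta>) \<partial>circle_measure)"
    unfolding H2_inner_def L2_inner_def
  proof (rule integral_cong_AE)
    show "AE \<zeta> in circle_measure. bdry g \<zeta> * cnj (bdry kernel_preimage \<zeta>) = bdry g \<zeta> * cnj (bdry a \<zeta> * K \<zeta>\<^sub>0 \<zeta>)"
      using bdry_kernel_preimage by eventually_elim (simp add: K_def)
  qed measurable
  show "((deriv ^^ l) (toeplitz (conj_symbol a) g) \<longlongrightarrow> H2_inner g kernel_preimage) (at \<zeta>\<^sub>0 within stolz_region \<alpha> \<zeta>\<^sub>0)"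
    \<comment> \<open>Dominated convergence is applied along sequences in the Stolz region.\<close>
    unfolding tendsto_at_iff_sequentially
  proof (intro allI impI)
    fix X assume X: "\<forall>i. X i \<in> stolz_region \<alpha> \<zeta>\<^sub>0 - {\<zeta>\<^sub>0}" and lim: "X \<longlonglongrightarrow> \<zeta>\<^sub>0"
    have X1: "cmod (X i) < 1" for i using X by (auto simp: stolz_region_def)
    have "(\<lambda>i. \<integral>\<zeta>. bdry g \<zeta> * cnj (bdry a \<zeta> * K (X i) \<zeta>) \<partial>circle_measure) \<longlonglongrightarrow>
       (\<integral>\<zeta>. bdry g \<zeta> * cnj (bdry a \<zeta> * K \<zeta>\<^sub>0 \<zeta>) \<partial>circle_measure)"
    \<comment> \<open>\<open>stolz_kernel_bound\<close>, raised to the power l + 1, replaces the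
      moving denominator by the one at \<open>\<zeta>\<^sub>0\<close>. The majorant does not depend
      on i and is integrable as a product of two L2 functions.\<close>
    proof (rule integral_dominated_convergence[where w="\<lambda>\<zeta>. fact l * (1 + \<alpha>) ^ Suc l * (cmod (bdry g \<zeta>) * cmod (bdry W \<zeta>))"])
      show "integrable circle_measure (\<lambda>\<zeta>. fact l * (1 + \<alpha>) ^ Suc l * (cmod (bdry g \<zeta>) * cmod (bdry W \<zeta>)))"
        by (intro integrable_mult_right L2_norm_mult_integrable bdry_L2 g W)
      show "AE \<zeta> in circle_measure. (\<lambda>i. bdry g \<zeta> * cnj (bdry a \<zeta> * K (X i) \<zeta>)) \<longlonglongrightarrow> bdry g \<zeta> * cnj (bdry a \<zeta> * K \<zeta>\<^sub>0 \<zeta>)"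
        using AE_circle_norm AE_circle_neq[of \<zeta>\<^sub>0]
      proof eventually_elim
        case (elim \<zeta>)
        have nz: "1 - cnj \<zeta>\<^sub>0 * \<zeta> \<noteq> 0" using cmod_one_minus_cnj_mult[OF elim(1), of \<zeta>\<^sub>0] elim by auto
        show ?case unfolding K_def using nz by (intro tendsto_intros lim) auto
      qed
      show "AE \<zeta> in circle_measure. norm (bdry g \<zeta> * cnj (bdry a \<zeta> * K (X i) \<zeta>))
         \<le> fact l * (1 + \<alpha>) ^ Suc l * (cmod (bdry g \<zeta>) * cmod (bdry W \<zeta>))" for i
        using AE_circle_norm AE_circle_neq[of \<zeta>\<^sub>0] bdry_kernel_preimage
      proof eventually_elim
        case (elim \<zeta>)
        define p q where "p = cmod (1 - cnj (X i) * \<zeta>) ^ Suc l" and "q = cmod (1 - cnj \<zeta>\<^sub>0 * \<zeta>) ^ Suc l"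
        have q0: "0 < q" using cmod_one_minus_cnj_mult[OF elim(1), of \<zeta>\<^sub>0] elim by (simp add: q_def del: power_Suc)
        have p0: "0 < p" using one_minus_cnj_mult_nonzero[of "X i" \<zeta>] X1[of i] elim by (simp add: p_def del: power_Suc)
        have "q \<le> (1 + \<alpha>) ^ Suc l * p"
          unfolding p_def q_def power_mult_distrib [symmetric]
          by (intro power_mono stolz_kernel_bound) (use X elim \<alpha> in auto)
        then have le: "1 / p \<le> (1 + \<alpha>) ^ Suc l * (1 / q)" using p0 q0 by (simp add: field_simps del: power_Suc)
        have Wq: "cmod (bdry W \<zeta>) = cmod (bdry a \<zeta>) * (1 / q)"
          using elim unfolding W_def[abs_def] q_def by (simp add: norm_divide norm_power del: power_Suc)
        have "norm (bdry g \<zeta> * cnj (bdry a \<zeta> * K (X i) \<zeta>)) = cmod (bdry g \<zeta>) * cmod (bdry a \<zeta> * K (X i) \<zeta>)"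
          by (simp only: norm_mult complex_mod_cnj)
        also have "\<dots> = fact l * cmod (bdry g \<zeta>) * cmod (bdry a \<zeta>) * (1 / p)"
          using elim(1) by (simp add: K_def p_def norm_mult norm_divide norm_power mult_ac del: power_Suc)
        also have "\<dots> \<le> fact l * cmod (bdry g \<zeta>) * cmod (bdry a \<zeta>) * ((1 + \<alpha>) ^ Suc l * (1 / q))"
          by (intro mult_left_mono le) auto
        finally show ?case unfolding Wq by (simp only: mult_ac)
      qed
    qed measurable
    then show "((deriv ^^ l) (toeplitz (conj_symbol a) g) \<circ> X) \<longlonglongrightarrow> H2_inner g kernel_preimage"
      unfolding inner o_def deriv[OF X1] .
  qed
qed

text \<open>Injectivity undoes \<open>inv_into\<close>, so \<open>range_inner\<close> becomes the
  inner product of preimages. The non-tangential limit then gives the representing property, and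
  uniqueness of such limits makes the description definite.\<close>

lemma range_kernel_eq: "range_kernel a \<zeta>\<^sub>0 l = toeplitz (conj_symbol a) kernel_preimage"
  unfolding range_kernel_def
proof (rule the_equality)
  let ?T = "toeplitz (conj_symbol a)"
  have inv: "inv_into H2 ?T (?T g) = g" if "g \<in> H2" for g
    by (rule inv_into_f_f[OF toeplitz_conj_inj[OF a outer] that])
  show "?T kernel_preimage \<in> range_space a \<and>
    (\<forall>f\<in>range_space a. has_nt_limit ((deriv ^^ l) f) \<zeta>\<^sub>0 (range_inner a f (?T kernel_preimage)))"
    using kernel_preimage_H2 toeplitz_conj_nt_limit by (auto simp: range_space_def range_inner_def inv)
  fix k assume k: "k \<in> range_space a \<and> (\<forall>f\<in>range_space a. has_nt_limit ((deriv ^^ l) f) \<zeta>\<^sub>0 (range_inner a f k))"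
  then obtain u where u: "u \<in> H2" "k = ?T u" by (auto simp: range_space_def)
  have eq: "H2_inner g u = H2_inner g kernel_preimage" if g: "g \<in> H2" for g
  proof (rule has_nt_limit_unique[OF z0 _ toeplitz_conj_nt_limit[OF g]])
    have "has_nt_limit ((deriv ^^ l) (?T g)) \<zeta>\<^sub>0 (range_inner a (?T g) (?T u))"
      using k g u by (auto simp: range_space_def)
    then show "has_nt_limit ((deriv ^^ l) (?T g)) \<zeta>\<^sub>0 (H2_inner g u)"
      by (simp add: range_inner_def inv g u)
  qed
  \<comment> \<open>The two functions have equal inner products with all of \<open>H2\<close>;
    testing with Szego kernels compares their values in the disk.\<close>
  have "u = kernel_preimage"
  proof (rule disk_analytic_eqI)
    fix z :: complex assume z: "cmod z < 1"
    have kH: "szego_deriv z 0 \<in> H2" by (intro Hinf_subset_H2 szego_deriv_Hinf z)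
    have cnj: "f z = cnj (H2_inner (szego_deriv z 0) f)" if "f \<in> H2" for f
      using H2_reproducing[OF that z, of 0]
      by (simp add: H2_inner_def L2_inner_def mult.commute flip: Bochner_Integration.integral_cnj)
    show "u z = kernel_preimage z" using eq[OF kH] cnj[OF u(1)] cnj[OF kernel_preimage_H2] by simp
  qed (use u kernel_preimage_H2 H2_disk_analytic in auto)
  then show "k = ?T kernel_preimage" using u by simp
qed

end

theorem proposition5p15:
  fixes a \<gamma> I :: "complex \<Rightarrow> complex" and N :: nat and \<zeta>\<^sub>0 :: complex
  assumes "a \<in> Hinf" and "outer_fun a"
    and "toeplitz_ker (conj_quot_symbol a) \<noteq> {\<lambda>_. 0}"
    and "extremal_fun (toeplitz_ker (conj_quot_symbol a)) \<gamma>"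
    and "inner_fun I" and "I 0 = 0"
    and "toeplitz_ker (conj_quot_symbol a) = mult_space \<gamma> (model_space I)"
    and "cmod \<zeta>\<^sub>0 = 1"
    and "AC_condition a N \<zeta>\<^sub>0"
  shows "\<forall>l\<le>N. range_kernel a \<zeta>\<^sub>0 l
           \<in> toeplitz (conj_symbol a) ` mult_space \<gamma> (model_space I)"
proof (intro allI impI)
  fix l assume "l \<le> N"
  then have V: "(\<lambda>z. a z * inv_power \<zeta>\<^sub>0 (Suc l) z) \<in> H2"
    using assms by (intro AC_quotient_H2 AC_condition_integrable)
  \<comment> \<open>Reading the assumed factorization from right to left turns the target into the
    image of the Toeplitz kernel, which contains the preimage.\<close>
  show "range_kernel a \<zeta>\<^sub>0 l \<in> toeplitz (conj_symbol a) ` mult_space \<gamma> (model_space I)"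
    unfolding range_kernel_eq[OF assms(1,2,8) V] assms(7) [symmetric]
    by (intro imageI kernel_preimage_in_ker assms V)
qed

end
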